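(* Let $n\ge 1$ and $M\ge 1$ be integers, let $\lambda\in\mathbb{C}$ with $\operatorname{Re}\lambda^2\ge 0$, let $a_j>0$ and $-\infty\le p_j<q_j\le+\infty$ for $j=1,\dots,n$. Put $\widetilde\eta_{2M}(x)=\pi^{-1/2}L^{(1/2)}_{M-1}(x^2)\,e^{-x^2}$ and let $u$ be the solution (in the sense described in the context) of $$(-\Delta+\lambda^2)\,u=\prod_{j=1}^n\chi_{(p_j,q_j)}(x_j)\,\widetilde\eta_{2M}(a_jx_j)\qquad\text{in }\mathbb{R}^n .$$ For $t>0$ and $x,y,p\in\mathbb{R}$ define $$F(t,x,y)=\sqrt{\frac{1+t}{t}}\Big(y-\frac{x}{1+t}\Big),$$ $$\mathcal{P}_M(t,x)=\sum_{k=0}^{M-1}\frac{1}{(1+t)^{k+1/2}}\,L^{(-1/2)}_k\Big(\frac{x^2}{1+t}\Big),$$ $$\mathcal{Q}_M(t,x,y)=2\sum_{k=1}^{M-1}\frac{(-1)^k}{k!\,4^k}\sum_{\ell=1}^{2k}\frac{(-1)^\ell}{t^{\ell/2}}\bigg(H_{2k-\ell}(y)\,H_{\ell-1}\Big(\frac{y-x}{\sqrt t}\Big)-\binom{2k}{\ell}H_{2k-\ell}\Big(\frac{x}{\sqrt{1+t}}\Big)\frac{H_{\ell-1}\big(F(t,x,y)\big)}{(1+t)^{k+1/2}}\bigg),$$ $$\Phi_M(x,t,p)=\frac{e^{-x^2/(1+t)}}{2\sqrt\pi}\Big(\operatorname{erfc}\big(F(t,x,p)\big)\,\mathcal{P}_M(t,x)-\frac{e^{-F^2(t,x,p)}}{\sqrt\pi}\,\mathcal{Q}_M(t,x,p)\Big).$$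 Then $\mathcal{P}_M$ and $\mathcal{Q}_M$ are polynomials in $x$ of degree $2M-2$ and $2M-3$, respectively (with $\mathcal{Q}_1=0$ when $M=1$). Moreover, if $n\ge 3$, then for $\mathbf{x}=(x_1,\dots,x_n)\in\mathbb{R}^n$ the solution $u$ is given by the one-dimensional integral $$u(\mathbf{x})=\frac14\int_0^\infty e^{-\lambda^2t/4}\prod_{j=1}^n\Big(\Phi_M(a_jx_j,a_j^2t,a_jp_j)-\Phi_M(a_jx_j,a_j^2t,a_jq_j)\Big)\,dt .$$ If $\operatorname{Re}\lambda^2>0$, then this representation is valid for all $n\ge 1$.
   Context: Notation: $\chi_{(p,q)}$ is the characteristic function of the interval $(p,q)$. $\operatorname{erfc}(x)=\frac{2}{\sqrt\pi}\int_x^\infty e^{-s^2}ds$. The generalized Laguerre polynomials are $L_k^{(\gamma)}(y)=\frac{e^{y}y^{-\gamma}}{k!}\big(\frac{d}{dy}\big)^k\big(e^{-y}y^{k+\gamma}\big)$, $\gamma>-1$, and the Hermite polynomials are $H_k(x)=(-1)^ke^{x^2}\frac{d^k}{dx^k}e^{-x^2}$. When $p=\pm\infty$, $\Phi_M(x,t,p)$ is understood as the limit of $\Phi_M(x,t,p')$ as $p'\to\pm\infty$. Meaning of "the solution": the solution of $(-\Delta+\lambda^2)u=g$ in $\mathbb{R}^n$ is the volume potential $u(\mathbf{x})=\int_{\mathbb{R}^n}\kappa_\lambda(\mathbf{x}-\mathbf{y})\,g(\mathbf{y})\,d\mathbf{y}$. Here, for $\lambda\neq0$, $$\kappa_\lambda(\mathbf{x})=\frac{1}{(2\pi)^{n/2}}\Big(\frac{|\mathbf{x}|}{\lambda}\Big)^{1-n/2}K_{n/2-1}(\lambda|\mathbf{x}|),$$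 with $K_\nu$ the modified Bessel function of the second kind, and, for $\lambda=0$ and $n\ge3$, $\kappa_0(\mathbf{x})=\frac{\Gamma(n/2-1)}{4\pi^{n/2}}|\mathbf{x}|^{2-n}$. Only $\lambda^2$ enters the equation; in $\kappa_\lambda$ the square root $\lambda$ of $\lambda^2$ with $\operatorname{Re}\lambda\ge0$ is used (principal branches). *)

theory Defs
  imports "HOL-Analysis.Analysis"
begin

section \<open>Special functions\<close>

definition erfc :: "real \<Rightarrow> real" where
  "erfc x = 2 / sqrt pi * (LBINT s:{x..}. exp (- (s\<^sup>2)))"

text \<open>
  The Rodrigues formula is meaningless at \<open>y = 0\<close> and (for real powers) at \<open>y < 0\<close>. The generalized
  Laguerre polynomial is the polynomial that it defines on \<open>y > 0\<close>.
\<close>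
definition laguerre :: "nat \<Rightarrow> real \<Rightarrow> real poly" where
  "laguerre k \<gamma> = (THE P. \<forall>y>0. poly P y =
     exp y * y powr (- \<gamma>) / fact k * (deriv ^^ k) (\<lambda>s. exp (- s) * s powr (real k + \<gamma>)) y)"

definition hermite :: "nat \<Rightarrow> real \<Rightarrow> real" where
  "hermite k x = (-1) ^ k * exp (x\<^sup>2) * (deriv ^^ k) (\<lambda>s. exp (- (s\<^sup>2))) x"

text \<open>Modified Bessel functions of real order and complex argument (principal branches).\<close>

definition bessel_I :: "real \<Rightarrow> complex \<Rightarrow> complex" where
  "bessel_I \<nu> z = (z / 2) powr of_real \<nu> *
     (\<Sum>k. (z\<^sup>2 / 4) ^ k * of_real (rGamma (\<nu> + real k + 1)) / fact k)"

text \<open>At integer order the quotient is \<open>0 / 0\<close>, and the function is its limit in the order.\<close>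
definition bessel_K :: "real \<Rightarrow> complex \<Rightarrow> complex" where
  "bessel_K \<nu> z =
     (let K = (\<lambda>\<mu>. of_real (pi / 2) * (bessel_I (- \<mu>) z - bessel_I \<mu> z) / of_real (sin (\<mu> * pi)))
      in if \<nu> \<in> \<int> then Lim (at \<nu>) K else K \<nu>)"


section \<open>The volume potential\<close>

text \<open>
  The fundamental solution of \<open>- \<Delta> + lam\<^sup>2\<close>. The library's principal square root \<open>csqrt\<close> has nonnegative
  real part, so \<open>csqrt (lam\<^sup>2)\<close> is the admissible one of \<open>lam\<close> and \<open>- lam\<close>. The branch \<open>lam = 0\<close> is meaningful
  only for dimension at least 3.
\<close>
definition kappa :: "complex \<Rightarrow> real ^ 'n \<Rightarrow> complex" where
  "kappa lam x =
     (let n = real CARD('n); \<mu> = csqrt (lam\<^sup>2) in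
      if lam = 0 then of_real (Gamma (n / 2 - 1) / (4 * pi powr (n / 2)) * norm x powr (2 - n))
      else of_real (1 / (2 * pi) powr (n / 2)) * (of_real (norm x) / \<mu>) powr of_real (1 - n / 2)
             * bessel_K (n / 2 - 1) (\<mu> * of_real (norm x)))"

definition volume_potential :: "complex \<Rightarrow> (real ^ 'n \<Rightarrow> real) \<Rightarrow> real ^ 'n \<Rightarrow> complex" where
  "volume_potential lam g x = (LINT y|lborel. kappa lam (x - y) * of_real (g y))"


section \<open>The one-dimensional integrand\<close>

definition eta :: "nat \<Rightarrow> real \<Rightarrow> real" where
  "eta M x = 1 / sqrt pi * poly (laguerre (M - 1) (1/2)) (x\<^sup>2) * exp (- (x\<^sup>2))"

definition FF :: "real \<Rightarrow> real \<Rightarrow> real \<Rightarrow> real" where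
  "FF t x y = sqrt ((1 + t) / t) * (y - x / (1 + t))"

definition PM :: "nat \<Rightarrow> real \<Rightarrow> real \<Rightarrow> real" where
  "PM M t x = (\<Sum>k<M. 1 / (1 + t) powr (real k + 1/2) * poly (laguerre k (-1/2)) (x\<^sup>2 / (1 + t)))"

definition QM :: "nat \<Rightarrow> real \<Rightarrow> real \<Rightarrow> real \<Rightarrow> real" where
  "QM M t x y = 2 * (\<Sum>k=1..M-1. (-1) ^ k / (fact k * 4 ^ k) *
     (\<Sum>l=1..2*k. (-1) ^ l / t powr (real l / 2) *
        (hermite (2*k - l) y * hermite (l - 1) ((y - x) / sqrt t)
         - real ((2*k) choose l) * hermite (2*k - l) (x / sqrt (1 + t))
             * (hermite (l - 1) (FF t x y) / (1 + t) powr (real k + 1/2)))))"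

definition Phi_real :: "nat \<Rightarrow> real \<Rightarrow> real \<Rightarrow> real \<Rightarrow> real" where
  "Phi_real M x t p = exp (- (x\<^sup>2) / (1 + t)) / (2 * sqrt pi) *
     (erfc (FF t x p) * PM M t x - exp (- ((FF t x p)\<^sup>2)) / sqrt pi * QM M t x p)"

definition Phi :: "nat \<Rightarrow> real \<Rightarrow> real \<Rightarrow> ereal \<Rightarrow> real" where
  "Phi M x t p = (case p of
       ereal r \<Rightarrow> Phi_real M x t r
     | PInfty \<Rightarrow> Lim at_top (Phi_real M x t)
     | MInfty \<Rightarrow> Lim at_bot (Phi_real M x t))"

end

theory Submission
  imports Defs "HOL-Probability.Distributions" "HOL-Complex_Analysis.Conformal_Mappings"
begin

text \<open>
  For \<open>z \<noteq> 0\<close> the fundamental solution is a superposition of heat kernels,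
  \[ \kappa_\lambda(z) = \frac14 \int_0^\infty e^{-\lambda^2 t/4} \prod_j \frac{e^{-z_j^2/t}}{\sqrt{\pi t}}\,dt, \]
  so by Fubini's theorem the potential of a product is a one-dimensional integral of products of
  one-dimensional heat convolutions. The convolution of the density over \<open>(p, q)\<close> is a difference of values of
  \<open>Phi\<close> because $\partial_p \Phi_M(x,t,p) = -(\pi t)^{-1/2} e^{-(x-p)^2/t}\,\tilde\eta_{2M}(p)$. With
  $L_{M-1}^{(1/2)} = \sum_{k<M} L_k^{(-1/2)}$ and $L_k^{(-1/2)}(y^2) = (-1)^k H_{2k}(y)/(k!\,4^k)$ the latter splits into
  one identity for each \<open>k\<close>: the derivative of the inner sum of \<open>QM\<close> telescopes, up to the addition theorem
  of the Hermite polynomials.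

  The superposition formula amounts to $K_\nu(z) = \frac12 (z/2)^{-\nu} G_\nu(z^2/4)$ with
  $G_a(w) = \int_0^\infty e^{-s-w/s} s^{a-1}\,ds$. Let $D_a$ be the difference of $G_a$ and the power series expression
  in the definition of $K_a$. For $0 < a < 1$ and \<open>w > 0\<close> the symmetry $G_{-a}(w) = w^{-a} G_a(w)$ gives
  $D_a' = - w^{a-1} D_{1-a}$, and $D_a(0) = 0$ by the reflection formula, so that $D_a$ and $D_{1-a}$ vanish near \<open>0\<close> by a
  contraction argument, hence on the right half plane. Differentiation and symmetry give all nonintegral
  orders; the boundary \<open>Re w = 0\<close> and the integral orders follow by continuity.
\<close>

text \<open>The Bessel order that occurs is n/2 - 1: n = 1 gives -1/2, every even n falls under the
  limit clause of \<open>bessel_K\<close>, and Re lambda^2 = 0 puts w on the boundary of the half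
  plane. Hence the integral representation is proved for every real order inside the half plane, and
  on its boundary for positive orders only, which means n >= 3. The initial value problem for D_a is
  singular at 0, since w^(a-1) is unbounded there for a < 1. Its integrability takes the place of a
  Lipschitz bound. Passing from D_(a-1) to D_(1-a) by the symmetry is what makes both unknowns
  continuous at 0, as G_(a-1) itself has no finite value there. Fubini's theorem rests on one
  estimate: a heat convolution of a bounded integrable function is O(min(1, t^(-1/2))). The n-fold
  product is thus bounded near t = 0 and O(t^(-n/2)) at infinity, integrable if n >= 3; otherwise
  e^(-lambda^2 t/4) supplies the decay. The constant of integration in \<open>Phi\<close> is never
  computed. \<open>Phi\<close> is an unknown constant plus a convergent tail integral, which also
  yields the limits at both infinite endpoints without any asymptotics of \<open>QM\<close>.\<close>

lemma iterated_deriv_eqI: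
  fixes D :: "nat \<Rightarrow> real \<Rightarrow> real"
  assumes "open S" "\<And>x. x \<in> S \<Longrightarrow> D 0 x = f x"
    and "\<And>j x. x \<in> S \<Longrightarrow> (D j has_real_derivative D (Suc j) x) (at x)"
  shows "x \<in> S \<Longrightarrow> (deriv ^^ k) f x = D k x"
proof (induction k arbitrary: x)
  case 0
  then show ?case using assms(2) by simp
next
  case (Suc k)
  \<comment> \<open>\<open>deriv\<close> at x sees the values near x, so the induction hypothesis is
    needed on a whole neighbourhood; openness of \<open>S\<close> supplies it.\<close>
  have "\<forall>\<^sub>F y in nhds x. (deriv ^^ k) f y = D k y"
    using eventually_nhds_in_open[OF assms(1) Suc.prems] by eventually_elim (rule Suc.IH)
  hence "deriv ((deriv ^^ k) f) x = deriv (D k) x"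
    by (rule deriv_cong_ev) simp
  also have "\<dots> = D (Suc k) x"
    using assms(3)[OF Suc.prems] by (rule DERIV_imp_deriv)
  finally show ?case by simp
qed

lemma poly_extI: "(\<And>x. poly p x = poly q x) \<Longrightarrow> p = (q :: real poly)"
  by (simp add: poly_eq_poly_eq_iff[symmetric] fun_eq_iff)

subsection \<open>Laguerre polynomials\<close>

text \<open>This is k! L_k^(c). Unlike the Rodrigues formula, whose exponent k + c moves with k, the
  recursion keeps the parameter fixed and so allows induction on k.\<close>

primrec scaled_laguerre :: "nat \<Rightarrow> real \<Rightarrow> real poly" where
  "scaled_laguerre 0 c = 1"
| "scaled_laguerre (Suc k) c = [:0, 1:] * pderiv (scaled_laguerre k c) + [:real k + 1 + c, -1:] * scaled_laguerre k c"

text \<open>The polynomial factor left when e^(-s) s^(c-j) is split off from the j-th derivative of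
  e^(-s) s^c.\<close>

primrec rodrigues :: "nat \<Rightarrow> real \<Rightarrow> real poly" where
  "rodrigues 0 c = 1"
| "rodrigues (Suc j) c = [:0, 1:] * pderiv (rodrigues j c) + [:c - real j, -1:] * rodrigues j c"

text \<open>Leibniz' rule for s^(c+1) = s * s^c, where only two terms survive. It compensates for
  the exponent k + c growing with k.\<close>

lemma rodrigues_shift:
  "rodrigues (Suc j) (c + 1) = rodrigues (Suc j) c + smult (real (Suc j)) (rodrigues j c)"
proof (induction j)
  case 0
  show ?case by simp
next
  case (Suc j)
  have "poly (rodrigues (Suc (Suc j)) (c + 1)) x =
      poly (rodrigues (Suc (Suc j)) c + smult (real (Suc (Suc j))) (rodrigues (Suc j) c)) x" for x
  proof -
    have "poly (rodrigues (Suc (Suc j)) (c + 1)) x =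
        x * poly (pderiv (rodrigues (Suc j) (c + 1))) x
          + (c - real j - x) * poly (rodrigues (Suc j) (c + 1)) x"
      unfolding rodrigues.simps(2)[of "Suc j"] by (simp add: left_diff_distrib del: rodrigues.simps)
    also have "\<dots> = x * (poly (pderiv (rodrigues (Suc j) c)) x + (real j + 1) * poly (pderiv (rodrigues j c)) x)
          + (c - real j - x) * (poly (rodrigues (Suc j) c) x + (real j + 1) * poly (rodrigues j c) x)"
      unfolding Suc.IH by (simp add: pderiv_add pderiv_smult add.commute del: rodrigues.simps)
    also have "\<dots> = (x * poly (pderiv (rodrigues (Suc j) c)) x + (c - real (Suc j) - x) * poly (rodrigues (Suc j) c) x)
        + poly (rodrigues (Suc j) c) x
        + (real j + 1) * (x * poly (pderiv (rodrigues j c)) x + (c - real j - x) * poly (rodrigues j c) x)"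
      by (simp add: algebra_simps del: rodrigues.simps)
    also have "x * poly (pderiv (rodrigues (Suc j) c)) x + (c - real (Suc j) - x) * poly (rodrigues (Suc j) c) x
        = poly (rodrigues (Suc (Suc j)) c) x"
      unfolding rodrigues.simps(2)[of "Suc j"] by (simp add: left_diff_distrib del: rodrigues.simps)
    also have "x * poly (pderiv (rodrigues j c)) x + (c - real j - x) * poly (rodrigues j c) x
        = poly (rodrigues (Suc j) c) x"
      by (simp add: left_diff_distrib)
    finally show ?thesis by (simp add: algebra_simps del: rodrigues.simps)
  qed
  then show ?case by (rule poly_extI)
qed

lemma scaled_laguerre_eq_rodrigues: "scaled_laguerre k c = rodrigues k (real k + c)"
proof (induction k)
  case (Suc k)
  have "rodrigues (Suc k) (real (Suc k) + c) = rodrigues (Suc k) ((real k + c) + 1)"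
    by (simp add: add_ac)
  also have "\<dots> = rodrigues (Suc k) (real k + c) + smult (real (Suc k)) (rodrigues k (real k + c))"
    by (rule rodrigues_shift)
  also have "\<dots> = scaled_laguerre (Suc k) c"
    unfolding scaled_laguerre.simps Suc.IH rodrigues.simps
    by (rule poly_eq_poly_eq_iff[THEN iffD1], rule ext) (simp add: algebra_simps)
  finally show ?case ..
qed simp

lemma deriv_iter_rodrigues:
  assumes "x > 0"
  shows "(deriv ^^ j) (\<lambda>s. exp (- s) * s powr c) x = exp (- x) * x powr (c - real j) * poly (rodrigues j c) x"
proof (rule iterated_deriv_eqI[where S = "{0<..}"])
  fix j and x :: real assume "x \<in> {0<..}"
  then have x: "x > 0" by auto
  have *: "x powr (c - real j) = x * x powr (c - real j - 1)"
    using x by (simp add: powr_mult_base)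
  show "((\<lambda>x. exp (- x) * x powr (c - real j) * poly (rodrigues j c) x) has_real_derivative
     exp (- x) * x powr (c - real (Suc j)) * poly (rodrigues (Suc j) c) x) (at x)"
    using x by (auto intro!: derivative_eq_intros simp: algebra_simps * diff_diff_eq)
qed (use assms in auto)

text \<open>The description in \<open>laguerre\<close> has a unique solution because two polynomials
  that agree on the infinite set y > 0 are equal.\<close>

lemma laguerre_eq_scaled_laguerre: "laguerre k c = smult (1 / fact k) (scaled_laguerre k c)"
proof -
  have *: "exp y * y powr (- c) / fact k * (deriv ^^ k) (\<lambda>s. exp (- s) * s powr (real k + c)) y
      = poly (smult (1 / fact k) (scaled_laguerre k c)) y" if "y > 0" for y
    using that by (subst deriv_iter_rodrigues)
       (auto simp: scaled_laguerre_eq_rodrigues exp_minus field_simps powr_minus)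
  show ?thesis
    unfolding laguerre_def
  proof (rule the_equality)
    show "\<forall>y>0. poly (smult (1 / fact k) (scaled_laguerre k c)) y =
         exp y * y powr - c / fact k * (deriv ^^ k) (\<lambda>s. exp (- s) * s powr (real k + c)) y"
      using * by simp
  next
    fix P assume P: "\<forall>y>0. poly P y =
         exp y * y powr - c / fact k * (deriv ^^ k) (\<lambda>s. exp (- s) * s powr (real k + c)) y"
    have "poly (P - smult (1 / fact k) (scaled_laguerre k c)) y = 0" if "y > 0" for y
      using P *[OF that] that by simp
    then have "{0<..} \<subseteq> {y. poly (P - smult (1 / fact k) (scaled_laguerre k c)) y = 0}"
      by auto
    moreover have "infinite {0::real<..}" by (rule infinite_Ioi)
    ultimately have "P - smult (1 / fact k) (scaled_laguerre k c) = 0"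
      using poly_roots_finite finite_subset by blast
    then show "P = smult (1 / fact k) (scaled_laguerre k c)" by simp
  qed
qed

text \<open>The two claims feed each other: the Laguerre equation at k gives the derivative rule at
  k, and that rule, applied once and twice, gives the equation at k + 1. So \<open>step\<close>
  takes the equation as a premise and is used inside the induction.\<close>

lemma scaled_laguerre_ode:
  "x * poly (pderiv (pderiv (scaled_laguerre k c))) x + (1 + c - x) * poly (pderiv (scaled_laguerre k c)) x + real k * poly (scaled_laguerre k c) x = 0"
  and pderiv_scaled_laguerre_Suc: "pderiv (scaled_laguerre (Suc k) c) = smult (real (Suc k)) (pderiv (scaled_laguerre k c) - scaled_laguerre k c)"
proof -
  have step: "pderiv (scaled_laguerre (Suc k) c) = smult (real (Suc k)) (pderiv (scaled_laguerre k c) - scaled_laguerre k c)"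
    if ode: "\<And>x. x * poly (pderiv (pderiv (scaled_laguerre k c))) x + (1 + c - x) * poly (pderiv (scaled_laguerre k c)) x
        + real k * poly (scaled_laguerre k c) x = 0" for k
  proof -
    have "poly (pderiv (scaled_laguerre (Suc k) c)) x = poly (smult (real (Suc k)) (pderiv (scaled_laguerre k c) - scaled_laguerre k c)) x" for x
      using ode[of x] by (simp add: pderiv_add pderiv_mult pderiv_pCons pderiv_diff pderiv_smult pderiv_minus algebra_simps)
    then show ?thesis by (rule poly_extI)
  qed
  have ode: "x * poly (pderiv (pderiv (scaled_laguerre k c))) x + (1 + c - x) * poly (pderiv (scaled_laguerre k c)) x
      + real k * poly (scaled_laguerre k c) x = 0" for x k
  proof (induction k arbitrary: x)
    case (Suc k)
    let ?f = "poly (scaled_laguerre k c) x" and ?f1 = "poly (pderiv (scaled_laguerre k c)) x"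
      and ?f2 = "poly (pderiv (pderiv (scaled_laguerre k c))) x"
    have "poly (scaled_laguerre (Suc k) c) x = x * ?f1 + (real k + 1 + c - x) * ?f"
      by (simp add: left_diff_distrib)
    moreover have "poly (pderiv (scaled_laguerre (Suc k) c)) x = (real k + 1) * (?f1 - ?f)"
      unfolding step[OF Suc.IH] by simp
    moreover have "poly (pderiv (pderiv (scaled_laguerre (Suc k) c))) x = (real k + 1) * (?f2 - ?f1)"
      unfolding step[OF Suc.IH] by (simp add: pderiv_smult pderiv_diff)
    moreover have "x * ((real k + 1) * (?f2 - ?f1)) + (1 + c - x) * ((real k + 1) * (?f1 - ?f))
        + (real k + 1) * (x * ?f1 + (real k + 1 + c - x) * ?f)
        = (real k + 1) * (x * ?f2 + (1 + c - x) * ?f1 + real k * ?f)"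
      by (simp add: algebra_simps)
    ultimately show ?case
      using Suc.IH[of x] by (simp add: add.commute[of 1] del: scaled_laguerre.simps)
  qed simp
  show "x * poly (pderiv (pderiv (scaled_laguerre k c))) x + (1 + c - x) * poly (pderiv (scaled_laguerre k c)) x
      + real k * poly (scaled_laguerre k c) x = 0"
    by (rule ode)
  show "pderiv (scaled_laguerre (Suc k) c) = smult (real (Suc k)) (pderiv (scaled_laguerre k c) - scaled_laguerre k c)"
    by (rule step) (rule ode)
qed

lemma scaled_laguerre_plus1: "scaled_laguerre k (c + 1) = scaled_laguerre k c - pderiv (scaled_laguerre k c)"
proof (induction k)
  case (Suc k)
  have "poly (scaled_laguerre (Suc k) (c + 1)) x = poly (scaled_laguerre (Suc k) c - pderiv (scaled_laguerre (Suc k) c)) x" for x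
  proof -
    let ?f = "poly (scaled_laguerre k c) x" and ?f1 = "poly (pderiv (scaled_laguerre k c)) x"
      and ?f2 = "poly (pderiv (pderiv (scaled_laguerre k c))) x"
    have "poly (scaled_laguerre (Suc k) (c + 1)) x = x * (?f1 - ?f2) + (real k + 2 + c - x) * (?f - ?f1)"
      unfolding scaled_laguerre.simps Suc.IH by (simp add: pderiv_diff left_diff_distrib algebra_simps)
    also have "\<dots> = (x * ?f1 + (real k + 1 + c - x) * ?f) - (real k + 1) * (?f1 - ?f)"
      using scaled_laguerre_ode[of x k c] by (simp add: algebra_simps)
    also have "\<dots> = poly (scaled_laguerre (Suc k) c - pderiv (scaled_laguerre (Suc k) c)) x"
      unfolding pderiv_scaled_laguerre_Suc by (simp add: algebra_simps)
    finally show ?thesis .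
  qed
  then show ?case by (rule poly_extI)
qed simp

text \<open>The shift of the parameter and the derivative rule combine to L_(n+1)^(c+1) - L_n^(c+1)
  = L_(n+1)^(c), which telescopes. With c = -1/2 this splits the density into the pieces that match
  the summands of \<open>PM\<close> and \<open>QM\<close>.\<close>

lemma laguerre_sum: "laguerre n (c + 1) = (\<Sum>k\<le>n. laguerre k c)"
proof (induction n)
  case (Suc n)
  have "laguerre (Suc n) (c + 1) = laguerre (Suc n) c + laguerre n (c + 1)"
  proof -
    have "scaled_laguerre (Suc n) (c + 1) = scaled_laguerre (Suc n) c + smult (real (Suc n)) (scaled_laguerre n (c + 1))"
      unfolding scaled_laguerre_plus1 pderiv_scaled_laguerre_Suc by (simp add: smult_diff_right)
    then show ?thesis
      unfolding laguerre_eq_scaled_laguerre by (simp add: smult_add_right del: scaled_laguerre.simps)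
  qed
  then show ?case using Suc.IH by simp
qed (simp add: laguerre_eq_scaled_laguerre)

subsection \<open>Hermite polynomials\<close>

primrec hermite_poly :: "nat \<Rightarrow> real poly" where
  "hermite_poly 0 = 1"
| "hermite_poly (Suc k) = [:0, 2:] * hermite_poly k - pderiv (hermite_poly k)"

text \<open>Together with its Gaussian a Hermite polynomial differentiates to a single term of the
  next index. This is why \<open>QM_term\<close> is only ever differentiated after multiplication by
  a Gaussian.\<close>

lemma exp_hermite_poly_deriv [derivative_intros]:
  assumes "(f has_real_derivative f') (at x within A)"
  shows "((\<lambda>y. exp (- (f y)\<^sup>2) * poly (hermite_poly j) (f y)) has_real_derivative
     - exp (- (f x)\<^sup>2) * poly (hermite_poly (Suc j)) (f x) * f') (at x within A)"
  using assms by (auto intro!: derivative_eq_intros simp: algebra_simps power2_eq_square)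

lemma hermite_eq_hermite_poly: "hermite k x = poly (hermite_poly k) x"
proof -
  have "(deriv ^^ k) (\<lambda>s. exp (- (s\<^sup>2))) x = (-1) ^ k * (exp (- x\<^sup>2) * poly (hermite_poly k) x)"
    by (rule iterated_deriv_eqI[where S = UNIV])
      (auto intro!: derivative_eq_intros simp: algebra_simps power2_eq_square)
  then show ?thesis
    by (simp add: hermite_def exp_minus field_simps flip: power_mult_distrib)
qed

lemma degree_coeff_hermite_poly: "degree (hermite_poly k) \<le> k" "coeff (hermite_poly k) k = 2 ^ k"
proof (induction k)
  case (Suc k)
  { case 1
    have "degree ([:0, 2:] * hermite_poly k) \<le> Suc k"
      using Suc.IH(1) by (intro order.trans[OF degree_mult_le]) simp
    moreover have "degree (pderiv (hermite_poly k)) \<le> Suc k"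
      using Suc.IH(1) by (simp add: degree_pderiv)
    ultimately show ?case by (simp del: mult_pCons_left add: degree_diff_le)
  next
    case 2
    show ?case using Suc.IH by (simp add: coeff_pCons coeff_pderiv coeff_eq_0)
  }
qed auto

text \<open>Two Hermite steps form a second order operator in x. Written in x^2, its second
  derivative is removed by the Laguerre equation with c = -1/2, and one Laguerre step times -4
  remains.\<close>

lemma hermite_poly_even: "hermite_poly (2 * k) = smult ((-4) ^ k) (pcompose (scaled_laguerre k (-1/2)) [:0, 0, 1:])"
proof (induction k)
  case (Suc k)
  let ?L = "scaled_laguerre k (-1/2)"
  let ?c = "(-4) ^ k :: real"
  have "poly (hermite_poly (2 * Suc k)) x = poly (smult ((-4) ^ Suc k) (pcompose (scaled_laguerre (Suc k) (-1/2)) [:0, 0, 1:])) x" for x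
  proof -
    let ?f = "poly ?L (x\<^sup>2)" and ?f1 = "poly (pderiv ?L) (x\<^sup>2)" and ?f2 = "poly (pderiv (pderiv ?L)) (x\<^sup>2)"
    have h: "poly (hermite_poly (2 * k)) y = ?c * poly ?L (y\<^sup>2)" for y
      by (simp add: Suc.IH poly_pcompose power2_eq_square)
    have h1: "poly (pderiv (hermite_poly (2 * k))) y = ?c * (2 * y * poly (pderiv ?L) (y\<^sup>2))" for y
      by (rule DERIV_unique[OF poly_DERIV]) (unfold h, auto intro!: derivative_eq_intros)
    have h2: "poly (pderiv (pderiv (hermite_poly (2 * k)))) x = ?c * (2 * ?f1 + 4 * x\<^sup>2 * ?f2)"
      by (rule DERIV_unique[OF poly_DERIV])
        (unfold h1, auto intro!: derivative_eq_intros simp: power2_eq_square algebra_simps)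
    have "poly (hermite_poly (2 * Suc k)) x = (4 * x\<^sup>2 - 2) * poly (hermite_poly (2 * k)) x
        - 4 * x * poly (pderiv (hermite_poly (2 * k))) x + poly (pderiv (pderiv (hermite_poly (2 * k)))) x"
      by (simp add: pderiv_mult pderiv_diff pderiv_pCons pderiv_smult algebra_simps power2_eq_square)
    also have "\<dots> = ?c * ((4 * x\<^sup>2 - 2) * ?f - 8 * x\<^sup>2 * ?f1 + 2 * ?f1 + 4 * x\<^sup>2 * ?f2)"
      unfolding h h1 h2 by (simp add: algebra_simps power2_eq_square)
    also have "(4 * x\<^sup>2 - 2) * ?f - 8 * x\<^sup>2 * ?f1 + 2 * ?f1 + 4 * x\<^sup>2 * ?f2
        = -4 * (x\<^sup>2 * ?f1 + (real k + 1 + -1/2 - x\<^sup>2) * ?f)"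
      using scaled_laguerre_ode[of "x\<^sup>2" k "-1/2"] by (simp add: algebra_simps)
    also have "?c * \<dots> = (-4) ^ Suc k * poly (scaled_laguerre (Suc k) (-1/2)) (x\<^sup>2)"
      by (simp add: algebra_simps)
    finally show ?thesis
      by (simp add: poly_pcompose power2_eq_square del: scaled_laguerre.simps)
  qed
  then show ?case by (rule poly_extI)
qed (simp add: one_pCons)

lemma poly_laguerre_hermite:
  "poly (laguerre k (- (1/2))) (y\<^sup>2) = (-1) ^ k / (fact k * 4 ^ k) * poly (hermite_poly (2 * k)) y"
proof -
  have "(-4 :: real) ^ k = (-1) ^ k * 4 ^ k" by (simp flip: power_mult_distrib)
  moreover have "(-1 :: real) ^ k * (-1) ^ k = 1" by (simp flip: power_mult_distrib)
  moreover have "- (1/2) = (-1/2 :: real)" by simp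
  ultimately show ?thesis
    unfolding hermite_poly_even laguerre_eq_scaled_laguerre by (simp add: poly_pcompose power2_eq_square field_simps)
qed

text \<open>Pascal's rule, arranged as the inductive step of a Leibniz formula: each step raises
  exactly one of the two indices of \<open>A\<close>.\<close>

lemma binomial_convolution_Suc:
  fixes A :: "nat \<Rightarrow> nat \<Rightarrow> real"
  shows "(\<Sum>l\<le>m. of_nat (m choose l) * (A (Suc (m - l)) l + A (m - l) (Suc l)))
    = (\<Sum>l\<le>Suc m. of_nat (Suc m choose l) * A (Suc m - l) l)"
proof -
  have "(\<Sum>l\<le>Suc m. of_nat (Suc m choose l) * A (Suc m - l) l) =
      A (Suc m) 0 + (\<Sum>l\<le>m. of_nat (Suc m choose Suc l) * A (m - l) (Suc l))"
    by (subst sum.atMost_Suc_shift) simp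
  also have "(\<Sum>l\<le>m. of_nat (Suc m choose Suc l) * A (m - l) (Suc l)) =
      (\<Sum>l\<le>m. of_nat (m choose l) * A (m - l) (Suc l)) + (\<Sum>l\<le>m. of_nat (m choose Suc l) * A (m - l) (Suc l))"
    by (simp add: algebra_simps sum.distrib)
  also have "A (Suc m) 0 + (\<dots>) = (\<Sum>l\<le>m. of_nat (m choose l) * A (m - l) (Suc l)) +
      (\<Sum>l\<le>Suc m. of_nat (m choose l) * A (Suc m - l) l)"
    using sum.atMost_Suc_shift[of "\<lambda>l. of_nat (m choose l) * A (Suc m - l) l" m] by simp
  also have "(\<Sum>l\<le>Suc m. of_nat (m choose l) * A (Suc m - l) l) = (\<Sum>l\<le>m. of_nat (m choose l) * A (Suc (m - l)) l)"
    by (simp add: Suc_diff_le)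
  finally show ?thesis by (simp add: algebra_simps sum.distrib)
qed

text \<open>In H_(m+1)(u) = 2u H_m(u) - H_m'(u) the factor 1 = a^2 + b^2 splits the last term into a
  (a H_m') + b (b H_m'). Here a H_m' and b H_m' are the partial derivatives of the inductive formula
  in x and y, so each half completes a Hermite step in one variable.\<close>

lemma hermite_poly_addition:
  assumes ab: "a\<^sup>2 + b\<^sup>2 = 1"
  shows "poly (hermite_poly m) (a * x + b * y) =
    (\<Sum>l\<le>m. of_nat (m choose l) * (a ^ (m - l) * b ^ l * poly (hermite_poly (m - l)) x * poly (hermite_poly l) y))"
proof (induction m arbitrary: x y)
  case (Suc m)
  let ?H = "\<lambda>j. poly (hermite_poly j)" and ?D = "\<lambda>j. poly (pderiv (hermite_poly j))"
  let ?u = "a * x + b * y"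
  have "((\<lambda>x. ?H m (a * x + b * y)) has_real_derivative a * ?D m ?u) (at x)"
    by (auto intro!: derivative_eq_intros)
  moreover have "((\<lambda>x. ?H m (a * x + b * y)) has_real_derivative
      (\<Sum>l\<le>m. of_nat (m choose l) * (a ^ (m - l) * b ^ l * ?D (m - l) x * ?H l y))) (at x)"
    unfolding Suc.IH by (auto intro!: derivative_eq_intros sum.cong)
  ultimately have dx: "a * ?D m ?u = (\<Sum>l\<le>m. of_nat (m choose l) * (a ^ (m - l) * b ^ l * ?D (m - l) x * ?H l y))"
    by (rule DERIV_unique)
  have "((\<lambda>y. ?H m (a * x + b * y)) has_real_derivative b * ?D m ?u) (at y)"
    by (auto intro!: derivative_eq_intros)
  moreover have "((\<lambda>y. ?H m (a * x + b * y)) has_real_derivative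
      (\<Sum>l\<le>m. of_nat (m choose l) * (a ^ (m - l) * b ^ l * ?H (m - l) x * ?D l y))) (at y)"
    unfolding Suc.IH by (auto intro!: derivative_eq_intros sum.cong)
  ultimately have dy: "b * ?D m ?u = (\<Sum>l\<le>m. of_nat (m choose l) * (a ^ (m - l) * b ^ l * ?H (m - l) x * ?D l y))"
    by (rule DERIV_unique)
  have "?H (Suc m) ?u = 2 * ?u * ?H m ?u - (a\<^sup>2 + b\<^sup>2) * ?D m ?u"
    using ab by simp
  also have "\<dots> = 2 * ?u * ?H m ?u - a * (a * ?D m ?u) - b * (b * ?D m ?u)"
    by (simp add: algebra_simps power2_eq_square)
  also have "\<dots> = (\<Sum>l\<le>m. of_nat (m choose l) *
      (a ^ Suc (m - l) * b ^ l * ?H (Suc (m - l)) x * ?H l y + a ^ (m - l) * b ^ Suc l * ?H (m - l) x * ?H (Suc l) y))"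
    unfolding dx dy unfolding Suc.IH
    by (simp add: sum_distrib_left sum_subtractf[symmetric] algebra_simps)
  also have "\<dots> = (\<Sum>l\<le>Suc m. of_nat (Suc m choose l) * (a ^ (Suc m - l) * b ^ l * ?H (Suc m - l) x * ?H l y))"
    by (rule binomial_convolution_Suc[where A = "\<lambda>i j. a ^ i * b ^ j * ?H i x * ?H j y"])
  finally show ?case .
qed simp

subsection \<open>The antiderivative\<close>

lemma has_real_derivative_tail_integral:
  fixes f :: "real \<Rightarrow> real"
  assumes f: "integrable lborel f" and cont: "continuous_on UNIV f"
  shows "((\<lambda>x. LBINT s:{x..}. f s) has_real_derivative - f x) (at x)"
proof -
  let ?a = "x - 1" and ?b = "x + 1"
  have si: "set_integrable lborel A f" if "A \<in> sets borel" for A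
    unfolding set_integrable_def using integrable_mult_indicator[of A lborel f] f that by simp
  have "((\<lambda>u. integral {?a..u} f) has_real_derivative f x) (at x within {?a..?b})"
    by (rule integral_has_real_derivative) (use continuous_on_subset[OF cont] in auto)
  then have "((\<lambda>u. integral {?a..u} f) has_real_derivative f x) (at x)"
    by (subst (asm) at_within_interior) auto
  then have d: "((\<lambda>u. (LBINT s:{?a..}. f s) - integral {?a..u} f) has_real_derivative - f x) (at x)"
    by (auto intro!: derivative_eq_intros)
  have eq: "(LBINT s:{?a..}. f s) - integral {?a..u} f = (LBINT s:{u..}. f s)" if "u \<in> {?a<..<?b}" for u
  proof -
    have "{?a..} = {?a..u} \<union> {u<..}" using that by auto
    then have "(LBINT s:{?a..}. f s) = (LBINT s:{?a..u}. f s) + (LBINT s:{u<..}. f s)"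
      by (simp only:, intro set_integral_Un si) auto
    also have "(LBINT s:{?a..u}. f s) = integral {?a..u} f"
      by (rule set_borel_integral_eq_integral(2)) (rule si, simp)
    also have "(LBINT s:{u<..}. f s) = (LBINT s:{u..}. f s)"
      unfolding set_lebesgue_integral_def
      using f by (intro integral_cong_AE) (auto intro!: AE_I[where N = "{u}"] simp: indicator_def)
    finally show ?thesis by simp
  qed
  show ?thesis
    by (rule has_field_derivative_transform_within_open[OF d, of "{?a<..<?b}"]) (use eq in auto)
qed

lemma integrable_exp_neg_square: "c > 0 \<Longrightarrow> integrable lborel (\<lambda>s::real. exp (- (c * s\<^sup>2)))"
proof -
  assume c: "c > 0"
  have "integrable lborel (\<lambda>x. normal_density 0 (1 / sqrt (2 * c)) x * sqrt (2 * pi * (1 / sqrt (2 * c))\<^sup>2))"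
    using c by (intro integrable_mult_left integrable_normal_density) auto
  then show ?thesis
    using c by (simp add: normal_density_def field_simps power_divide)
qed

lemma has_real_derivative_erfc [derivative_intros]:
  assumes "(f has_real_derivative f') (at x)"
  shows "((\<lambda>x. erfc (f x)) has_real_derivative - 2 / sqrt pi * exp (- (f x)\<^sup>2) * f') (at x)"
proof -
  have "(erfc has_real_derivative 2 / sqrt pi * - exp (- y\<^sup>2)) (at y)" for y
    unfolding erfc_def[abs_def]
    using integrable_exp_neg_square[of 1]
    by (intro DERIV_cmult has_real_derivative_tail_integral) (auto intro!: continuous_intros)
  from DERIV_chain2[OF this assms] show ?thesis by (simp add: algebra_simps)
qed

lemma powr_half_nat: "x > 0 \<Longrightarrow> x powr (real l / 2) = sqrt x ^ l"
  by (simp add: powr_half_sqrt[symmetric] powr_powr flip: powr_realpow)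

lemma powr_nat_plus_half: "x > 0 \<Longrightarrow> x powr (real k + 1/2) = sqrt x ^ (2 * k + 1)"
  using powr_half_nat[of x "2 * k + 1"] by (simp add: add_divide_distrib add.commute)

text \<open>The inner sum of \<open>QM\<close>, with the real powers of t and 1 + t rewritten as
  natural powers of square roots.\<close>

definition QM_term :: "nat \<Rightarrow> real \<Rightarrow> real \<Rightarrow> real \<Rightarrow> real" where
  "QM_term k t x y = (\<Sum>l=1..2*k. (-1) ^ l / sqrt t ^ l *
        (poly (hermite_poly (2*k - l)) y * poly (hermite_poly (l - 1)) ((y - x) / sqrt t)
         - real ((2*k) choose l) * poly (hermite_poly (2*k - l)) (x / sqrt (1 + t))
             * (poly (hermite_poly (l - 1)) (FF t x y) / sqrt (1 + t) ^ (2 * k + 1))))"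

lemma QM_eq_QM_term:
  assumes "t > 0"
  shows "QM M t x y = 2 * (\<Sum>k<M. (-1) ^ k / (fact k * 4 ^ k) * QM_term k t x y)"
proof -
  have "QM M t x y = 2 * (\<Sum>k=1..M-1. (-1) ^ k / (fact k * 4 ^ k) * QM_term k t x y)"
    using assms by (simp add: QM_def QM_term_def hermite_eq_hermite_poly powr_half_nat powr_nat_plus_half)
  also have "(\<Sum>k=1..M-1. (-1) ^ k / (fact k * 4 ^ k) * QM_term k t x y) =
      (\<Sum>k<M. (-1) ^ k / (fact k * 4 ^ k) * QM_term k t x y)"
    \<comment> \<open>For k = 0 the sum over l is empty, so k may start at 0, as it does in
      \<open>PM\<close>.\<close>
    by (intro sum.mono_neutral_left) (auto simp: QM_term_def)
  finally show ?thesis .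
qed

lemma PM_eq_hermite_poly:
  assumes "t > 0"
  shows "PM M t x = (\<Sum>k<M. (-1) ^ k / (fact k * 4 ^ k) * (poly (hermite_poly (2*k)) (x / sqrt (1 + t)) / sqrt (1 + t) ^ (2 * k + 1)))"
proof -
  have "x\<^sup>2 / (1 + t) = (x / sqrt (1 + t))\<^sup>2" using assms by (simp add: power_divide)
  then show ?thesis
    unfolding PM_def using assms by (simp add: poly_laguerre_hermite powr_nat_plus_half mult_ac del: power_Suc)
qed

lemma hermite_poly_even_minus: "poly (hermite_poly (2 * k)) (- x) = poly (hermite_poly (2 * k)) x"
  by (simp add: hermite_poly_even poly_pcompose)

text \<open>Completing the square in y, which is where F comes from: the Gaussian of the density
  times the heat kernel is e^(-x^2/(1+t)) e^(-F^2).\<close>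

lemma FF_square:
  assumes "t > 0"
  shows "x\<^sup>2 / (1 + t) + (FF t x y)\<^sup>2 = y\<^sup>2 + ((y - x) / sqrt t)\<^sup>2"
proof -
  have "(FF t x y)\<^sup>2 = (1 + t) / t * (y - x / (1 + t))\<^sup>2"
    using assms by (simp add: FF_def power_mult_distrib)
  moreover have "((y - x) / sqrt t)\<^sup>2 = (y - x)\<^sup>2 / t"
    using assms by (simp add: power_divide)
  moreover have "x\<^sup>2 / (1 + t) + (1 + t) / t * (y - x / (1 + t))\<^sup>2 = y\<^sup>2 + (y - x)\<^sup>2 / t"
    using assms by (simp add: divide_simps) (simp add: power2_eq_square algebra_simps)
  ultimately show ?thesis by simp
qed

lemma hermite_poly_addition_FF:
  fixes t :: real
  assumes t: "t > 0"
  shows "sqrt ((1 + t) / t) / sqrt (1 + t) ^ (2 * k + 1) *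
      (\<Sum>l\<le>2*k. real ((2*k) choose l) * ((-1) ^ l / sqrt t ^ l *
          poly (hermite_poly (2*k - l)) (x / sqrt (1 + t)) * poly (hermite_poly l) (FF t x y)))
    = poly (hermite_poly (2*k)) ((y - x) / sqrt t) / sqrt t ^ (2 * k + 1)"
proof -
  define r s where "r = sqrt (1 + t)" and "s = sqrt t"
  have rs: "r > 0" "s > 0" "r\<^sup>2 = 1 + t" "s\<^sup>2 = t" using t by (auto simp: r_def s_def)
  have F: "FF t x y = r / s * (y - x / r\<^sup>2)"
    unfolding rs(3) by (simp add: FF_def r_def s_def real_sqrt_divide)
  \<comment> \<open>With these coefficients the addition theorem for x / r and F has the argument
    -(y - x) / s. The sign is harmless because the index 2k is even.\<close>
  have "(s / r)\<^sup>2 + (- 1 / r)\<^sup>2 = 1"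
    using rs t by (simp add: power_divide add_divide_distrib[symmetric])
  from hermite_poly_addition[OF this, of "2 * k" "x / r" "FF t x y"]
  have "poly (hermite_poly (2*k)) (s / r * (x / r) + - 1 / r * FF t x y) =
     (\<Sum>l\<le>2*k. real ((2*k) choose l) * ((s / r) ^ (2*k - l) * (- 1 / r) ^ l *
        poly (hermite_poly (2*k - l)) (x / r) * poly (hermite_poly l) (FF t x y)))" .
  also have "s / r * (x / r) + - 1 / r * FF t x y = - ((y - x) / s)"
  proof -
    have "s / r * (x / r) + - 1 / r * FF t x y = (s\<^sup>2 * x - r\<^sup>2 * y + x) / (s * r\<^sup>2)"
      unfolding F using rs(1,2) by (simp add: field_simps power2_eq_square)
    also have "s\<^sup>2 * x - r\<^sup>2 * y + x = r\<^sup>2 * (x - y)"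
      using rs by (simp add: algebra_simps)
    also have "r\<^sup>2 * (x - y) / (s * r\<^sup>2) = - ((y - x) / s)"
      using rs(1,2) by (simp add: diff_divide_distrib)
    finally show ?thesis .
  qed
  also have "(\<Sum>l\<le>2*k. real ((2*k) choose l) * ((s / r) ^ (2*k - l) * (- 1 / r) ^ l *
        poly (hermite_poly (2*k - l)) (x / r) * poly (hermite_poly l) (FF t x y))) =
      (s / r) ^ (2 * k) * (\<Sum>l\<le>2*k. real ((2*k) choose l) * ((-1) ^ l / s ^ l *
          poly (hermite_poly (2*k - l)) (x / r) * poly (hermite_poly l) (FF t x y)))"
    unfolding sum_distrib_left
  proof (rule sum.cong, rule refl)
    fix l assume "l \<in> {..2*k}"
    then have "(s / r) ^ (2 * k) = (s / r) ^ (2 * k - l) * (s / r) ^ l"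
      by (simp flip: power_add)
    moreover have "(s / r) ^ l * ((-1) ^ l / s ^ l) = (s / r * (- 1 / s)) ^ l"
      by (simp only: power_mult_distrib power_divide)
    then have "(s / r) ^ l * ((-1) ^ l / s ^ l) = (- 1 / r) ^ l"
      using rs by simp
    ultimately have e: "(s / r) ^ (2 * k) * ((-1) ^ l / s ^ l) = (s / r) ^ (2 * k - l) * (- 1 / r) ^ l"
      by (simp only: mult.assoc)
    then show "real ((2*k) choose l) * ((s / r) ^ (2*k - l) * (- 1 / r) ^ l *
        poly (hermite_poly (2*k - l)) (x / r) * poly (hermite_poly l) (FF t x y)) =
      (s / r) ^ (2 * k) * (real ((2*k) choose l) * ((-1) ^ l / s ^ l *
          poly (hermite_poly (2*k - l)) (x / r) * poly (hermite_poly l) (FF t x y)))"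
      unfolding e[symmetric] by (simp only: mult_ac)
  qed
  finally have e1: "(\<Sum>l\<le>2*k. real ((2*k) choose l) * ((-1) ^ l / s ^ l *
          poly (hermite_poly (2*k - l)) (x / r) * poly (hermite_poly l) (FF t x y)))
      = (r / s) ^ (2 * k) * poly (hermite_poly (2*k)) ((y - x) / s)"
    using rs(1,2) unfolding hermite_poly_even_minus by (simp add: field_simps)
  have "r / s / r ^ (2 * k + 1) * ((r / s) ^ (2 * k) * h) = h / s ^ (2 * k + 1)" for h
    using rs(1,2) by (simp add: power_divide)
  then show ?thesis
    unfolding r_def[symmetric] s_def[symmetric] real_sqrt_divide e1 .
qed

text \<open>The Gaussian e^(-F^2) is read in two ways: as it stands for the products with H(F), and
  by \<open>FF_square\<close> as a product of one Gaussian in y and one in (y - x) / sqrt t for the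
  other products. Each Hermite factor then carries its own Gaussian.\<close>

lemma QM_term_deriv:
  assumes t: "t > 0"
  shows "((\<lambda>y. exp (- (FF t x y)\<^sup>2) * QM_term k t x y) has_real_derivative
     exp (- (FF t x y)\<^sup>2) * (poly (hermite_poly (2*k)) y / sqrt t
        - sqrt ((1 + t) / t) * (poly (hermite_poly (2*k)) (x / sqrt (1 + t)) / sqrt (1 + t) ^ (2 * k + 1)))) (at y)"
proof -
  define s where "s = sqrt t"
  define c where "c = 1 / sqrt (1 + t) ^ (2 * k + 1)"
  define X where "X = x / sqrt (1 + t)"
  define F' where "F' = sqrt ((1 + t) / t)"
  define m where "m = 2 * k"
  have cm: "c = 1 / sqrt (1 + t) ^ (m + 1)" by (simp add: c_def m_def)
  let ?H = "\<lambda>j. poly (hermite_poly j)"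
  let ?F = "FF t x"
  have s: "s > 0" using t by (simp add: s_def)
  have FF: "exp (- (?F y)\<^sup>2) = exp (x\<^sup>2 / (1 + t)) * exp (- y\<^sup>2) * exp (- ((y - x) / s)\<^sup>2)" for y
    using FF_square[OF t, of x y] by (simp add: s_def flip: exp_add)
  have d1: "((\<lambda>y. exp (- (?F y)\<^sup>2) * (?H i y * ?H j ((y - x) / s))) has_real_derivative
      - exp (- (?F y)\<^sup>2) * (?H (Suc i) y * ?H j ((y - x) / s) + ?H i y * ?H (Suc j) ((y - x) / s) / s)) (at y)"
    for i j y
  proof -
    have "((\<lambda>y. exp (x\<^sup>2 / (1 + t)) * (exp (- y\<^sup>2) * ?H i y) * (exp (- ((y - x) / s)\<^sup>2) * ?H j ((y - x) / s)))
       has_real_derivative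
        exp (x\<^sup>2 / (1 + t)) * (- exp (- y\<^sup>2) * ?H (Suc i) y) * (exp (- ((y - x) / s)\<^sup>2) * ?H j ((y - x) / s))
      + exp (x\<^sup>2 / (1 + t)) * (exp (- y\<^sup>2) * ?H i y) * (- exp (- ((y - x) / s)\<^sup>2) * ?H (Suc j) ((y - x) / s) * (1 / s))) (at y)"
      using s by (auto intro!: derivative_eq_intros simp del: hermite_poly.simps)
    then show ?thesis
      unfolding FF by (simp add: algebra_simps del: hermite_poly.simps)
  qed
  have d2: "((\<lambda>y. exp (- (?F y)\<^sup>2) * ?H j (?F y)) has_real_derivative
      - exp (- (?F y)\<^sup>2) * ?H (Suc j) (?F y) * F') (at y)" for j y
    unfolding F'_def by (rule exp_hermite_poly_deriv) (auto simp: FF_def intro!: derivative_eq_intros)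
  have "((\<lambda>y. \<Sum>l<m. (-1) ^ Suc l / s ^ Suc l * (exp (- (?F y)\<^sup>2) * (?H (m - Suc l) y * ?H l ((y - x) / s)))
         - real (m choose Suc l) * ((-1) ^ Suc l / s ^ Suc l * ?H (m - Suc l) X * c) * (exp (- (?F y)\<^sup>2) * ?H l (?F y)))
     has_real_derivative
     (\<Sum>l<m. (-1) ^ Suc l / s ^ Suc l * (- exp (- (?F y)\<^sup>2) * (?H (Suc (m - Suc l)) y * ?H l ((y - x) / s)
              + ?H (m - Suc l) y * ?H (Suc l) ((y - x) / s) / s))
        - real (m choose Suc l) * ((-1) ^ Suc l / s ^ Suc l * ?H (m - Suc l) X * c)
            * (- exp (- (?F y)\<^sup>2) * ?H (Suc l) (?F y) * F'))) (at y)"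
    by (intro DERIV_sum DERIV_diff DERIV_cmult d1 d2)
  also have "(\<lambda>y. \<Sum>l<m. (-1) ^ Suc l / s ^ Suc l * (exp (- (?F y)\<^sup>2) * (?H (m - Suc l) y * ?H l ((y - x) / s)))
         - real (m choose Suc l) * ((-1) ^ Suc l / s ^ Suc l * ?H (m - Suc l) X * c) * (exp (- (?F y)\<^sup>2) * ?H l (?F y)))
     = (\<lambda>y. exp (- (?F y)\<^sup>2) * QM_term k t x y)"
  proof
    fix y
    have *: "{1..m} = Suc ` {..<m}" by (simp add: image_Suc_lessThan)
    show "(\<Sum>l<m. (-1) ^ Suc l / s ^ Suc l * (exp (- (?F y)\<^sup>2) * (?H (m - Suc l) y * ?H l ((y - x) / s)))
         - real (m choose Suc l) * ((-1) ^ Suc l / s ^ Suc l * ?H (m - Suc l) X * c) * (exp (- (?F y)\<^sup>2) * ?H l (?F y)))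
       = exp (- (?F y)\<^sup>2) * QM_term k t x y"
      unfolding QM_term_def sum_distrib_left m_def[symmetric] *
      by (subst sum.reindex)
        (auto intro!: sum.cong simp: s_def[symmetric] X_def[symmetric] cm algebra_simps
          simp del: hermite_poly.simps power_Suc binomial_Suc_Suc)
  qed
  also have "(\<Sum>l<m. (-1) ^ Suc l / s ^ Suc l * (- exp (- (?F y)\<^sup>2) * (?H (Suc (m - Suc l)) y * ?H l ((y - x) / s)
              + ?H (m - Suc l) y * ?H (Suc l) ((y - x) / s) / s))
        - real (m choose Suc l) * ((-1) ^ Suc l / s ^ Suc l * ?H (m - Suc l) X * c)
            * (- exp (- (?F y)\<^sup>2) * ?H (Suc l) (?F y) * F'))
     = exp (- (?F y)\<^sup>2) * (?H m y / s - F' * (?H m X * c))"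
  proof -
    \<comment> \<open>The product rule applied to the l-th product of the first kind gives the
      consecutive values \<open>C l\<close> and \<open>C (Suc l)\<close> with opposite signs;
      \<open>B\<close> collects the terms of the addition theorem.\<close>
    define C where "C l = (-1) ^ l / s ^ l * (?H (m - l) y * ?H l ((y - x) / s)) / s" for l
    define B where "B l = real (m choose l) * ((-1) ^ l / s ^ l * ?H (m - l) X * ?H l (?F y))" for l
    have "(\<Sum>l<m. (-1) ^ Suc l / s ^ Suc l * (- exp (- (?F y)\<^sup>2) * (?H (Suc (m - Suc l)) y * ?H l ((y - x) / s)
              + ?H (m - Suc l) y * ?H (Suc l) ((y - x) / s) / s))
        - real (m choose Suc l) * ((-1) ^ Suc l / s ^ Suc l * ?H (m - Suc l) X * c)
            * (- exp (- (?F y)\<^sup>2) * ?H (Suc l) (?F y) * F'))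
       = (\<Sum>l<m. exp (- (?F y)\<^sup>2) * ((C l - C (Suc l)) + F' * c * B (Suc l)))"
    proof (rule sum.cong, rule refl)
      fix l assume "l \<in> {..<m}"
      then have e: "Suc (m - Suc l) = m - l" by auto
      have "C l = - ((-1) ^ Suc l / s ^ Suc l * (?H (m - l) y * ?H l ((y - x) / s)))"
        by (simp add: C_def del: hermite_poly.simps)
      then show "(-1) ^ Suc l / s ^ Suc l * (- exp (- (?F y)\<^sup>2) * (?H (Suc (m - Suc l)) y * ?H l ((y - x) / s)
              + ?H (m - Suc l) y * ?H (Suc l) ((y - x) / s) / s))
        - real (m choose Suc l) * ((-1) ^ Suc l / s ^ Suc l * ?H (m - Suc l) X * c)
            * (- exp (- (?F y)\<^sup>2) * ?H (Suc l) (?F y) * F')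
       = exp (- (?F y)\<^sup>2) * ((C l - C (Suc l)) + F' * c * B (Suc l))"
        unfolding e B_def C_def[of "Suc l"] by (simp add: algebra_simps del: hermite_poly.simps power_Suc binomial_Suc_Suc)
    qed
    also have "\<dots> = exp (- (?F y)\<^sup>2) * ((C 0 - C m) + F' * c * (\<Sum>l<m. B (Suc l)))"
      by (simp add: sum.distrib sum_distrib_left[symmetric] sum_lessThan_telescope' del: sum_distrib_left)
    also have "(\<Sum>l<m. B (Suc l)) = (\<Sum>l\<le>m. B l) - B 0"
      using sum.lessThan_Suc_shift[of B m] by (simp add: lessThan_Suc_atMost)
    \<comment> \<open>The complete sum in the addition theorem cancels the last telescoping term
      \<open>C m\<close>. The sum in \<open>QM_term\<close> starts at l = 1, and the missing
      \<open>B 0\<close> is what survives.\<close>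
    also have "F' * c * ((\<Sum>l\<le>m. B l) - B 0) = C m - F' * (?H m X * c)"
    proof -
      have "F' * c * (\<Sum>l\<le>m. B l) = ?H m ((y - x) / s) / s ^ (2 * k + 1)"
        using hermite_poly_addition_FF[OF t, of k x y]
        by (simp add: F'_def c_def B_def m_def s_def X_def del: power_Suc)
      also have "\<dots> = C m" by (simp add: C_def m_def)
      finally show ?thesis by (simp add: B_def algebra_simps)
    qed
    also have "C 0 - C m + (C m - F' * (?H m X * c)) = ?H m y / s - F' * (?H m X * c)"
      by (simp add: C_def)
    finally show ?thesis .
  qed
  finally show ?thesis by (simp add: m_def s_def F'_def X_def c_def)
qed

text \<open>The derivative of \<open>erfc\<close> times \<open>PM\<close> cancels the
  \<open>PM\<close> part of the derivative of the second summand. What is left carries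
  e^(-x^2/(1+t)) e^(-F^2), which \<open>FF_square\<close> turns back into density times heat
  kernel.\<close>

lemma Phi_real_deriv:
  assumes t: "t > 0" and M: "M \<ge> 1"
  shows "(Phi_real M x t has_real_derivative
     - (1 / sqrt (pi * t) * exp (- ((x - y)\<^sup>2 / t)) * eta M y)) (at y)"
proof -
  let ?e = "\<lambda>y. exp (- (FF t x y)\<^sup>2)" and ?F' = "sqrt ((1 + t) / t)"
  let ?c = "\<lambda>k. (-1) ^ k / (fact k * 4 ^ k) :: real"
  have "(\<lambda>y. ?e y * QM M t x y) = (\<lambda>y. 2 * (\<Sum>k<M. ?c k * (?e y * QM_term k t x y)))"
    by (simp add: QM_eq_QM_term[OF t] sum_distrib_left algebra_simps)
  moreover have "((\<lambda>y. 2 * (\<Sum>k<M. ?c k * (?e y * QM_term k t x y))) has_real_derivative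
      2 * (\<Sum>k<M. ?c k * (?e y * (poly (hermite_poly (2*k)) y / sqrt t
        - ?F' * (poly (hermite_poly (2*k)) (x / sqrt (1 + t)) / sqrt (1 + t) ^ (2 * k + 1)))))) (at y)"
    by (intro DERIV_cmult DERIV_sum QM_term_deriv t)
  moreover have "(\<Sum>k<M. ?c k * (?e y * (poly (hermite_poly (2*k)) y / sqrt t
        - ?F' * (poly (hermite_poly (2*k)) (x / sqrt (1 + t)) / sqrt (1 + t) ^ (2 * k + 1)))))
      = ?e y * (poly (laguerre (M - 1) (1/2)) (y\<^sup>2) / sqrt t - ?F' * PM M t x)"
  proof -
    have "poly (laguerre (M - 1) (1/2)) (y\<^sup>2) = (\<Sum>k<M. ?c k * poly (hermite_poly (2*k)) y)"
      using laguerre_sum[of "M - 1" "-1/2"] M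
      by (simp add: poly_sum poly_laguerre_hermite lessThan_Suc_atMost[symmetric])
    then show ?thesis
      unfolding PM_eq_hermite_poly[OF t] by (simp add: sum_distrib_left sum_divide_distrib sum_subtractf algebra_simps)
  qed
  ultimately have dQ: "((\<lambda>y. ?e y * QM M t x y) has_real_derivative
      2 * (?e y * (poly (laguerre (M - 1) (1/2)) (y\<^sup>2) / sqrt t - ?F' * PM M t x))) (at y)"
    by simp
  have dF: "((\<lambda>y. FF t x y) has_real_derivative ?F') (at y)"
    unfolding FF_def by (auto intro!: derivative_eq_intros)
  have "((\<lambda>y. exp (- (x\<^sup>2) / (1 + t)) / (2 * sqrt pi) * (erfc (FF t x y) * PM M t x
       - 1 / sqrt pi * (?e y * QM M t x y))) has_real_derivative
     exp (- (x\<^sup>2) / (1 + t)) / (2 * sqrt pi) * ((- 2 / sqrt pi * ?e y * ?F') * PM M t x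
       - 1 / sqrt pi * (2 * (?e y * (poly (laguerre (M - 1) (1/2)) (y\<^sup>2) / sqrt t - ?F' * PM M t x))))) (at y)"
    by (intro DERIV_cmult DERIV_diff dQ DERIV_cmult_right has_real_derivative_erfc dF)
  also have "(\<lambda>y. exp (- (x\<^sup>2) / (1 + t)) / (2 * sqrt pi) * (erfc (FF t x y) * PM M t x
       - 1 / sqrt pi * (?e y * QM M t x y))) = Phi_real M x t"
    by (simp add: Phi_real_def fun_eq_iff)
  also have "exp (- (x\<^sup>2) / (1 + t)) / (2 * sqrt pi) * ((- 2 / sqrt pi * ?e y * ?F') * PM M t x
       - 1 / sqrt pi * (2 * (?e y * (poly (laguerre (M - 1) (1/2)) (y\<^sup>2) / sqrt t - ?F' * PM M t x))))
     = - (exp (- (x\<^sup>2) / (1 + t)) * ?e y) * (poly (laguerre (M - 1) (1/2)) (y\<^sup>2)) / (sqrt t * (sqrt pi * sqrt pi))"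
    by (simp add: field_simps)
  also have "exp (- (x\<^sup>2) / (1 + t)) * ?e y = exp (- y\<^sup>2) * exp (- ((x - y)\<^sup>2 / t))"
    using FF_square[OF t, of x y] t
    by (simp add: power_divide power2_commute algebra_simps flip: exp_add)
  also have "sqrt t * (sqrt pi * sqrt pi) = sqrt (pi * t) * sqrt pi"
    by (simp add: real_sqrt_mult)
  finally show ?thesis
    by (simp add: eta_def mult_ac)
qed

subsection \<open>Degrees\<close>

text \<open>A bound n in place of the exact degree makes the formula apply to all summands of a sum
  at once, including those whose coefficient at n is 0.\<close>

lemma coeff_pcompose_linear_top:
  fixes p :: "real poly"
  assumes "degree p \<le> n"
  shows "coeff (pcompose p [:u, v:]) n = coeff p n * v ^ n" "degree (pcompose p [:u, v:]) \<le> n"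
proof -
  show d: "degree (pcompose p [:u, v:]) \<le> n"
    using assms mult_mono[of "degree p" n "degree [:u, v:]" 1]
    by (intro order.trans[OF degree_pcompose_le]) simp
  show "coeff (pcompose p [:u, v:]) n = coeff p n * v ^ n"
  proof (cases "v = 0 \<or> degree p < n")
    case False
    then have v: "v \<noteq> 0" and n: "degree p = n" using assms by auto
    have "lead_coeff (pcompose p [:u, v:]) = lead_coeff p * lead_coeff [:u, v:] ^ degree p"
      by (rule lead_coeff_comp) (use v in simp)
    then show ?thesis using v n by (simp add: degree_pcompose)
  next
    case True
    then show ?thesis
    proof (cases "degree p < n")
      case True
      moreover have "degree (pcompose p [:u, v:]) < n"
        using True mult_mono[of "degree p" "degree p" "degree [:u, v:]" 1]
        by (intro le_less_trans[OF degree_pcompose_le]) simp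
      ultimately show ?thesis by (simp add: coeff_eq_0)
    next
      case False
      with True have v: "v = 0" by simp
      have "pcompose p [:u:] = [:poly p u:]" by (rule poly_extI) (simp add: poly_pcompose)
      moreover have "poly p u = coeff p 0" if "n = 0"
        using assms that by (auto elim!: degree_eq_zeroE)
      ultimately show ?thesis using v by (cases n) auto
    qed
  qed
qed

lemma coeff_mult_top:
  fixes p q :: "real poly"
  assumes "degree p \<le> m" "degree q \<le> n"
  shows "coeff (p * q) (m + n) = coeff p m * coeff q n"
proof (cases "degree p = m \<and> degree q = n")
  case True
  then show ?thesis using coeff_mult_degree_sum[of p q] by simp
next
  case False
  then have "degree (p * q) < m + n"
    using assms by (intro le_less_trans[OF degree_mult_le]) auto
  moreover have "coeff p m * coeff q n = 0"
    using False assms by (auto simp: coeff_eq_0 le_less)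
  ultimately show ?thesis by (simp add: coeff_eq_0)
qed

lemma PM_poly:
  assumes t: "t > 0" and M: "M \<ge> 1"
  shows "\<exists>P :: real poly. P \<noteq> 0 \<and> degree P = 2 * M - 2 \<and> (\<forall>x. PM M t x = poly P x)"
proof -
  define r where "r = sqrt (1 + t)"
  have r: "r > 0" using t by (simp add: r_def)
  define P where "P = (\<Sum>k<M. smult ((-1) ^ k / (fact k * 4 ^ k) / r ^ (2 * k + 1)) (pcompose (hermite_poly (2*k)) [:0, 1 / r:]))"
  have "PM M t x = poly P x" for x
    unfolding PM_eq_hermite_poly[OF t] P_def by (simp add: poly_sum poly_pcompose r_def)
  moreover have "degree P \<le> 2 * M - 2"
    unfolding P_def
    by (intro degree_sum_le order.trans[OF degree_smult_le] coeff_pcompose_linear_top(2)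
        order.trans[OF degree_coeff_hermite_poly(1)]) auto
  moreover have "coeff P (2 * M - 2) \<noteq> 0"
  proof -
    obtain N where N: "M = Suc N" using M by (cases M) auto
    \<comment> \<open>Only the last summand k = M - 1 reaches the degree 2M - 2, so nothing can
      cancel its leading coefficient.\<close>
    have "coeff P (2 * N) = (\<Sum>k<M. (-1) ^ k / (fact k * 4 ^ k) / r ^ (2 * k + 1) * (coeff (hermite_poly (2*k)) (2 * N) * (1 / r) ^ (2 * N)))"
      unfolding P_def coeff_sum coeff_smult
      by (intro sum.cong refl arg_cong2[where f = "(*)"] coeff_pcompose_linear_top(1)
        order.trans[OF degree_coeff_hermite_poly(1)]) (auto simp: N)
    also have "\<dots> = (\<Sum>k\<in>{N}. (-1) ^ k / (fact k * 4 ^ k) / r ^ (2 * k + 1) * (coeff (hermite_poly (2*k)) (2 * N) * (1 / r) ^ (2 * N)))"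
      using degree_coeff_hermite_poly(1)
      by (intro sum.mono_neutral_right) (auto simp: N coeff_eq_0 le_less_trans[OF degree_coeff_hermite_poly(1)])
    finally show ?thesis using r by (simp add: N degree_coeff_hermite_poly(2))
  qed
  ultimately show ?thesis
    by (metis coeff_0 le_degree le_antisym)
qed

text \<open>At degree 2k - 1 cancellation has to be excluded: the products with H(F) contribute for
  every l, the other ones only for l = 2k. The former add up to a binomial sum without its term l =
  0. The complete sum ((1+t)/t)^(2k) would cancel the latter exactly, so the absent term is the
  leading coefficient.\<close>

lemma QM_term_poly:
  assumes t: "t > 0" and k: "k \<ge> 1"
  shows "\<exists>Q :: real poly. degree Q \<le> 2 * k - 1 \<and> coeff Q (2 * k - 1) \<noteq> 0 \<and> (\<forall>x. QM_term k t x y = poly Q x)"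
proof -
  define r s where "r = sqrt (1 + t)" and "s = sqrt t"
  have rs: "r > 0" "s > 0" "r\<^sup>2 = 1 + t" "s\<^sup>2 = t" using t by (auto simp: r_def s_def)
  have F: "FF t x y = r / s * y + x * (- 1 / (r * s))" for x
  proof -
    have "FF t x y = r / s * (y - x / r\<^sup>2)"
      unfolding rs(3) by (simp add: FF_def r_def s_def real_sqrt_divide)
    then show ?thesis using rs(1,2) by (simp add: right_diff_distrib power2_eq_square)
  qed
  define A where "A l = smult (poly (hermite_poly (2*k - l)) y) (pcompose (hermite_poly (l - 1)) [:y / s, - 1 / s:])" for l
  define B where "B l = pcompose (hermite_poly (2*k - l)) [:0, 1 / r:] * pcompose (hermite_poly (l - 1)) [:r / s * y, - 1 / (r * s):]" for l
  define Q where "Q = (\<Sum>l=1..2*k. smult ((-1) ^ l / s ^ l)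
     (A l - smult (real ((2*k) choose l) / r ^ (2 * k + 1)) (B l)))"
  have "QM_term k t x y = poly Q x" for x
    unfolding QM_term_def Q_def A_def B_def F
    by (simp add: poly_sum poly_pcompose r_def[symmetric] s_def[symmetric] diff_divide_distrib mult.assoc)
  moreover have dA: "degree (A l) \<le> l - 1" for l
    unfolding A_def by (intro order.trans[OF degree_smult_le] coeff_pcompose_linear_top(2) degree_coeff_hermite_poly(1))
  have dB: "degree (B l) \<le> 2 * k - 1" if "l \<in> {1..2*k}" for l
  proof -
    have "degree (B l) \<le> (2 * k - l) + (l - 1)" unfolding B_def
      by (intro order.trans[OF degree_mult_le] add_mono coeff_pcompose_linear_top(2) degree_coeff_hermite_poly(1))
    then show ?thesis using that by auto
  qed
  moreover have "degree Q \<le> 2 * k - 1"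
    unfolding Q_def using dA dB
    by (intro degree_sum_le order.trans[OF degree_smult_le] degree_diff_le) (auto intro: order.trans[OF dA])
  moreover have "coeff Q (2 * k - 1) = - (2 ^ (2 * k - 1) * s / r ^ (4 * k))"
  proof -
    have cB: "coeff (B l) (2 * k - 1) = 2 ^ (2 * k - 1) * ((-1) ^ (l - 1) / (r ^ (2 * k - 1) * s ^ (l - 1)))"
      if l: "l \<in> {1..2*k}" for l
    proof -
      have e: "2 * k - 1 = (2 * k - l) + (l - 1)" using l by auto
      have "coeff (B l) (2 * k - 1) = (2 ^ (2 * k - l) * (1 / r) ^ (2 * k - l)) * (2 ^ (l - 1) * (- 1 / (r * s)) ^ (l - 1))"
        unfolding e B_def
        by (subst coeff_mult_top) (auto intro!: coeff_pcompose_linear_top(2) degree_coeff_hermite_poly(1)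
          simp: coeff_pcompose_linear_top(1) degree_coeff_hermite_poly)
      also have "\<dots> = 2 ^ (2 * k - 1) * ((-1) ^ (l - 1) / (r ^ (2 * k - 1) * s ^ (l - 1)))"
        unfolding e power_add by (simp add: power_divide power_mult_distrib power_minus[of "1 / (r * s)"] mult_ac)
      finally show ?thesis .
    qed
    have cA: "coeff (A l) (2 * k - 1) = (if l = 2 * k then - (2 ^ (2 * k - 1) / s ^ (2 * k - 1)) else 0)"
      if l: "l \<in> {1..2*k}" for l
    proof (cases "l = 2 * k")
      case True
      have "(- 1 / s) ^ (2 * k - 1) = - (1 / s ^ (2 * k - 1))"
        using k by (simp add: power_divide)
      then show ?thesis using True
        unfolding A_def by (simp add: coeff_pcompose_linear_top(1) degree_coeff_hermite_poly)
    next
      case False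
      then have "l - 1 < 2 * k - 1" using l by auto
      then show ?thesis using False dA[of l] by (simp add: coeff_eq_0)
    qed
    have "coeff Q (2 * k - 1) = (\<Sum>l=1..2*k. (-1) ^ l / s ^ l * coeff (A l) (2 * k - 1))
       - (\<Sum>l=1..2*k. (-1) ^ l / s ^ l * (real ((2*k) choose l) / r ^ (2 * k + 1)) * coeff (B l) (2 * k - 1))"
      unfolding Q_def by (simp add: coeff_sum sum_subtractf right_diff_distrib mult.assoc)
    also have "(\<Sum>l=1..2*k. (-1) ^ l / s ^ l * coeff (A l) (2 * k - 1)) =
        (\<Sum>l=1..2*k. if l = 2 * k then - (2 ^ (2 * k - 1) / s ^ (2 * k - 1) / s ^ (2 * k)) else 0)"
      by (intro sum.cong refl) (simp only: cA, simp)
    also have "\<dots> = - (2 ^ (2 * k - 1) / s ^ (2 * k - 1) / s ^ (2 * k))"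
      using k by (subst sum.delta) auto
    also have "(\<Sum>l=1..2*k. (-1) ^ l / s ^ l * (real ((2*k) choose l) / r ^ (2 * k + 1)) * coeff (B l) (2 * k - 1)) =
        (\<Sum>l=1..2*k. - (2 ^ (2 * k - 1) * s / r ^ (4 * k)) * (real ((2*k) choose l) * (1 / s\<^sup>2) ^ l))"
    proof (intro sum.cong refl)
      fix l assume l: "l \<in> {1..2*k}"
      obtain j where j: "l = Suc j" using l by (cases l) auto
      obtain i where i: "k = Suc i" using k by (cases k) auto
      have sg: "(-1 :: real) ^ j * (-1) ^ j = 1" by (simp flip: power_mult_distrib)
      have e: "r ^ (2 * k + 1) * r ^ (2 * k - 1) = r ^ (4 * k)"
      proof -
        have "(2 * k + 1) + (2 * k - 1) = 4 * k" using i by simp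
        then show ?thesis by (metis power_add)
      qed
      have "(-1) ^ l / s ^ l * (real ((2*k) choose l) / r ^ (2 * k + 1)) * coeff (B l) (2 * k - 1)
         = - (2 ^ (2 * k - 1) / (r ^ (2 * k + 1) * r ^ (2 * k - 1)) * real ((2*k) choose l)) * ((-1) ^ j * (-1) ^ j / (s ^ Suc j * s ^ j))"
      proof -
        have "(- e) / S * (N / R) * (W * (e / (R' * S')))
          = - (W / (R * R') * N) * (e * e / (S * S'))" for e S N R W R' S' :: real
          by (simp add: divide_inverse mult_ac)
        from this[of "(-1) ^ j" "s ^ l" "real ((2*k) choose l)" "r ^ (2 * k + 1)" "2 ^ (2 * k - 1)" "r ^ (2 * k - 1)" "s ^ j"]
        show ?thesis unfolding cB[OF l] unfolding j diff_Suc_1 power_Suc[of "-1"] mult_minus1 .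
      qed
      also have "1 / (s ^ Suc j * s ^ j) = s * (1 / s\<^sup>2) ^ l"
        using rs(2) by (simp add: j field_simps power2_eq_square power_mult_distrib)
      then have "(-1) ^ j * (-1) ^ j / (s ^ Suc j * s ^ j) = s * (1 / s\<^sup>2) ^ l" unfolding sg .
      finally show "(-1) ^ l / s ^ l * (real ((2*k) choose l) / r ^ (2 * k + 1)) * coeff (B l) (2 * k - 1) =
          - (2 ^ (2 * k - 1) * s / r ^ (4 * k)) * (real ((2*k) choose l) * (1 / s\<^sup>2) ^ l)"
        unfolding e by (simp add: mult_ac)
    qed
    also have "\<dots> = - (2 ^ (2 * k - 1) * s / r ^ (4 * k)) * (\<Sum>l=1..2*k. real ((2*k) choose l) * (1 / s\<^sup>2) ^ l)"
      by (simp add: sum_distrib_left)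
    also have "(\<Sum>l=1..2*k. real ((2*k) choose l) * (1 / s\<^sup>2) ^ l) = (r\<^sup>2 / s\<^sup>2) ^ (2 * k) - 1"
    proof -
      have e: "r\<^sup>2 / s\<^sup>2 = 1 / s\<^sup>2 + 1" using rs t by (simp add: field_simps)
      have "(r\<^sup>2 / s\<^sup>2) ^ (2 * k) = (\<Sum>l\<le>2*k. real ((2*k) choose l) * (1 / s\<^sup>2) ^ l)"
        unfolding e binomial_ring by simp
      also have "\<dots> = 1 + (\<Sum>l=1..2*k. real ((2*k) choose l) * (1 / s\<^sup>2) ^ l)"
        unfolding atMost_atLeast0 by (subst sum.atLeast_Suc_atMost) auto
      finally show ?thesis by simp
    qed
    also have "- (2 ^ (2 * k - 1) / s ^ (2 * k - 1) / s ^ (2 * k)) - - (2 ^ (2 * k - 1) * s / r ^ (4 * k)) * ((r\<^sup>2 / s\<^sup>2) ^ (2 * k) - 1)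
       = - (2 ^ (2 * k - 1) * s / r ^ (4 * k))"
    proof -
      obtain i where i: "k = Suc i" using k by (cases k) auto
      have b: "2 * (2 * k) = 4 * k" "Suc ((2 * k - 1) + 2 * k) = 4 * k" using i by auto
      have a: "(r\<^sup>2 / s\<^sup>2) ^ (2 * k) = r ^ (4 * k) / (s * (s ^ (2 * k - 1) * s ^ (2 * k)))"
        unfolding power_add[symmetric] power_Suc[symmetric] power_divide power_mult[symmetric] b ..
      have "- (w / u / v) - - (w * s / R) * (R / (s * (u * v)) - 1) = - (w * s / R)"
        if "u \<noteq> 0" "v \<noteq> 0" "R \<noteq> 0" for u v w R :: real
        using that rs(2) by (simp add: field_simps)
      then show ?thesis unfolding a using rs(1,2) by simp
    qed
    finally show ?thesis .
  qed
  ultimately show ?thesis using rs(1,2) by (intro exI[of _ Q]) auto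
qed

lemma QM_poly:
  assumes t: "t > 0" and M: "M \<ge> 2"
  shows "\<exists>Q :: real poly. degree Q = 2 * M - 3 \<and> (\<forall>x. QM M t x y = poly Q x)"
proof -
  obtain N where N: "M = Suc N" "N \<ge> 1" using M by (cases M) auto
  define T where "T k = (SOME Q :: real poly. degree Q \<le> 2 * k - 1 \<and> coeff Q (2 * k - 1) \<noteq> 0 \<and> (\<forall>x. QM_term k t x y = poly Q x))" for k
  have T: "degree (T k) \<le> 2 * k - 1" "coeff (T k) (2 * k - 1) \<noteq> 0" "QM_term k t x y = poly (T k) x"
    if "k \<ge> 1" for k x
    using someI_ex[OF QM_term_poly[OF t that, of y], folded T_def] by auto
  define Q where "Q = (\<Sum>k\<in>{1..N}. smult (2 * (-1) ^ k / (fact k * 4 ^ k)) (T k))"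
  have "QM M t x y = poly Q x" for x
  proof -
    have "QM M t x y = 2 * (\<Sum>k\<in>{1..N}. (-1) ^ k / (fact k * 4 ^ k) * QM_term k t x y)"
      unfolding QM_eq_QM_term[OF t]
      by (intro arg_cong2[where f = "(*)"] refl sum.mono_neutral_right) (auto simp: N QM_term_def)
    also have "\<dots> = poly Q x" unfolding Q_def by (simp add: poly_sum sum_distrib_left T(3) mult.assoc)
    finally show ?thesis .
  qed
  moreover have "degree Q \<le> 2 * N - 1"
    unfolding Q_def
  proof (intro degree_sum_le order.trans[OF degree_smult_le])
    fix k assume "k \<in> {1..N}"
    then show "degree (T k) \<le> 2 * N - 1" using T(1)[of k] by auto
  qed simp
  moreover have "coeff Q (2 * N - 1) \<noteq> 0"
  proof -
    have "coeff Q (2 * N - 1) = (\<Sum>k\<in>{N}. 2 * (-1) ^ k / (fact k * 4 ^ k) * coeff (T k) (2 * N - 1))"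
      unfolding Q_def coeff_sum coeff_smult
    proof (rule sum.mono_neutral_right)
      show "\<forall>k\<in>{1..N} - {N}. 2 * (-1) ^ k / (fact k * 4 ^ k) * coeff (T k) (2 * N - 1) = 0"
      proof
        fix k assume k: "k \<in> {1..N} - {N}"
        then have "degree (T k) < 2 * N - 1" using T(1)[of k] by auto
        then show "2 * (-1) ^ k / (fact k * 4 ^ k) * coeff (T k) (2 * N - 1) = 0"
          by (simp add: coeff_eq_0)
      qed
    qed (use N in auto)
    then show ?thesis using T(2)[of N] N by simp
  qed
  ultimately have "degree Q = 2 * M - 3" using N le_degree[of Q "2 * N - 1"] by auto
  with \<open>\<And>x. QM M t x y = poly Q x\<close> show ?thesis by blast
qed

subsection \<open>The integral representation of the Bessel function\<close>

text \<open>Dominated convergence for a continuous parameter, via sequences. The bound is asked only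
  for \<open>x \<noteq> x0\<close>, so that difference quotients are admissible integrands.\<close>

lemma set_dominated_convergence_at:
  fixes f :: "'a::metric_space \<Rightarrow> 'b \<Rightarrow> 'c::{banach, second_countable_topology}"
  assumes meas: "\<And>x. x \<in> S \<Longrightarrow> set_borel_measurable M A (f x)" "set_borel_measurable M A f0"
    and w: "set_integrable M A w"
    and bound: "\<And>x s. x \<in> S \<Longrightarrow> x \<noteq> x0 \<Longrightarrow> s \<in> A \<Longrightarrow> norm (f x s) \<le> w s"
    and lim: "\<And>s. s \<in> A \<Longrightarrow> ((\<lambda>x. f x s) \<longlongrightarrow> f0 s) (at x0 within S)"
  shows "((\<lambda>x. LINT s:A|M. f x s) \<longlongrightarrow> (LINT s:A|M. f0 s)) (at x0 within S)"
  unfolding tendsto_at_iff_sequentially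
proof (intro allI impI)
  fix X assume X: "\<forall>i. X i \<in> S - {x0}" "X \<longlonglongrightarrow> x0"
  show "((\<lambda>x. LINT s:A|M. f x s) \<circ> X) \<longlonglongrightarrow> (LINT s:A|M. f0 s)"
    unfolding set_lebesgue_integral_def o_def
  proof (rule integral_dominated_convergence)
    show "(\<lambda>s. indicator A s *\<^sub>R f0 s) \<in> borel_measurable M"
      using meas(2) by (simp add: set_borel_measurable_def)
    show "(\<lambda>s. indicator A s *\<^sub>R f (X i) s) \<in> borel_measurable M" for i
      using meas(1)[of "X i"] X by (simp add: set_borel_measurable_def)
    show "integrable M (\<lambda>s. indicator A s *\<^sub>R w s)"
      using w by (simp add: set_integrable_def)
    show "AE s in M. (\<lambda>i. indicator A s *\<^sub>R f (X i) s) \<longlonglongrightarrow> indicator A s *\<^sub>R f0 s"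
    proof (rule AE_I2)
      fix s show "(\<lambda>i. indicator A s *\<^sub>R f (X i) s) \<longlonglongrightarrow> indicator A s *\<^sub>R f0 s"
        using lim[of s, unfolded tendsto_at_iff_sequentially, rule_format, of X] X
        by (cases "s \<in> A") (auto simp: o_def)
    qed
    show "AE s in M. norm (indicator A s *\<^sub>R f (X i) s) \<le> indicator A s *\<^sub>R w s" for i
      using bound[of "X i"] X by (auto simp: indicator_def)
  qed
qed

text \<open>The function G_a of the overview.\<close>

definition bessel_integral :: "real \<Rightarrow> complex \<Rightarrow> complex" where
  "bessel_integral a w = (LINT s:{0<..}|lborel. of_real (s powr (a - 1) * exp (- s)) * exp (- w / of_real s))"

text \<open>With d = Re w this is the modulus of the integrand of G_a(w), and with d = 0 the
  integrand of Gamma(a). It serves as the dominating function throughout.\<close>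

definition bessel_kernel :: "real \<Rightarrow> real \<Rightarrow> real \<Rightarrow> real" where
  "bessel_kernel a d s = s powr (a - 1) * exp (- s) * exp (- d / s)"

lemma norm_bessel_integral_integrand:
  "s > 0 \<Longrightarrow> norm (of_real (s powr (a - 1) * exp (- s)) * exp (- w / of_real s)) = bessel_kernel a (Re w) s"
  by (simp add: norm_mult bessel_kernel_def)

lemma set_borel_measurable_bessel_integral [measurable]:
  "set_borel_measurable lborel {0<..} (\<lambda>s. of_real (s powr (a - 1) * exp (- s)) * exp (- w / of_real s) :: complex)"
  unfolding set_borel_measurable_def by measurable

lemma set_borel_measurable_bessel_kernel [measurable]: "set_borel_measurable lborel {0<..} (bessel_kernel a d)"
  unfolding set_borel_measurable_def bessel_kernel_def by measurable

lemma Gamma_set_integral: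
  assumes "a > (0::real)"
  shows "set_integrable lborel {0<..} (bessel_kernel a 0)" "(LINT s:{0<..}|lborel. bessel_kernel a 0 s) = Gamma a"
proof -
  have hi: "((\<lambda>t. t powr (a - 1) / exp t) has_integral Gamma a) {0..}"
    by (rule Gamma_integral_real[OF assms])
  have "((\<lambda>t. if t \<in> {0<..} then t powr (a - 1) / exp t else 0) has_integral Gamma a) {0..}"
    using hi by (rule has_integral_spike [of "{0}", rotated 2]) auto
  then have "((\<lambda>t. t powr (a - 1) / exp t) has_integral Gamma a) {0<..}"
    by (subst (asm) has_integral_restrict) auto
  then have hi': "(bessel_kernel a 0 has_integral Gamma a) {0<..}"
    by (rule has_integral_eq[rotated]) (simp add: bessel_kernel_def exp_minus divide_inverse)
  then have "bessel_kernel a 0 absolutely_integrable_on {0<..}"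
    by (intro nonnegative_absolutely_integrable_1) (auto simp: bessel_kernel_def integrable_on_def)
  then show i: "set_integrable lborel {0<..} (bessel_kernel a 0)"
    unfolding set_integrable_def
    by (rule integrable_completion[THEN iffD1, rotated])
      (use set_borel_measurable_bessel_kernel[of a 0] in \<open>simp add: set_borel_measurable_def\<close>)
  show "(LINT s:{0<..}|lborel. bessel_kernel a 0 s) = Gamma a"
    using set_borel_integral_eq_integral(2)[OF i] hi' by (simp add: integral_unique)
qed

text \<open>For d > 0 the bound e^(-d/s) \<le> m! (s/d)^m, one term of the exponential series,
  raises the exponent from a to a + m > 0, and the Gamma integrand dominates. For a > 0 the choice m
  = 0 also covers d = 0.\<close>

lemma bessel_kernel_integrable:
  assumes "a > 0 \<and> d \<ge> 0 \<or> d > 0"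
  shows "set_integrable lborel {0<..} (bessel_kernel a d)"
proof -
  obtain m :: nat where m: "a + m > 0" "m = 0 \<or> d > 0"
  proof (cases "a > 0")
    case False
    then have "d > 0" using assms by auto
    moreover obtain m :: nat where "- a < m" using reals_Archimedean2 by blast
    ultimately show ?thesis using that[of m] by simp
  qed (use that[of 0] in auto)
  have d: "d \<ge> 0" using assms by auto
  have "set_integrable lborel {0<..} (\<lambda>s. (if m = 0 then 1 else fact m / d ^ m) * bessel_kernel (a + m) 0 s)"
    by (intro set_integrable_mult_right Gamma_set_integral m)
  then show ?thesis
  proof (rule set_integrable_bound)
    show "AE s in lborel. s \<in> {0<..} \<longrightarrow> norm (bessel_kernel a d s) \<le>
        norm ((if m = 0 then 1 else fact m / d ^ m) * bessel_kernel (a + m) 0 s)"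
    proof (rule AE_I2, rule impI)
      fix s :: real assume "s \<in> {0<..}"
      then have s: "s > 0" by simp
      have p: "s powr (a + m - 1) = s powr (a - 1) * s ^ m"
        using s by (simp add: algebra_simps powr_add[symmetric] flip: powr_realpow)
      have "exp (- d / s) \<le> (if m = 0 then 1 else fact m / d ^ m) * s ^ m"
      proof (cases "m = 0")
        case True
        then show ?thesis using d s by simp
      next
        case False
        then have d: "d > 0" using m by simp
        have "(d / s) ^ m / fact m \<le> exp (d / s)"
          using sum_le_suminf[OF summable_exp_generic[of "d / s"], of "{m}"] d s
          by (simp add: exp_def divide_inverse mult.commute)
        then show ?thesis using d s False
          by (simp add: exp_minus field_simps)
      qed
      then have "s powr (a - 1) * exp (- s) * exp (- d / s) \<le> s powr (a - 1) * exp (- s) * ((if m = 0 then 1 else fact m / d ^ m) * s ^ m)"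
        by (intro mult_left_mono) auto
      then show "norm (bessel_kernel a d s) \<le> norm ((if m = 0 then 1 else fact m / d ^ m) * bessel_kernel (a + m) 0 s)"
        using d s unfolding bessel_kernel_def p by (auto simp: abs_mult mult_ac)
    qed
  qed (rule set_borel_measurable_bessel_kernel)
qed

lemma bessel_integral_integrable:
  assumes "a > 0 \<and> Re w \<ge> 0 \<or> Re w > 0"
  shows "set_integrable lborel {0<..} (\<lambda>s. of_real (s powr (a - 1) * exp (- s)) * exp (- w / of_real s) :: complex)"
  by (rule set_integrable_bound[OF bessel_kernel_integrable[OF assms]])
    (auto simp only: set_borel_measurable_bessel_integral norm_bessel_integral_integrand greaterThan_iff real_norm_def intro!: AE_I2 abs_ge_self)

lemma bessel_integral_0: "a > 0 \<Longrightarrow> bessel_integral a 0 = of_real (Gamma a)"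
proof -
  assume a: "a > 0"
  have "bessel_integral a 0 = (LINT s:{0<..}|lborel. of_real (bessel_kernel a 0 s))"
    by (simp add: bessel_integral_def bessel_kernel_def)
  also have "\<dots> = of_real (Gamma a)"
    using Gamma_set_integral[OF a] by (simp add: set_integral_complex_of_real)
  finally show ?thesis .
qed

lemma bessel_kernel_mono: "s > 0 \<Longrightarrow> d \<le> e \<Longrightarrow> bessel_kernel a e s \<le> bessel_kernel a d s"
  by (auto simp: bessel_kernel_def divide_right_mono intro!: mult_left_mono)

text \<open>Continuity up to the boundary of the half plane. It is needed at w = 0 for the initial
  values of the differential equations and at imaginary w for Re lambda^2 = 0.\<close>

lemma bessel_integral_tendsto:
  assumes "a > 0" "Re w \<ge> 0"
  shows "(bessel_integral a \<longlongrightarrow> bessel_integral a w) (at w within {z. Re z \<ge> 0})"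
  unfolding bessel_integral_def
proof (rule set_dominated_convergence_at[where w = "bessel_kernel a 0"])
  show "set_integrable lborel {0<..} (bessel_kernel a 0)"
    using assms by (intro bessel_kernel_integrable) auto
  show "norm (complex_of_real (s powr (a - 1) * exp (- s)) * exp (- x / complex_of_real s)) \<le> bessel_kernel a 0 s"
    if "x \<in> {z. 0 \<le> Re z}" "s \<in> {0<..}" for x s
    using that by (subst norm_bessel_integral_integrand) (auto intro!: bessel_kernel_mono)
qed (rule set_borel_measurable_bessel_integral | auto intro!: tendsto_intros)+

lemma bessel_integral_tendsto_order:
  assumes "a > 0 \<and> Re w \<ge> 0 \<or> Re w > 0"
  shows "((\<lambda>a. bessel_integral a w) \<longlongrightarrow> bessel_integral a w) (at a)"
proof -
  \<comment> \<open>If a > 0, possibly with Re w = 0, the lower order a - e must stay positive;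
    otherwise Re w > 0 and any radius will do.\<close>
  define e where "e = (if a > 0 then a / 2 else 1)"
  have e: "e > 0" by (auto simp: e_def)
  have ea: "a - e > 0 \<or> Re w > 0" using assms by (auto simp: e_def)
  have "((\<lambda>a. bessel_integral a w) \<longlongrightarrow> bessel_integral a w) (at a within {a - e<..<a + e})"
    unfolding bessel_integral_def
  proof (rule set_dominated_convergence_at[where w = "\<lambda>s. bessel_kernel (a - e) (Re w) s + bessel_kernel (a + e) (Re w) s"])
    show "set_integrable lborel {0<..} (\<lambda>s. bessel_kernel (a - e) (Re w) s + bessel_kernel (a + e) (Re w) s)"
      using assms e ea by (intro set_integral_add bessel_kernel_integrable) auto
    show "norm (complex_of_real (s powr (x - 1) * exp (- s)) * exp (- w / complex_of_real s))
        \<le> bessel_kernel (a - e) (Re w) s + bessel_kernel (a + e) (Re w) s"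
      if "x \<in> {a - e<..<a + e}" "s \<in> {0<..}" for x s
    proof -
      \<comment> \<open>The higher exponent dominates for s \<ge> 1, the lower one for s < 1; the
        sum covers both.\<close>
      have "s powr (x - 1) \<le> s powr (a - e - 1) + s powr (a + e - 1)"
      proof (cases "s \<ge> 1")
        case True
        then have "s powr (x - 1) \<le> s powr (a + e - 1)" using that by (intro powr_mono) auto
        then show ?thesis by (smt (verit) powr_ge_zero)
      next
        case False
        then have "s powr (x - 1) \<le> s powr (a - e - 1)" using that by (intro powr_mono') auto
        then show ?thesis by (smt (verit) powr_ge_zero)
      qed
      then have "s powr (x - 1) * (exp (- s) * exp (- Re w / s)) \<le>
          (s powr (a - e - 1) + s powr (a + e - 1)) * (exp (- s) * exp (- Re w / s))"
        by (intro mult_right_mono) auto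
      then show ?thesis using that
        by (subst norm_bessel_integral_integrand) (auto simp: bessel_kernel_def algebra_simps)
    qed
  qed (rule set_borel_measurable_bessel_integral | auto intro!: tendsto_intros)+
  then show ?thesis using e by (subst (asm) at_within_open) auto
qed

lemma bessel_integral_deriv:
  assumes w: "Re w > 0"
  shows "(bessel_integral a has_field_derivative - bessel_integral (a - 1) w) (at w)"
proof -
  \<comment> \<open>On the ball of radius d around w the real part stays above d. The mean value
    bound e^(-d/s)/s for the difference quotient then dominates uniformly, and its factor 1/s lowers
    the order to a - 1.\<close>
  define d where "d = Re w / 2"
  have d: "d > 0" using w by (simp add: d_def)
  let ?f = "\<lambda>w s. of_real (s powr (a - 1) * exp (- s)) * exp (- w / of_real s) :: complex"
  have re: "Re z > d" if "z \<in> ball w d" for z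
  proof -
    have "\<bar>Re (w - z)\<bar> < d" using that complex_Re_le_cmod[of "w - z"] abs_Re_le_cmod[of "w - z"]
      by (simp add: dist_norm)
    then show ?thesis by (auto simp: d_def abs_if split: if_splits)
  qed
  have "((\<lambda>z. LINT s:{0<..}|lborel. (?f z s - ?f w s) / (z - w)) \<longlongrightarrow>
      (LINT s:{0<..}|lborel. - (of_real (s powr ((a - 1) - 1) * exp (- s)) * exp (- w / of_real s)))) (at w within ball w d)"
  proof (rule set_dominated_convergence_at[where w = "bessel_kernel (a - 1) d"])
    show "set_integrable lborel {0<..} (bessel_kernel (a - 1) d)"
      using d by (intro bessel_kernel_integrable) auto
    show "norm ((?f z s - ?f w s) / (z - w)) \<le> bessel_kernel (a - 1) d s"
      if z: "z \<in> ball w d" "z \<noteq> w" "s \<in> {0<..}" for z s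
    proof -
      have s: "s > 0" using z by simp
      have "norm (exp (- z / of_real s) - exp (- w / of_real s)) \<le> exp (- d / s) / s * norm (z - w)"
      proof (rule field_differentiable_bound)
        show "convex (ball w d)" by simp
        show "((\<lambda>z. exp (- z / of_real s)) has_field_derivative exp (- z / of_real s) * (- 1 / of_real s)) (at z within ball w d)" for z
          using s by (auto intro!: derivative_eq_intros)
        show "norm (exp (- z / of_real s) * (- 1 / of_real s)) \<le> exp (- d / s) / s" if "z \<in> ball w d" for z
          using s re[OF that] by (simp add: norm_mult norm_divide divide_right_mono)
      qed (use z d in auto)
      then have "norm (exp (- z / of_real s) - exp (- w / of_real s)) / norm (z - w) \<le> exp (- d / s) / s"
        using z by (simp add: field_simps)
      then have "s powr (a - 1) * exp (- s) * (norm (exp (- z / of_real s) - exp (- w / of_real s)) / norm (z - w))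
          \<le> s powr (a - 1) * exp (- s) * (exp (- d / s) / s)"
        by (intro mult_left_mono) auto
      also have "\<dots> = bessel_kernel (a - 1) d s"
        using s by (simp add: bessel_kernel_def powr_diff power2_eq_square)
      finally show ?thesis
        by (simp add: norm_mult norm_divide flip: right_diff_distrib)
    qed
    show "((\<lambda>z. (?f z s - ?f w s) / (z - w)) \<longlongrightarrow>
        - (of_real (s powr ((a - 1) - 1) * exp (- s)) * exp (- w / of_real s))) (at w within ball w d)"
      if "s \<in> {0<..}" for s
    proof -
      have "((\<lambda>z. ?f z s) has_field_derivative
          of_real (s powr (a - 1) * exp (- s)) * (exp (- w / of_real s) * (- 1 / of_real s))) (at w within ball w d)"
        using that by (auto intro!: derivative_eq_intros)
      moreover have "s powr (a - 1 - 1) = s powr (a - 1) / s"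
        using that by (subst powr_diff) simp
      ultimately show ?thesis
        unfolding has_field_derivative_iff by simp
    qed
  qed (unfold set_borel_measurable_def, measurable)
  also have "(LINT s:{0<..}|lborel. - (of_real (s powr ((a - 1) - 1) * exp (- s)) * exp (- w / of_real s))) = - bessel_integral (a - 1) w"
    unfolding bessel_integral_def set_lebesgue_integral_def by (simp flip: integral_minus)
  finally have "((\<lambda>z. LINT s:{0<..}|lborel. (?f z s - ?f w s) / (z - w)) \<longlongrightarrow> - bessel_integral (a - 1) w) (at w)"
    using d by (subst (asm) at_within_open) auto
  moreover have "eventually (\<lambda>z. (LINT s:{0<..}|lborel. (?f z s - ?f w s) / (z - w)) = (bessel_integral a z - bessel_integral a w) / (z - w)) (at w)"
  proof -
    have "eventually (\<lambda>z. z \<in> ball w d) (at w)"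
      using d by (intro eventually_at_in_open') auto
    then show ?thesis
    proof eventually_elim
      case (elim z)
      then have "Re z > 0" using re[of z] d by simp
      then show ?case unfolding bessel_integral_def
        using w by (subst set_integral_divide_zero, subst set_integral_diff(2)[OF bessel_integral_integrable bessel_integral_integrable]) auto
    qed
  qed
  ultimately show ?thesis
    unfolding has_field_derivative_iff by (rule Lim_transform_eventually)
qed

text \<open>The substitution s -> c/s maps the half line onto itself. It serves twice: for the
  symmetry of G_a, and to pass from the Bessel integral to the heat kernels.\<close>

lemma set_integral_reciprocal:
  fixes f :: "real \<Rightarrow> complex"
  assumes f: "set_integrable lborel {0<..} f" and c: "c > 0"
  shows "set_integrable lborel {0<..} (\<lambda>s. (c / s\<^sup>2) *\<^sub>R f (c / s))"
    and "(LINT s:{0<..}|lborel. (c / s\<^sup>2) *\<^sub>R f (c / s)) = (LINT s:{0<..}|lborel. f s)"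
proof -
  let ?h = "\<lambda>s. (c / s\<^sup>2) *\<^sub>R f (c / s)"
  have im: "(\<lambda>s. c / s) ` {0<..} = {0<..}"
  proof safe
    fix x :: real assume "x > 0"
    then show "x \<in> (\<lambda>s. c / s) ` {0<..}" using c by (intro image_eqI[of _ _ "c / x"]) auto
  qed (use c in auto)
  have meas: "(\<lambda>s. indicator {0<..} s *\<^sub>R f s) \<in> borel_measurable lborel"
    using f by (auto simp: set_integrable_def)
  have "(\<lambda>s. (c / s\<^sup>2) *\<^sub>R (indicator {0<..} (c / s) *\<^sub>R f (c / s))) \<in> borel_measurable lborel"
    using measurable_compose[OF _ meas, of "\<lambda>s. c / s" lborel]
    by (intro borel_measurable_scaleR[of "\<lambda>s. c / s\<^sup>2"]) simp_all
  also have "(\<lambda>s. (c / s\<^sup>2) *\<^sub>R (indicator {0<..} (c / s) *\<^sub>R f (c / s))) = (\<lambda>s. indicator {0<..} s *\<^sub>R ?h s)"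
    using c by (auto simp: fun_eq_iff indicator_def zero_less_divide_iff)
  finally have meas': "(\<lambda>s. indicator {0<..} s *\<^sub>R ?h s) \<in> borel_measurable lborel" .
  have fa: "f absolutely_integrable_on {0<..}"
    using integrable_completion[OF meas] f unfolding set_integrable_def by blast
  have ab: "\<bar>- c / x\<^sup>2\<bar> = c / x\<^sup>2" for x :: real using c by simp
  have "(\<lambda>x. \<bar>- c / x\<^sup>2\<bar> *\<^sub>R f (c / x)) absolutely_integrable_on {0<..} \<and>
      integral {0<..} (\<lambda>x. \<bar>- c / x\<^sup>2\<bar> *\<^sub>R f (c / x)) = integral {0<..} f"
    by (subst has_absolute_integral_change_of_variables_real[where g = "\<lambda>s. c / s" and h = "\<lambda>x. - c / x\<^sup>2"])
      (use c fa in \<open>auto intro!: derivative_eq_intros simp: im inj_on_def power2_eq_square\<close>)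
  then have h: "?h absolutely_integrable_on {0<..}" "integral {0<..} ?h = integral {0<..} f"
    unfolding ab by auto
  show h': "set_integrable lborel {0<..} ?h"
    using integrable_completion[OF meas'] h(1) unfolding set_integrable_def by blast
  show "(LINT s:{0<..}|lborel. ?h s) = (LINT s:{0<..}|lborel. f s)"
    using set_borel_integral_eq_integral(2)[OF h'] set_borel_integral_eq_integral(2)[OF f] h(2) by simp
qed

text \<open>The substitution s -> x/s exchanges e^(-s) and e^(-x/s). It maps the half line to itself
  only for positive real x; complex arguments are reached by analytic continuation.\<close>

lemma bessel_integral_symmetric:
  assumes x: "x > 0"
  shows "bessel_integral (- a) (of_real x) = of_real (x powr (- a)) * bessel_integral a (of_real x)"
proof -
  let ?f = "\<lambda>s. of_real (s powr (a - 1) * exp (- s)) * exp (- of_real x / of_real s) :: complex"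
  have i: "set_integrable lborel {0<..} ?f"
    using x by (intro bessel_integral_integrable) auto
  have "bessel_integral a (of_real x) = (LINT s:{0<..}|lborel. (x / s\<^sup>2) *\<^sub>R ?f (x / s))"
    unfolding bessel_integral_def by (rule set_integral_reciprocal(2)[OF i x, symmetric])
  also have "\<dots> = (LINT s:{0<..}|lborel. of_real (x powr a) *
      (of_real (s powr (- a - 1) * exp (- s)) * exp (- of_real x / of_real s)))"
  proof (rule set_lebesgue_integral_cong)
    show "\<forall>s. s \<in> {0<..} \<longrightarrow> (x / s\<^sup>2) *\<^sub>R ?f (x / s) = of_real (x powr a) *
      (of_real (s powr (- a - 1) * exp (- s)) * exp (- of_real x / of_real s))"
    proof (intro allI impI)
      fix s :: real assume "s \<in> {0<..}"
      then have s: "s > 0" by simp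
      have "x / s\<^sup>2 * (x / s) powr (a - 1) = x powr a * s powr (- a - 1)"
      proof -
        have "(x / s) powr (a - 1) = x powr (a - 1) * s powr (- (a - 1))"
          unfolding powr_minus using powr_divide[of x s "a - 1"] x s by (simp add: divide_inverse)
        moreover have "x / s\<^sup>2 = x powr 1 * s powr (- 2)"
          using x s by (simp add: powr_minus divide_inverse)
        ultimately have "x / s\<^sup>2 * (x / s) powr (a - 1) = x powr 1 * s powr (- 2) * (x powr (a - 1) * s powr (- (a - 1)))"
          by (simp only:)
        also have "\<dots> = (x powr 1 * x powr (a - 1)) * (s powr (- 2) * s powr (- (a - 1)))"
          by (simp only: mult_ac)
        also have "\<dots> = x powr a * s powr (- a - 1)"
        proof -
          have "- 2 + - (a - 1) = - a - 1" "1 + (a - 1) = a" by simp_all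
          then show ?thesis by (simp only: powr_add[symmetric])
        qed
        finally show ?thesis .
      qed
      moreover have "(x / s\<^sup>2) *\<^sub>R ?f (x / s) =
          of_real (x / s\<^sup>2 * (x / s) powr (a - 1)) * (of_real (exp (- s)) * exp (- of_real x / of_real s))"
      proof -
        have "- (x / (x / s)) = - s" "- complex_of_real x / complex_of_real (x / s) = of_real (- s)"
          "exp (- complex_of_real x / of_real s) = of_real (exp (- (x / s)))"
          using x s by (simp_all flip: exp_of_real)
        then show ?thesis
          by (simp only: scaleR_conv_of_real exp_of_real of_real_mult mult_ac)
      qed
      ultimately show "(x / s\<^sup>2) *\<^sub>R ?f (x / s) = of_real (x powr a) *
          (of_real (s powr (- a - 1) * exp (- s)) * exp (- of_real x / of_real s))"
        by (simp add: mult_ac)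
    qed
  qed auto
  also have "\<dots> = of_real (x powr a) * bessel_integral (- a) (of_real x)"
    unfolding bessel_integral_def by (rule set_integral_mult_right)
  finally show ?thesis using x
    by (simp add: powr_minus field_simps flip: of_real_mult)
qed

section \<open>The power series of the Bessel functions of the first kind\<close>

definition bessel_coeff :: "real \<Rightarrow> nat \<Rightarrow> complex" where
  "bessel_coeff b k = of_real (rGamma (b + real k + 1) / fact k)"

text \<open>The entire factor of I_b: I_b(z) is (z/2)^b times this series at w = z^2/4.\<close>

definition bessel_series :: "real \<Rightarrow> complex \<Rightarrow> complex" where
  "bessel_series b w = (\<Sum>k. bessel_coeff b k * w ^ k)"

text \<open>The multiplied form stays valid at negative integers b, where b + k + 1 can
  vanish.\<close>

lemma bessel_coeff_Suc: "((b + real k + 1) * (real k + 1)) *\<^sub>R bessel_coeff b (Suc k) = bessel_coeff b k"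
proof -
  have e: "b + real (Suc k) + 1 = b + real k + 1 + 1" by simp
  have "(b + real k + 1) * rGamma (b + real k + 1 + 1) = rGamma (b + real k + 1)"
    by (rule rGamma_plus1)
  moreover have "c * n * (R / (n * F)) = c * R / F" if "n \<noteq> 0" for c n R F :: real
    using that by simp
  from this[of "real (Suc k)" "b + real k + 1" "rGamma (b + real k + 1 + 1)" "fact k"]
  have "(b + real k + 1) * (real k + 1) * (rGamma (b + real k + 1 + 1) / fact (Suc k))
      = (b + real k + 1) * rGamma (b + real k + 1 + 1) / fact k"
    by (simp add: add.commute)
  ultimately have "(b + real k + 1) * (real k + 1) * (rGamma (b + real (Suc k) + 1) / fact (Suc k))
      = rGamma (b + real k + 1) / fact k"
    unfolding e by simp
  then show ?thesis
    unfolding bessel_coeff_def scaleR_conv_of_real of_real_mult[symmetric] by (simp only:)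
qed

lemma summable_bessel_series: "summable (\<lambda>k. bessel_coeff b k * w ^ k)"
proof -
  \<comment> \<open>Beyond N both |b + n + 1| \<ge> 1 and n + 1 \<ge> 2|w|, which bounds the ratio
    by 1/2.\<close>
  obtain N :: nat where N: "2 * norm w + \<bar>b\<bar> + 1 < N" using reals_Archimedean2 by blast
  show ?thesis
  proof (rule summable_ratio_test[where c = "1/2" and N = N])
    fix n assume n: "n \<ge> N"
    then have n': "real n \<ge> real N" by simp
    have 1: "\<bar>b + real n + 1\<bar> \<ge> 1" using N n' norm_ge_zero[of w] by linarith
    have 2: "2 * norm w \<le> real n + 1" using N n' by linarith
    have "2 * norm w * norm (bessel_coeff b (Suc n)) \<le> (\<bar>b + real n + 1\<bar> * (real n + 1)) * norm (bessel_coeff b (Suc n))"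
      using mult_mono[OF 1 2] by (intro mult_right_mono) auto
    also have "\<dots> = norm (bessel_coeff b n)"
      unfolding bessel_coeff_Suc[symmetric, of b n] norm_scaleR abs_mult by simp
    finally have "2 * norm w * norm (bessel_coeff b (Suc n)) * norm w ^ n \<le> norm (bessel_coeff b n) * norm w ^ n"
      by (rule mult_right_mono) simp
    then show "norm (bessel_coeff b (Suc n) * w ^ Suc n) \<le> 1 / 2 * norm (bessel_coeff b n * w ^ n)"
      by (simp add: norm_mult norm_power algebra_simps)
  qed simp
qed

lemma diffs_bessel_coeff: "diffs (bessel_coeff b) = bessel_coeff (b + 1)"
proof
  fix n
  have e: "b + real (Suc n) + 1 = b + 1 + real n + 1" by simp
  have "real (Suc n) * (rGamma (b + real (Suc n) + 1) / fact (Suc n)) = rGamma (b + 1 + real n + 1) / fact n"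
    unfolding e by (simp add: fact_Suc del: of_nat_Suc)
  then have "of_real (real (Suc n)) * bessel_coeff b (Suc n) = bessel_coeff (b + 1) n"
    unfolding bessel_coeff_def of_real_mult[symmetric] by (simp only:)
  then show "diffs (bessel_coeff b) n = bessel_coeff (b + 1) n"
    by (simp only: diffs_def of_real_of_nat_eq)
qed

lemma bessel_series_deriv: "(bessel_series b has_field_derivative bessel_series (b + 1) w) (at w)"
  using termdiffs_strong_converges_everywhere[OF summable_bessel_series[of b], of w]
  unfolding bessel_series_def[abs_def] diffs_bessel_coeff .

text \<open>The contiguity relation by which w^b f_b differentiates to w^(b-1) f_(b-1).
  Differentiation then lowers the order a by one in both parts of \<open>bessel_diff\<close>, just
  as it does for G_a.\<close>

lemma bessel_series_recurrence: "bessel_series (b - 1) w = of_real b * bessel_series b w + w * bessel_series (b + 1) w"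
proof -
  have "summable (\<lambda>k. diffs (bessel_coeff b) k * w ^ k)"
    unfolding diffs_bessel_coeff by (rule summable_bessel_series)
  then have "(\<lambda>k. of_nat k * bessel_coeff b k * w ^ (k - Suc 0)) sums bessel_series (b + 1) w"
    using diffs_equiv[of "bessel_coeff b" w] unfolding diffs_bessel_coeff bessel_series_def by simp
  from sums_mult[OF this, of w]
  have "(\<lambda>k. of_nat k * bessel_coeff b k * w ^ k) sums (w * bessel_series (b + 1) w)"
  proof (rule sums_cong[THEN iffD1, rotated])
    show "w * (of_nat k * bessel_coeff b k * w ^ (k - Suc 0)) = of_nat k * bessel_coeff b k * w ^ k" for k
      by (cases k) auto
  qed
  moreover have "(\<lambda>k. of_real b * (bessel_coeff b k * w ^ k)) sums (of_real b * bessel_series b w)"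
    unfolding bessel_series_def by (intro sums_mult summable_sums summable_bessel_series)
  ultimately have "(\<lambda>k. of_real b * (bessel_coeff b k * w ^ k) + of_nat k * bessel_coeff b k * w ^ k)
      sums (of_real b * bessel_series b w + w * bessel_series (b + 1) w)"
    by (rule sums_add[rotated])
  moreover have "of_real b * (bessel_coeff b k * w ^ k) + of_nat k * bessel_coeff b k * w ^ k = bessel_coeff (b - 1) k * w ^ k" for k
  proof -
    have "(b + real k) * rGamma (b + real k + 1) = rGamma (b + real k)"
      by (rule rGamma_plus1)
    then have "(b + real k) * (rGamma (b + real k + 1) / fact k) = rGamma (b - 1 + real k + 1) / fact k"
      by simp
    then have e: "of_real (b + real k) * bessel_coeff b k = bessel_coeff (b - 1) k"
      unfolding bessel_coeff_def of_real_mult[symmetric] by simp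
    show ?thesis unfolding e[symmetric] by (simp add: distrib_right mult.assoc)
  qed
  ultimately show ?thesis
    unfolding bessel_series_def[of "b - 1"] by (simp add: sums_iff)
qed

lemma powr_bessel_series_deriv:
  assumes "w \<notin> \<real>\<^sub>\<le>\<^sub>0"
  shows "((\<lambda>w. w powr of_real b * bessel_series b w) has_field_derivative w powr of_real (b - 1) * bessel_series (b - 1) w) (at w)"
proof -
  have w: "w \<noteq> 0" using assms by auto
  have *: "w powr of_real b = w powr of_real (b - 1) * w"
    using w powr_add[of w "of_real (b - 1)" 1] by simp
  have "((\<lambda>w. w powr of_real b * bessel_series b w) has_field_derivative
     w powr of_real b * bessel_series (b + 1) w + of_real b * w powr (of_real b - 1) * bessel_series b w) (at w)"
    using assms by (auto intro!: derivative_eq_intros bessel_series_deriv)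
  also have "w powr of_real b * bessel_series (b + 1) w + of_real b * w powr (of_real b - 1) * bessel_series b w
      = w powr of_real (b - 1) * bessel_series (b - 1) w"
    unfolding bessel_series_recurrence * by (simp add: algebra_simps)
  finally show ?thesis .
qed

text \<open>With w = z^2/4 and Re z > 0 this is (z/2)^a (I_(-a)(z) - I_a(z)), so G_a should be pi /
  sin(pi a) times it.\<close>

definition bessel_diff :: "real \<Rightarrow> complex \<Rightarrow> complex" where
  "bessel_diff a w = bessel_series (- a) w - w powr of_real a * bessel_series a w"

lemma bessel_diff_deriv:
  assumes "w \<notin> \<real>\<^sub>\<le>\<^sub>0"
  shows "(bessel_diff a has_field_derivative bessel_diff (a - 1) w) (at w)"
  unfolding bessel_diff_def[abs_def]
  using DERIV_diff[OF bessel_series_deriv[of "- a" w] powr_bessel_series_deriv[OF assms, of a]]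
  by (simp add: algebra_simps)

lemma bessel_series_0: "bessel_series b 0 = of_real (rGamma (b + 1))"
  unfolding bessel_series_def powser_zero bessel_coeff_def by simp

section \<open>Identification of the integral with the series at nonintegral orders\<close>

lemma Gamma_rGamma_reflection:
  assumes "a \<in> {0<..<1::real}"
  shows "Gamma a = pi / sin (pi * a) * rGamma (1 - a)"
proof -
  have "of_real (rGamma a * rGamma (1 - a)) = (of_real (sin (pi * a) / pi) :: complex)"
    using rGamma_reflection_complex[of "of_real a"]
    by (simp add: rGamma_complex_of_real[symmetric] sin_of_real[symmetric])
  then have "rGamma a * rGamma (1 - a) = sin (pi * a) / pi"
    by (simp only: of_real_eq_iff)
  moreover have "sin (pi * a) > 0" using assms by (intro sin_gt_zero) auto
  moreover have "Gamma a > 0" using assms by (intro Gamma_real_pos) auto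
  ultimately show ?thesis by (simp add: rGamma_inverse_Gamma[of a] field_simps)
qed

text \<open>Let m be the maximum of |f| and |g| on [0, d]. The weight x^(c-1) has integral d^c/c <
  1/2 over [0, d], so both functions are bounded by m/2 there, whence m \<le> m/2 and m = 0.\<close>

lemma coupled_ode_zero:
  fixes f g :: "real \<Rightarrow> complex"
  assumes ab: "a > 0" "b > 0"
    and cont: "continuous_on {0..1} f" "continuous_on {0..1} g"
    and zero: "f 0 = 0" "g 0 = 0"
    and f': "\<And>x. x > 0 \<Longrightarrow> (f has_vector_derivative - (x powr (a - 1)) *\<^sub>R g x) (at x)"
    and g': "\<And>x. x > 0 \<Longrightarrow> (g has_vector_derivative - (x powr (b - 1)) *\<^sub>R f x) (at x)"
  shows "\<exists>d>0. \<forall>x\<in>{0..d}. f x = 0 \<and> g x = 0"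
proof -
  have ev: "\<forall>\<^sub>F d in at_right 0. d powr c / c < 1/2" if "c > 0" for c :: real
  proof -
    have "((\<lambda>d. d powr c / c) \<longlongrightarrow> 0 powr c / c) (at_right 0)"
      using that by (intro tendsto_divide tendsto_powr' tendsto_ident_at tendsto_const)
        (auto simp: eventually_at_filter)
    then show ?thesis using that by (intro order_tendstoD) auto
  qed
  have "\<forall>\<^sub>F d in at_right 0. d powr a / a < 1/2 \<and> d powr b / b < 1/2 \<and> d \<in> {0<..<1::real}"
    by (intro eventually_conj ev ab eventually_at_right_real) auto
  then obtain d where d: "d powr a / a < 1/2" "d powr b / b < 1/2" "0 < d" "d < 1"
    using eventually_happens'[of "at_right (0::real)"] by (auto simp: trivial_limit_at_right_real)
  have c: "continuous_on {0..d} (\<lambda>x. max (norm (f x)) (norm (g x)))"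
    using d by (intro continuous_intros continuous_on_subset[OF cont(1)] continuous_on_subset[OF cont(2)]) auto
  obtain x0 where x0: "x0 \<in> {0..d}" "\<And>x. x \<in> {0..d} \<Longrightarrow> max (norm (f x)) (norm (g x)) \<le> max (norm (f x0)) (norm (g x0))"
    using continuous_attains_sup[OF _ _ c] d by auto
  define m where "m = max (norm (f x0)) (norm (g x0))"
  \<comment> \<open>Stated for a generic pair h, k so as to serve for (f, g) with exponent a and for
    (g, f) with exponent b.\<close>
  have half: "norm (h x) \<le> m / 2"
    if x: "x \<in> {0..d}" and c: "c > 0" "d powr c / c < 1/2" and h: "continuous_on {0..1} h" "h 0 = 0"
      "\<And>x. x > 0 \<Longrightarrow> (h has_vector_derivative - (x powr (c - 1)) *\<^sub>R k x) (at x)"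
      and k: "\<And>x. x \<in> {0..d} \<Longrightarrow> norm (k x) \<le> m" for h k :: "real \<Rightarrow> complex" and x c :: real
  proof (cases "x = 0")
    case False
    then have x': "x > 0" using x by auto
    have "norm (h x - h 0) \<le> m * (x powr c / c) - m * (0 powr c / c)"
    proof (rule differentiable_bound_general[OF x'])
      show "continuous_on {0..x} h" using x d by (intro continuous_on_subset[OF h(1)]) auto
      show "continuous_on {0..x} (\<lambda>x. m * (x powr c / c))"
        using c by (intro continuous_intros continuous_on_powr') auto
      show "(h has_vector_derivative - (y powr (c - 1)) *\<^sub>R k y) (at y)" if "0 < y" "y < x" for y
        using h(3) that by auto
      show "((\<lambda>x. m * (x powr c / c)) has_vector_derivative m * y powr (c - 1)) (at y)" if "0 < y" "y < x" for y
        unfolding has_real_derivative_iff_has_vector_derivative[symmetric]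
        using that c by (auto intro!: derivative_eq_intros)
      show "norm (- (y powr (c - 1)) *\<^sub>R k y) \<le> m * y powr (c - 1)" if "0 < y" "y < x" for y
        using k[of y] that x by (simp add: mult.commute mult_left_mono)
    qed
    also have "\<dots> \<le> m * (1 / 2)"
    proof -
      have "x powr c / c \<le> d powr c / c" using x x' c by (intro divide_right_mono powr_mono2) auto
      then have "x powr c / c \<le> 1 / 2" using c(2) by linarith
      moreover have "m \<ge> 0" by (auto simp: m_def max_def)
      ultimately have "m * (x powr c / c) \<le> m * (1 / 2)" by (rule mult_left_mono)
      then show ?thesis by simp
    qed
    finally show ?thesis using h(2) by simp
  qed (use h in \<open>auto simp: m_def max_def\<close>)
  have k: "norm (f x) \<le> m" "norm (g x) \<le> m" if "x \<in> {0..d}" for x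
    using x0(2)[OF that] by (auto simp: m_def)
  have h: "norm (f x) \<le> m / 2" "norm (g x) \<le> m / 2" if "x \<in> {0..d}" for x
    using half[OF that ab(1) d(1) cont(1) zero(1) f' k(2)] half[OF that ab(2) d(2) cont(2) zero(2) g' k(1)]
    by auto
  have "m \<le> m / 2" using h[OF x0(1)] by (auto simp: m_def max_def)
  then have "m \<le> 0" by simp
  then have "f x = 0 \<and> g x = 0" if "x \<in> {0..d}" for x
    using k[OF that] by (metis norm_le_zero_iff order.trans)
  then show ?thesis using d by blast
qed

lemma right_half_plane_eqI:
  fixes f g :: "complex \<Rightarrow> complex"
  assumes f: "f holomorphic_on {z. Re z > 0}" and g: "g holomorphic_on {z. Re z > 0}"
    and d: "d > 0" and eq: "\<And>x. 0 < x \<Longrightarrow> x < d \<Longrightarrow> f (of_real x) = g (of_real x)"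
    and w: "Re w > 0"
  shows "f w = g w"
proof -
  have "f w - g w = 0"
  \<comment> \<open>The zeros must accumulate inside the open half plane. Since 0 lies outside it,
    the accumulation point is d/2, approached from the right.\<close>
  proof (rule analytic_continuation[where f = "\<lambda>z. f z - g z" and S = "{z. Re z > 0}"
        and U = "of_real ` {d/2<..<d}" and \<xi> = "of_real (d / 2)"])
    show "(\<lambda>z. f z - g z) holomorphic_on {z. Re z > 0}" using f g by (intro holomorphic_intros)
    show "open {z. Re z > 0}" by (rule open_halfspace_Re_gt)
    show "connected {z. Re z > 0}" by (intro convex_connected convex_halfspace_Re_gt)
    show "complex_of_real (d / 2) islimpt of_real ` {d/2<..<d}"
      unfolding islimpt_approachable
    proof (intro allI impI)
      fix e :: real assume "e > 0"
      then obtain x where "x \<in> {d/2<..<d}" "dist x (d / 2) < e"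
        using islimpt_greaterThanLessThan1[of "d / 2" d] d unfolding islimpt_approachable by fastforce
      then show "\<exists>x'\<in>of_real ` {d/2<..<d}. x' \<noteq> complex_of_real (d / 2) \<and> dist x' (of_real (d / 2)) < e"
        by (intro bexI[of _ "of_real x"]) (auto simp del: of_real_divide)
    qed
  qed (use d eq w in auto)
  then show ?thesis by simp
qed

lemma bessel_integral_holomorphic: "bessel_integral a holomorphic_on {z. Re z > 0}"
  using bessel_integral_deriv by (auto simp: holomorphic_on_open open_halfspace_Re_gt)

lemma Re_pos_not_nonpos_Reals: "Re w > 0 \<Longrightarrow> w \<notin> \<real>\<^sub>\<le>\<^sub>0"
  by (auto simp: complex_nonpos_Reals_iff)

lemma bessel_diff_holomorphic: "bessel_diff a holomorphic_on {z. Re z > 0}"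
  using bessel_diff_deriv[OF Re_pos_not_nonpos_Reals] by (auto simp: holomorphic_on_open open_halfspace_Re_gt)

lemma bessel_integral_eq_bessel_diff_unit:
  assumes a: "a \<in> {0<..<1}" and w: "Re w > 0"
  shows "bessel_integral a w = of_real (pi / sin (pi * a)) * bessel_diff a w"
proof -
  \<comment> \<open>The constant is that of a for both b = a and b = 1 - a, as the sines agree. Only
    with a common constant does the pair close up into a linear system.\<close>
  define D where "D = (\<lambda>b x. bessel_integral b (of_real x) - of_real (pi / sin (pi * a)) * bessel_diff b (of_real x))"
  have s: "pi / sin (pi * b) = pi / sin (pi * a)" if "b = a \<or> b = 1 - a" for b
    using that by (auto simp: right_diff_distrib sin_diff)
  have deriv: "(D b has_vector_derivative - (x powr (b - 1)) *\<^sub>R D (1 - b) x) (at x)" if x: "x > 0" for b x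
  proof -
    let ?c = "of_real (pi / sin (pi * a)) :: complex"
    have "((\<lambda>w. bessel_integral b w - ?c * bessel_diff b w) has_field_derivative
       - bessel_integral (b - 1) (of_real x) - ?c * bessel_diff (b - 1) (of_real x)) (at (of_real x))"
      using x by (intro DERIV_diff DERIV_cmult bessel_integral_deriv bessel_diff_deriv) auto
    then have "(D b has_vector_derivative - bessel_integral (b - 1) (of_real x) - ?c * bessel_diff (b - 1) (of_real x)) (at x)"
      unfolding D_def by (rule has_vector_derivative_real_field)
    moreover have "bessel_integral (b - 1) (of_real x) = of_real (x powr (b - 1)) * bessel_integral (1 - b) (of_real x)"
      using bessel_integral_symmetric[OF x, of "1 - b"] by simp
    moreover have "bessel_diff (b - 1) (of_real x) = - of_real (x powr (b - 1)) * bessel_diff (1 - b) (of_real x)"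
    proof -
      have "x powr (b - 1) * x powr (1 - b) = 1" using x by (simp flip: powr_add)
      then have "of_real (x powr (b - 1)) * of_real (x powr (1 - b)) = (1 :: complex)"
        unfolding of_real_mult[symmetric] by simp
      moreover have "of_real x powr of_real c = (of_real (x powr c) :: complex)" for c
        using x by (simp add: powr_of_real)
      ultimately show ?thesis
        unfolding bessel_diff_def by (simp add: algebra_simps flip: of_real_diff)
    qed
    ultimately show ?thesis
      by (simp add: D_def scaleR_conv_of_real algebra_simps)
  qed
  have cont: "continuous_on {0..1} (D b)" if b: "b > 0" for b
  proof -
    have "continuous_on {0..1} (\<lambda>x. bessel_integral b (of_real x))"
      unfolding continuous_on_def
    proof
      fix x :: real assume x: "x \<in> {0..1}"
      have "filterlim complex_of_real (at (of_real x) within {z. Re z \<ge> 0}) (at x within {0..1})"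
        unfolding filterlim_at by (auto intro!: tendsto_intros simp: eventually_at_filter)
      from filterlim_compose[OF bessel_integral_tendsto[OF b] this] x
      show "((\<lambda>x. bessel_integral b (complex_of_real x)) \<longlongrightarrow> bessel_integral b (complex_of_real x)) (at x within {0..1})"
        by simp
    qed
    moreover have "continuous_on {0..1} (\<lambda>x. bessel_diff b (of_real x))"
    proof -
      have bs: "continuous_on {0..1} (\<lambda>x. bessel_series c (complex_of_real x))" for c
      proof -
        have "continuous_on UNIV (bessel_series c)"
          using bessel_series_deriv by (auto intro!: continuous_at_imp_continuous_on DERIV_isCont)
        then show ?thesis by (rule continuous_on_compose2) (auto intro!: continuous_intros)
      qed
      have "continuous_on {0..1} (\<lambda>x. bessel_series (- b) (of_real x) - of_real (x powr b) * bessel_series b (of_real x))"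
        using b by (intro continuous_intros bs continuous_on_powr') auto
      then show ?thesis
        by (rule continuous_on_eq) (auto simp: bessel_diff_def powr_of_real)
    qed
    ultimately show ?thesis unfolding D_def by (intro continuous_intros)
  qed
  \<comment> \<open>At 0 the term with w^b vanishes and the series leaves 1/Gamma(1 - b), so the
    initial value is the reflection formula.\<close>
  have zero: "D b 0 = 0" if b: "b = a \<or> b = 1 - a" for b
  proof -
    have b01: "b \<in> {0<..<1}" using a b by auto
    then have "bessel_integral b 0 = of_real (pi / sin (pi * a) * rGamma (1 - b))"
      unfolding s[OF b, symmetric] Gamma_rGamma_reflection[OF b01, symmetric] by (intro bessel_integral_0) auto
    then show ?thesis using b01 by (simp add: D_def bessel_diff_def bessel_series_0)
  qed
  obtain d where d: "d > 0" "\<And>x. x \<in> {0..d} \<Longrightarrow> D a x = 0"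
    using coupled_ode_zero[of a "1 - a" "D a" "D (1 - a)"] a cont zero deriv[of _ a] deriv[of _ "1 - a"] by auto
  show ?thesis
  proof (rule right_half_plane_eqI[OF bessel_integral_holomorphic _ d(1) _ w])
    show "(\<lambda>w. of_real (pi / sin (pi * a)) * bessel_diff a w) holomorphic_on {z. 0 < Re z}"
      by (intro holomorphic_intros bessel_diff_holomorphic)
    show "bessel_integral a (of_real x) = of_real (pi / sin (pi * a)) * bessel_diff a (of_real x)" if "0 < x" "x < d" for x
      using d(2)[of x] that by (simp add: D_def)
  qed
qed

text \<open>Differentiating the identity lowers the order by one. The sign in G_a' = -G_(a-1) is
  matched by sin(pi (a - 1)) = -sin(pi a).\<close>

lemma bessel_integral_eq_bessel_diff_lt1:
  assumes a: "a \<in> {0<..<1}" and w: "Re w > 0"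
  shows "bessel_integral (a - real n) w = of_real (pi / sin (pi * (a - real n))) * bessel_diff (a - real n) w"
  using w
proof (induction n arbitrary: w)
  case (Suc n)
  let ?b = "a - real n"
  have "(bessel_integral ?b has_field_derivative - bessel_integral (?b - 1) w) (at w)"
    by (rule bessel_integral_deriv) fact
  moreover have "(bessel_integral ?b has_field_derivative of_real (pi / sin (pi * ?b)) * bessel_diff (?b - 1) w) (at w)"
  proof (rule has_field_derivative_transform_within_open[where S = "{z. Re z > 0}"])
    show "((\<lambda>w. of_real (pi / sin (pi * ?b)) * bessel_diff ?b w) has_field_derivative
        of_real (pi / sin (pi * ?b)) * bessel_diff (?b - 1) w) (at w)"
      by (intro DERIV_cmult bessel_diff_deriv Re_pos_not_nonpos_Reals) fact
  qed (use Suc in \<open>auto simp: open_halfspace_Re_gt\<close>)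
  ultimately have "- bessel_integral (?b - 1) w = of_real (pi / sin (pi * ?b)) * bessel_diff (?b - 1) w"
    by (rule DERIV_unique)
  moreover have "sin (pi * (?b - 1)) = - sin (pi * ?b)"
    by (simp add: right_diff_distrib sin_diff)
  ultimately have "bessel_integral (?b - 1) w = of_real (pi / sin (pi * (?b - 1))) * bessel_diff (?b - 1) w"
    by (metis (no_types, opaque_lifting) add.inverse_inverse divide_minus_right mult_minus_left of_real_minus)
  moreover have "?b - 1 = a - real (Suc n)" by simp
  ultimately show ?case by metis
qed (use bessel_integral_eq_bessel_diff_unit a in simp)

lemma bessel_integral_eq_bessel_diff_interior:
  assumes a: "a \<notin> \<int>" and w: "Re w > 0"
  shows "bessel_integral a w = of_real (pi / sin (pi * a)) * bessel_diff a w"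
proof -
  have lt1: "bessel_integral b w = of_real (pi / sin (pi * b)) * bessel_diff b w" if b: "b < 1" "b \<notin> \<int>" "Re w > 0" for b w
  proof -
    \<comment> \<open>For b < 1 the floor is at most 0, so b is its fractional part minus a natural
      number.\<close>
    have "frac b \<in> {0<..<1}" using b frac_lt_1[of b] by (auto simp: frac_gt_0_iff)
    from bessel_integral_eq_bessel_diff_lt1[OF this b(3), of "nat (- \<lfloor>b\<rfloor>)"] show ?thesis
      using b by (simp add: frac_def)
  qed
  show ?thesis
  proof (cases "a < 1")
    \<comment> \<open>Orders above 1 are reflected to -a by the symmetry, which holds on the
      positive reals only; analytic continuation then extends the identity to the half
      plane.\<close>
    case False
    show ?thesis
    proof (rule right_half_plane_eqI[OF bessel_integral_holomorphic _ zero_less_one _ w])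
      show "(\<lambda>w. of_real (pi / sin (pi * a)) * bessel_diff a w) holomorphic_on {z. 0 < Re z}"
        by (intro holomorphic_intros bessel_diff_holomorphic)
      fix x :: real assume x: "0 < x"
      have na: "- a \<notin> \<int>" "- a < 1" using a False by auto
      have p: "of_real (x powr a) * of_real (x powr (- a)) = (1 :: complex)"
        unfolding of_real_mult[symmetric] using x by (simp flip: powr_add)
      have pw: "of_real x powr of_real c = (of_real (x powr c) :: complex)" for c
        using x by (simp add: powr_of_real)
      have "bessel_integral a (of_real x) = of_real (x powr a) * bessel_integral (- a) (of_real x)"
        using bessel_integral_symmetric[OF x, of "- a"] by simp
      also have "bessel_integral (- a) (of_real x) = of_real (pi / sin (pi * (- a))) * bessel_diff (- a) (of_real x)"
        using x by (intro lt1 na) auto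
      also have "bessel_diff (- a) (of_real x) = - of_real (x powr (- a)) * bessel_diff a (of_real x)"
        unfolding bessel_diff_def pw using p by (simp add: algebra_simps)
      also have "of_real (x powr a) * (of_real (pi / sin (pi * (- a))) * (- of_real (x powr (- a)) * bessel_diff a (of_real x)))
        = of_real (x powr a) * of_real (x powr (- a)) * (of_real (pi / sin (pi * a)) * bessel_diff a (of_real x))"
        by simp
      finally show "bessel_integral a (of_real x) = of_real (pi / sin (pi * a)) * bessel_diff a (of_real x)"
        unfolding p by simp
    qed
  qed (use lt1 a w in auto)
qed

lemma bessel_integral_eq_bessel_diff:
  assumes a: "a \<notin> \<int>" and w: "Re w > 0 \<or> a > 0 \<and> Re w \<ge> 0 \<and> w \<noteq> 0"
  shows "bessel_integral a w = of_real (pi / sin (pi * a)) * bessel_diff a w"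
proof (cases "Re w > 0")
  case False
  then have w: "a > 0" "Re w = 0" "w \<noteq> 0" using w by auto
  \<comment> \<open>A nonzero imaginary w avoids the branch cut, so the series side is continuous at
    w and both sides can be compared as limits from the right half plane.\<close>
  then have "w \<notin> \<real>\<^sub>\<le>\<^sub>0" by (auto simp: complex_nonpos_Reals_iff complex_eq_iff)
  let ?F = "at w within {z. Re z > 0}"
  have "(bessel_integral a \<longlongrightarrow> bessel_integral a w) ?F"
    using w by (intro tendsto_within_subset[OF bessel_integral_tendsto]) auto
  moreover have "(bessel_diff a \<longlongrightarrow> bessel_diff a w) ?F"
    using bessel_diff_deriv[OF \<open>w \<notin> \<real>\<^sub>\<le>\<^sub>0\<close>] DERIV_isCont isCont_def tendsto_within_subset by blast
  then have "((\<lambda>w. of_real (pi / sin (pi * a)) * bessel_diff a w) \<longlongrightarrow> of_real (pi / sin (pi * a)) * bessel_diff a w) ?F"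
    by (intro tendsto_intros)
  moreover have "eventually (\<lambda>z. of_real (pi / sin (pi * a)) * bessel_diff a z = bessel_integral a z) ?F"
    using bessel_integral_eq_bessel_diff_interior[OF a] by (auto simp: eventually_at_filter)
  ultimately have 1: "(bessel_integral a \<longlongrightarrow> bessel_integral a w) ?F" "(bessel_integral a \<longlongrightarrow> of_real (pi / sin (pi * a)) * bessel_diff a w) ?F"
    by (auto intro: Lim_transform_eventually)
  have "w islimpt {z. Re z > 0}"
    unfolding islimpt_approachable
  proof (intro allI impI)
    fix e :: real assume "e > 0"
    then show "\<exists>x'\<in>{z. 0 < Re z}. x' \<noteq> w \<and> dist x' w < e"
      using w by (intro bexI[of _ "w + of_real (e / 2)"]) (auto simp: dist_norm)
  qed
  then have "\<not> trivial_limit ?F" by (simp add: trivial_limit_within)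
  from tendsto_unique[OF this 1] show ?thesis .
qed (use bessel_integral_eq_bessel_diff_interior a in auto)

section \<open>The function K at all orders, integral ones included\<close>

lemma bessel_I_eq_bessel_series: "bessel_I a z = (z / 2) powr of_real a * bessel_series a (z\<^sup>2 / 4)"
  unfolding bessel_I_def bessel_series_def bessel_coeff_def by (simp add: mult_ac)

lemma bessel_quotient_eq_bessel_integral:
  assumes a: "a \<notin> \<int>" and z: "Re z > 0" "Re (z\<^sup>2) \<ge> 0" "a > 0 \<or> Re (z\<^sup>2) > 0"
  shows "of_real (pi / 2) * (bessel_I (- a) z - bessel_I a z) / of_real (sin (a * pi))
    = 1 / 2 * (z / 2) powr of_real (- a) * bessel_integral a (z\<^sup>2 / 4)"
proof -
  let ?v = "z / 2"
  have v: "Re ?v > 0" using z by simp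
  then have v0: "?v \<noteq> 0" by auto
  have z0: "z \<noteq> 0" using v0 by auto
  have "z\<^sup>2 / 4 = ?v\<^sup>2" by (simp add: power2_eq_square)
  \<comment> \<open>For Re z > 0 the argument is below pi/2 in modulus, so doubling it stays in the
    principal range and (z^2/4)^a is the square of (z/2)^a.\<close>
  moreover have "Im (2 * Ln ?v) \<in> {-pi<..pi}"
    using Re_Ln_pos_lt_imp[OF v] v by auto
  then have "Ln (?v\<^sup>2) = 2 * Ln ?v"
    using v0 by (intro Ln_unique) (auto simp: exp_double)
  ultimately have sq: "(z\<^sup>2 / 4) powr of_real a = ?v powr of_real a * ?v powr of_real a"
    using v0 by (simp add: powr_def algebra_simps flip: exp_add)
  have inv: "?v powr of_real (- a) * ?v powr of_real a = 1"
    using v0 by (simp add: powr_def flip: exp_add)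
  have "bessel_integral a (z\<^sup>2 / 4) = of_real (pi / sin (pi * a)) * bessel_diff a (z\<^sup>2 / 4)"
    by (rule bessel_integral_eq_bessel_diff[OF a]) (use z z0 in auto)
  also have "bessel_diff a (z\<^sup>2 / 4) = ?v powr of_real a * (bessel_I (- a) z - bessel_I a z)"
    unfolding bessel_diff_def bessel_I_eq_bessel_series sq using inv by (simp add: algebra_simps)
  finally have "?v powr of_real (- a) * bessel_integral a (z\<^sup>2 / 4) =
      (?v powr of_real (- a) * ?v powr of_real a) * of_real (pi / sin (pi * a)) * (bessel_I (- a) z - bessel_I a z)"
    by (simp only: mult_ac)
  then show ?thesis unfolding inv
    by (simp add: mult.commute[of a pi] mult.assoc)
qed

lemma bessel_K_eq_bessel_integral:
  assumes z: "Re z > 0" "Re (z\<^sup>2) \<ge> 0" "a > 0 \<or> Re (z\<^sup>2) > 0"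
  shows "bessel_K a z = 1 / 2 * (z / 2) powr of_real (- a) * bessel_integral a (z\<^sup>2 / 4)"
proof (cases "a \<in> \<int>")
  case False
  then show ?thesis
    unfolding bessel_K_def Let_def using bessel_quotient_eq_bessel_integral[OF False z] by simp
next
  case True
  let ?K = "\<lambda>\<mu>. of_real (pi / 2) * (bessel_I (- \<mu>) z - bessel_I \<mu> z) / of_real (sin (\<mu> * pi))"
  let ?R = "\<lambda>\<mu>. 1 / 2 * (z / 2) powr of_real (- \<mu>) * bessel_integral \<mu> (z\<^sup>2 / 4)"
  have "(?R \<longlongrightarrow> ?R a) (at a)"
    using z by (intro tendsto_intros bessel_integral_tendsto_order) (auto simp: complex_nonpos_Reals_iff)
  moreover have "eventually (\<lambda>\<mu>. ?R \<mu> = ?K \<mu>) (at a)"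
  proof -
    obtain k where k: "a = of_int k" using True by (auto elim: Ints_cases)
    have "eventually (\<lambda>\<mu>. \<mu> \<in> {a - 1<..<a + 1} \<and> \<mu> \<noteq> a) (at a)"
      using eventually_at_in_open[of "{a - 1<..<a + 1}" a] by simp
    \<comment> \<open>When Re z^2 = 0 the formula is available for positive orders only, and orders
      close to a > 0 are positive.\<close>
    moreover have "eventually (\<lambda>\<mu>. \<mu> > 0 \<or> Re (z\<^sup>2) > 0) (at a)"
      using z(3) order_tendstoD(1)[OF tendsto_ident_at, of 0 a UNIV] by (auto elim: eventually_mono)
    ultimately show ?thesis
    proof eventually_elim
      case (elim \<mu>)
      have "\<mu> \<notin> \<int>"
      proof
        assume "\<mu> \<in> \<int>"
        then obtain j where "\<mu> = of_int j" by (auto elim: Ints_cases)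
        then show False using elim k by auto
      qed
      from bessel_quotient_eq_bessel_integral[OF this z(1,2) elim(2)] show ?case by simp
    qed
  qed
  ultimately have "(?K \<longlongrightarrow> ?R a) (at a)"
    by (rule Lim_transform_eventually)
  then have "Lim (at a) ?K = ?R a" by (intro tendsto_Lim) auto
  then show ?thesis using True unfolding bessel_K_def Let_def by simp
qed

subsection \<open>The fundamental solution as a superposition of heat kernels\<close>

text \<open>The usual heat kernel at time t/4, that is, the normal density of variance t/2. This
  scaling is the source of the factor 1/4 and of the exponent lambda^2 t/4.\<close>

definition heat :: "real \<Rightarrow> real \<Rightarrow> real" where
  "heat t x = 1 / sqrt (pi * t) * exp (- (x\<^sup>2 / t))"

lemma heat_eq_normal_density: "t > 0 \<Longrightarrow> heat t (x - y) = normal_density x (sqrt (t / 2)) y"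
  by (simp add: heat_def normal_density_def power2_commute)

lemma heat_nonneg: "t > 0 \<Longrightarrow> heat t x \<ge> 0"
  by (simp add: heat_def)

lemma heat_le: "t > 0 \<Longrightarrow> heat t x \<le> 1 / sqrt (pi * t)"
  unfolding heat_def by (rule mult_left_le) auto

lemma prod_heat:
  fixes z :: "real ^ 'n"
  assumes t: "t > 0"
  shows "(\<Prod>j\<in>UNIV. heat t (z $ j)) = (pi * t) powr (- (real CARD('n) / 2)) * exp (- ((norm z)\<^sup>2 / t))"
proof -
  have "(norm z)\<^sup>2 = (\<Sum>j\<in>UNIV. (z $ j)\<^sup>2)"
    unfolding norm_vec_def L2_set_def by (simp add: sum_nonneg)
  then have e: "exp (- ((norm z)\<^sup>2 / t)) = (\<Prod>j\<in>UNIV. exp (- ((z $ j)\<^sup>2 / t)))"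
    by (simp only: exp_sum[OF finite_class.finite_UNIV, symmetric] sum_divide_distrib sum_negf)
  have "(1 / sqrt (pi * t)) ^ CARD('n) = (pi * t) powr (- (real CARD('n) / 2))"
    unfolding powr_minus using t powr_half_nat[of "pi * t" "CARD('n)"] by (simp only: power_one_over inverse_eq_divide) simp
  then show ?thesis unfolding heat_def e prod.distrib by simp
qed

text \<open>The complex prefactors of \<open>kappa\<close> and of K combine to a real number: the
  logarithm of mu cancels, which is safe on principal branches because Re mu > 0.\<close>

lemma powr_csqrt_product:
  assumes r: "r > 0" and mu: "Re mu > 0"
  shows "(of_real r / mu) powr of_real c * (mu * of_real r / 2) powr of_real c = of_real ((r\<^sup>2 / 2) powr c)"
proof -
  have mu0: "mu \<noteq> 0" using mu by auto
  have L: "Ln (of_real s * w) = of_real (ln s) + Ln w" if "s > 0" "w \<noteq> 0" for s w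
    unfolding Ln_times_of_real[OF that] Ln_of_real[OF that(1)] ..
  have "Ln (inverse mu) = - Ln mu"
    by (intro Ln_inverse Re_pos_not_nonpos_Reals mu)
  then have 1: "Ln (of_real r * inverse mu) = of_real (ln r) - Ln mu"
    using L[OF r, of "inverse mu"] mu0 by simp
  have 2: "Ln (of_real (r / 2) * mu) = of_real (ln (r / 2)) + Ln mu"
    by (rule L) (use r mu0 in auto)
  have nz: "of_real r * inverse mu \<noteq> 0" "of_real (r / 2) * mu \<noteq> 0" using r mu0 by auto
  have "(of_real r * inverse mu) powr of_real c * (of_real (r / 2) * mu) powr of_real c
      = exp (of_real c * Ln (of_real r * inverse mu) + of_real c * Ln (of_real (r / 2) * mu))"
    unfolding exp_add using nz by (simp only: powr_def if_False)
  also have "\<dots> = exp (of_real c * (of_real (ln r) + of_real (ln (r / 2))))"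
  proof -
    have "C * (A - L) + C * (B + L) = C * (A + B)" for A B C L :: complex
      by (simp add: algebra_simps)
    then show ?thesis unfolding 1 2 by (simp only:)
  qed
  also have "\<dots> = of_real (exp (c * (ln r + ln (r / 2))))"
    by (simp only: of_real_add[symmetric] of_real_mult[symmetric] exp_of_real)
  also have "ln r + ln (r / 2) = ln (r\<^sup>2 / 2)"
  proof -
    have "ln (r * (r / 2)) = ln r + ln (r / 2)" using r by (simp only: ln_mult) simp
    then show ?thesis by (simp only: power2_eq_square times_divide_eq_right)
  qed
  also have "exp (c * ln (r\<^sup>2 / 2)) = (r\<^sup>2 / 2) powr c"
    unfolding powr_def using r by simp
  finally have "(of_real r * inverse mu) powr of_real c * (of_real (r / 2) * mu) powr of_real c = of_real ((r\<^sup>2 / 2) powr c)" .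
  moreover have "of_real r * inverse mu = of_real r / mu" "of_real (r / 2) * mu = mu * of_real r / 2"
    by (rule divide_inverse[symmetric]) simp
  ultimately show ?thesis by (simp only:)
qed

lemma kappa_eq_bessel_integral:
  fixes z :: "real ^ 'n"
  assumes z: "z \<noteq> 0" and lam: "Re (lam\<^sup>2) \<ge> 0" "CARD('n) \<ge> 3 \<or> Re (lam\<^sup>2) > 0"
  shows "kappa lam z = of_real (1 / (4 * pi powr (real CARD('n) / 2)) * norm z powr (2 - real CARD('n)))
           * bessel_integral (real CARD('n) / 2 - 1) (lam\<^sup>2 * of_real ((norm z)\<^sup>2) / 4)"
proof (cases "lam = 0")
  case True
  then have "CARD('n) \<ge> 3" using lam by auto
  then have "real CARD('n) / 2 - 1 > 0" by simp
  then show ?thesis using True by (simp add: kappa_def bessel_integral_0 Let_def)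
next
  case False
  define n where "n = real CARD('n)"
  define r where "r = norm z"
  define mu where "mu = csqrt (lam\<^sup>2)"
  have r: "r > 0" using z by (simp add: r_def)
  have mu2: "mu\<^sup>2 = lam\<^sup>2" by (simp add: mu_def)
  have mu0: "mu \<noteq> 0" using False mu2 by auto
  \<comment> \<open>If Re mu were 0, then Re mu^2 = -(Im mu)^2 \<ge> 0 would force mu = 0.\<close>
  have mu: "Re mu > 0"
  proof (rule ccontr)
    assume "\<not> Re mu > 0"
    moreover have "Re mu \<ge> 0" unfolding mu_def by (rule Re_csqrt)
    ultimately have 0: "Re mu = 0" by simp
    then have "Re (mu\<^sup>2) = - (Im mu)\<^sup>2" by (simp add: power2_eq_square)
    then have "Im mu = 0" using lam(1) mu2 by simp
    with 0 mu0 show False by (simp add: complex_eq_iff)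
  qed
  have sq: "(mu * of_real r)\<^sup>2 = lam\<^sup>2 * of_real (r\<^sup>2)" by (simp add: power_mult_distrib mu2)
  have re: "Re (lam\<^sup>2 * of_real (r\<^sup>2)) = Re (lam\<^sup>2) * r\<^sup>2" by simp
  have "n / 2 - 1 > 0 \<or> Re (lam\<^sup>2) > 0" using lam(2) by (auto simp: n_def)
  then have K: "bessel_K (n / 2 - 1) (mu * of_real r) =
      1 / 2 * (mu * of_real r / 2) powr of_real (- (n / 2 - 1)) * bessel_integral (n / 2 - 1) (lam\<^sup>2 * of_real (r\<^sup>2) / 4)"
    unfolding sq[symmetric]
    by (intro bessel_K_eq_bessel_integral) (use mu r lam in \<open>auto simp: sq re simp del: of_real_power\<close>)
  have "kappa lam z = of_real (1 / (2 * pi) powr (n / 2)) * (of_real r / mu) powr of_real (1 - n / 2)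
      * bessel_K (n / 2 - 1) (mu * of_real r)"
    using False by (simp add: kappa_def n_def r_def mu_def Let_def)
  also have "\<dots> = of_real (1 / (2 * pi) powr (n / 2) / 2)
      * ((of_real r / mu) powr of_real (1 - n / 2) * (mu * of_real r / 2) powr of_real (1 - n / 2))
      * bessel_integral (n / 2 - 1) (lam\<^sup>2 * of_real (r\<^sup>2) / 4)"
    unfolding K by simp
  also have "of_real (1 / (2 * pi) powr (n / 2) / 2)
      * ((of_real r / mu) powr of_real (1 - n / 2) * (mu * of_real r / 2) powr of_real (1 - n / 2))
      = complex_of_real (1 / (2 * pi) powr (n / 2) / 2 * (r\<^sup>2 / 2) powr (1 - n / 2))"
    unfolding powr_csqrt_product[OF r mu] of_real_mult[symmetric] ..
  also have "1 / (2 * pi) powr (n / 2) / 2 * (r\<^sup>2 / 2) powr (1 - n / 2) = 1 / (4 * pi powr (n / 2)) * r powr (2 - n)"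
  proof -
    have "(r\<^sup>2) powr (1 - n / 2) = r powr (2 - n)"
      using r by (simp add: powr_powr right_diff_distrib flip: powr_realpow powr_numeral)
    then have 1: "(r\<^sup>2 / 2) powr (1 - n / 2) = r powr (2 - n) / (2 powr (1 - n / 2))"
      using powr_divide[of "r\<^sup>2" 2 "1 - n / 2"] by simp
    have 2: "2 powr (1 - n / 2) = 2 / (2 powr (n / 2) :: real)"
      by (simp add: powr_diff)
    have 3: "(2 * pi) powr (n / 2) = 2 powr (n / 2) * pi powr (n / 2)"
      by (rule powr_mult)
    show ?thesis unfolding 1 2 3 by simp
  qed
  finally show ?thesis unfolding n_def r_def .
qed

text \<open>The substitution s = |z|^2/t in G_(n/2-1)(lambda^2 |z|^2/4) turns e^(-s) into the
  Gaussian in z and e^(-w/s) into e^(-lambda^2 t/4); the powers of s, |z| and t combine to the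
  n-dimensional normalisation.\<close>

lemma kappa_eq_heat:
  fixes z :: "real ^ 'n"
  assumes z: "z \<noteq> 0" and lam: "Re (lam\<^sup>2) \<ge> 0" "CARD('n) \<ge> 3 \<or> Re (lam\<^sup>2) > 0"
  shows "kappa lam z = 1 / 4 * (LINT t:{0<..}|lborel. exp (- (lam\<^sup>2) * of_real t / 4) * of_real (\<Prod>j\<in>UNIV. heat t (z $ j)))"
proof -
  define n where "n = real CARD('n)"
  define r where "r = norm z"
  have r: "r > 0" using z by (simp add: r_def)
  let ?w = "lam\<^sup>2 * of_real (r\<^sup>2) / 4"
  let ?a = "n / 2 - 1"
  let ?f = "\<lambda>s. of_real (s powr (?a - 1) * exp (- s)) * exp (- ?w / of_real s)"
  have i: "set_integrable lborel {0<..} ?f"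
    by (rule bessel_integral_integrable) (use lam r in \<open>auto simp: n_def simp del: of_real_power\<close>)
  have r2: "r\<^sup>2 > 0" using r by simp
  have "bessel_integral ?a ?w = (LINT t:{0<..}|lborel. (r\<^sup>2 / t\<^sup>2) *\<^sub>R ?f (r\<^sup>2 / t))"
    unfolding bessel_integral_def by (rule set_integral_reciprocal(2)[OF i r2, symmetric])
  also have "\<dots> = (LINT t:{0<..}|lborel. of_real (pi powr (n / 2) * r powr (n - 2)) *
       (exp (- (lam\<^sup>2) * of_real t / 4) * of_real (\<Prod>j\<in>UNIV. heat t (z $ j))))"
  proof (rule set_lebesgue_integral_cong)
    show "\<forall>t. t \<in> {0<..} \<longrightarrow> (r\<^sup>2 / t\<^sup>2) *\<^sub>R ?f (r\<^sup>2 / t) = of_real (pi powr (n / 2) * r powr (n - 2)) *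
       (exp (- (lam\<^sup>2) * of_real t / 4) * of_real (\<Prod>j\<in>UNIV. heat t (z $ j)))"
    proof (intro allI impI)
      fix t :: real assume "t \<in> {0<..}"
      then have t: "t > 0" by simp
      have ex: "- ?w / of_real (r\<^sup>2 / t) = - (lam\<^sup>2) * of_real t / 4"
        using r t by (simp add: field_simps)
      have P: "(\<Prod>j\<in>UNIV. heat t (z $ j)) = (pi * t) powr (- (n / 2)) * exp (- (r\<^sup>2 / t))"
        unfolding n_def r_def by (rule prod_heat[OF t])
      have "r\<^sup>2 / t\<^sup>2 * (r\<^sup>2 / t) powr (?a - 1) = pi powr (n / 2) * r powr (n - 2) * (pi * t) powr (- (n / 2))"
      proof -
        have p2: "y\<^sup>2 = y powr 2" if "y > 0" for y :: real
          using that by (simp add: powr_numeral)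
        have "(r\<^sup>2 / t) powr (?a - 1) = (r\<^sup>2) powr (?a - 1) / t powr (?a - 1)"
          by (rule powr_divide)
        also have "(r\<^sup>2) powr (?a - 1) = r powr (2 * (?a - 1))"
          unfolding p2[OF r] powr_powr ..
        finally have "r\<^sup>2 / t\<^sup>2 * (r\<^sup>2 / t) powr (?a - 1) =
            (r powr 2 * r powr (2 * (?a - 1))) / (t powr 2 * t powr (?a - 1))"
          unfolding p2[OF r] p2[OF t] by simp
        also have "r powr 2 * r powr (2 * (?a - 1)) = r powr (n - 2)"
          unfolding powr_add[symmetric] by simp
        also have "t powr 2 * t powr (?a - 1) = t powr (n / 2)"
          unfolding powr_add[symmetric] by simp
        finally show ?thesis
          using t by (simp add: powr_minus powr_mult field_simps)
      qed
      then have E: "of_real (r\<^sup>2 / t\<^sup>2 * (r\<^sup>2 / t) powr (?a - 1) * exp (- (r\<^sup>2 / t))) =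
          (of_real (pi powr (n / 2) * r powr (n - 2)) * of_real (\<Prod>j\<in>UNIV. heat t (z $ j)) :: complex)"
        unfolding P of_real_mult[symmetric] by (simp only: mult.assoc)
      show "(r\<^sup>2 / t\<^sup>2) *\<^sub>R ?f (r\<^sup>2 / t) = of_real (pi powr (n / 2) * r powr (n - 2)) *
       (exp (- (lam\<^sup>2) * of_real t / 4) * of_real (\<Prod>j\<in>UNIV. heat t (z $ j)))"
        unfolding ex scaleR_conv_of_real
        using arg_cong[OF E, of "\<lambda>v. v * exp (- (lam\<^sup>2) * of_real t / 4)"] by (simp only: of_real_mult mult_ac)
    qed
  qed auto
  also have "\<dots> = of_real (pi powr (n / 2) * r powr (n - 2)) *
      (LINT t:{0<..}|lborel. exp (- (lam\<^sup>2) * of_real t / 4) * of_real (\<Prod>j\<in>UNIV. heat t (z $ j)))"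
    by (rule set_integral_mult_right)
  finally have "kappa lam z = of_real (1 / (4 * pi powr (n / 2)) * r powr (2 - n) * (pi powr (n / 2) * r powr (n - 2))) *
      (LINT t:{0<..}|lborel. exp (- (lam\<^sup>2) * of_real t / 4) * of_real (\<Prod>j\<in>UNIV. heat t (z $ j)))"
    unfolding kappa_eq_bessel_integral[OF assms] n_def r_def by (simp only: of_real_mult mult.assoc)
  also have "1 / (4 * pi powr (n / 2)) * r powr (2 - n) * (pi powr (n / 2) * r powr (n - 2)) = 1 / 4"
  proof -
    have "r powr (2 - n) * r powr (n - 2) = 1" using r by (simp flip: powr_add)
    then show ?thesis by simp
  qed
  finally show ?thesis by simp
qed

subsection \<open>The one-dimensional convolution\<close>

text \<open>The induction halves the rate: the tail of the polynomial uses c/2, and the other half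
  absorbs its factor v through v \<le> (2/c) e^(cv/2).\<close>

lemma poly_le_exp:
  fixes p :: "real poly"
  assumes "c > 0"
  shows "\<exists>C\<ge>0. \<forall>v\<ge>0. \<bar>poly p v\<bar> \<le> C * exp (c * v)"
  using assms
proof (induction p arbitrary: c)
  case 0
  show ?case by (intro exI[of _ 0]) simp
next
  case (pCons b p)
  from pCons.IH[of "c / 2"] pCons.prems obtain C where
    C: "C \<ge> 0" "\<And>v. v \<ge> 0 \<Longrightarrow> \<bar>poly p v\<bar> \<le> C * exp (c / 2 * v)" by auto
  have "\<bar>poly (pCons b p) v\<bar> \<le> (\<bar>b\<bar> + 2 / c * C) * exp (c * v)" if v: "v \<ge> 0" for v
  proof -
    have "v \<le> 2 / c * exp (c / 2 * v)"
      using exp_ge_add_one_self[of "c / 2 * v"] pCons.prems by (simp add: field_simps)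
    then have "v * \<bar>poly p v\<bar> \<le> (2 / c * exp (c / 2 * v)) * (C * exp (c / 2 * v))"
      using C v by (intro mult_mono) auto
    also have "\<dots> = 2 / c * C * exp (c * v)"
      by (simp add: mult_ac flip: exp_add)
    finally have 1: "v * \<bar>poly p v\<bar> \<le> 2 / c * C * exp (c * v)" .
    have "\<bar>b\<bar> * 1 \<le> \<bar>b\<bar> * exp (c * v)"
      using v pCons.prems by (intro mult_left_mono) auto
    moreover have "\<bar>poly (pCons b p) v\<bar> \<le> \<bar>b\<bar> + v * \<bar>poly p v\<bar>"
      using v abs_triangle_ineq[of b "v * poly p v"] by (simp add: abs_mult)
    ultimately show ?thesis using 1 by (simp add: distrib_right)
  qed
  then show ?case using C(1) pCons.prems by (intro exI[of _ "\<bar>b\<bar> + 2 / c * C"]) auto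
qed

lemma continuous_on_eta: "continuous_on A (eta M)"
  unfolding eta_def[abs_def] by (intro continuous_intros)

lemma eta_measurable [measurable]: "eta M \<in> borel_measurable borel"
  by (intro borel_measurable_continuous_onI continuous_on_eta)

lemma eta_bound: "\<exists>C\<ge>0. \<forall>y. \<bar>eta M y\<bar> \<le> C * exp (- (1 / 2 * y\<^sup>2))"
proof -
  obtain C where C: "C \<ge> 0" "\<And>v. v \<ge> 0 \<Longrightarrow> \<bar>poly (laguerre (M - 1) (1/2)) v\<bar> \<le> C * exp (1 / 2 * v)"
    using poly_le_exp[of "1/2" "laguerre (M - 1) (1/2)"] by auto
  have "\<bar>eta M y\<bar> \<le> (1 / sqrt pi * C) * exp (- (1 / 2 * y\<^sup>2))" for y
  proof -
    have "\<bar>eta M y\<bar> = 1 / sqrt pi * \<bar>poly (laguerre (M - 1) (1/2)) (y\<^sup>2)\<bar> * exp (- y\<^sup>2)"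
      by (simp add: eta_def abs_mult)
    also have "\<dots> \<le> 1 / sqrt pi * (C * exp (1 / 2 * y\<^sup>2)) * exp (- y\<^sup>2)"
      using C(2)[of "y\<^sup>2"] by (intro mult_right_mono mult_left_mono) auto
    also have "\<dots> = (1 / sqrt pi * C) * (exp (1 / 2 * y\<^sup>2) * exp (- y\<^sup>2))" by simp
    also have "exp (1 / 2 * y\<^sup>2) * exp (- y\<^sup>2) = exp (- (1 / 2 * y\<^sup>2))"
      unfolding exp_add[symmetric] by simp
    finally show ?thesis .
  qed
  then show ?thesis using C(1) by (intro exI[of _ "1 / sqrt pi * C"]) auto
qed

lemma eta_bounded: "\<exists>C\<ge>0. \<forall>y. \<bar>eta M y\<bar> \<le> C"
proof -
  obtain C where C: "C \<ge> 0" "\<And>y. \<bar>eta M y\<bar> \<le> C * exp (- (1 / 2 * y\<^sup>2))" using eta_bound by blast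
  have "\<bar>eta M y\<bar> \<le> C" for y
    by (rule order.trans[OF C(2)]) (use C(1) in \<open>auto intro!: mult_left_le\<close>)
  then show ?thesis using C(1) by blast
qed

lemma integrable_eta: "integrable lborel (eta M)"
proof -
  obtain C where C: "C \<ge> 0" "\<And>y. \<bar>eta M y\<bar> \<le> C * exp (- (1 / 2 * y\<^sup>2))" using eta_bound by blast
  have "integrable lborel (\<lambda>y::real. C * exp (- (1 / 2 * y\<^sup>2)))"
    by (intro integrable_mult_right integrable_exp_neg_square) simp
  then show ?thesis
    by (rule Bochner_Integration.integrable_bound) (use C in auto)
qed

lemma heat_measurable [measurable]: "heat t \<in> borel_measurable borel"
  unfolding heat_def[abs_def] by measurable

lemma integrable_heat_mult:
  assumes t: "t > 0" and f: "integrable lborel f"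
  shows "integrable lborel (\<lambda>y. heat t (x - y) * f y)"
proof (rule Bochner_Integration.integrable_bound)
  show "integrable lborel (\<lambda>y. 1 / sqrt (pi * t) * f y)" by (intro integrable_mult_right f)
  show "(\<lambda>y. heat t (x - y) * f y) \<in> borel_measurable lborel"
    using f by measurable
  show "AE y in lborel. norm (heat t (x - y) * f y) \<le> norm (1 / sqrt (pi * t) * f y)"
  proof (rule AE_I2)
    fix y
    have "heat t (x - y) * \<bar>f y\<bar> \<le> 1 / sqrt (pi * t) * \<bar>f y\<bar>"
      by (rule mult_right_mono[OF heat_le[OF t]]) simp
    then show "norm (heat t (x - y) * f y) \<le> norm (1 / sqrt (pi * t) * f y)"
      using heat_nonneg[OF t, of "x - y"] t by (simp add: abs_mult)
  qed
qed

text \<open>One constant K, independent of p and infinite values included, so that it cancels in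
  differences. For infinite p the convergence of the tail integral shows that the limits exist;
  without that, \<open>Lim\<close> would be unspecified.\<close>

lemma Phi_eq_tail_integral:
  assumes t: "t > 0" and M: "M \<ge> 1"
  obtains K where "\<And>p. Phi M x t p = K + (LINT s|lborel. indicator {s. p < ereal s} s * (heat t (x - s) * eta M s))"
proof -
  define h where "h s = heat t (x - s) * eta M s" for s
  have hi: "integrable lborel h"
    unfolding h_def by (rule integrable_heat_mult[OF t integrable_eta])
  have hc: "continuous_on UNIV h"
    unfolding h_def heat_def using t by (intro continuous_intros continuous_on_eta) auto
  define G where "G y = (LBINT s:{y..}. h s)" for y
  have "((\<lambda>y. Phi_real M x t y - G y) has_real_derivative 0) (at y)" for y
    using DERIV_diff[OF Phi_real_deriv[OF t M, of x y] has_real_derivative_tail_integral[OF hi hc, of y]]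
    by (simp add: h_def heat_def G_def)
  then have const: "Phi_real M x t y - G y = Phi_real M x t 0 - G 0" for y
    by (intro DERIV_isconst_all) auto
  define K where "K = Phi_real M x t 0 - G 0"
  have P: "Phi_real M x t y = K + G y" for y using const[of y] by (simp add: K_def)
  have hm [measurable]: "h \<in> borel_measurable borel" using hi by auto
  have eqG: "(LINT s|lborel. indicator {s. ereal y < ereal s} s * h s) = G y" for y
    unfolding G_def set_lebesgue_integral_def
    by (intro integral_cong_AE) (auto intro!: AE_I[where N = "{y}"] simp: indicator_def)
  have top: "(G \<longlongrightarrow> 0) at_top"
  proof -
    have "((\<lambda>y. (LINT s|lborel. h s) - (LINT s|lborel. indicator {..y} s *\<^sub>R h s)) \<longlongrightarrow>
       (LINT s|lborel. h s) - (LINT s|lborel. h s)) at_top"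
      by (intro tendsto_diff tendsto_const tendsto_integral_at_top hi) simp
    also have "(\<lambda>y. (LINT s|lborel. h s) - (LINT s|lborel. indicator {..y} s *\<^sub>R h s)) = G"
    proof
      fix y
      have i: "integrable lborel (\<lambda>s. indicator {..y} s *\<^sub>R h s)"
        by (intro integrable_mult_indicator hi) simp
      have "(LINT s|lborel. h s) - (LINT s|lborel. indicator {..y} s *\<^sub>R h s) =
          (LINT s|lborel. h s - indicator {..y} s *\<^sub>R h s)"
        by (rule Bochner_Integration.integral_diff[symmetric, OF hi i])
      also have "\<dots> = (LINT s|lborel. indicator {s. ereal y < ereal s} s * h s)"
        by (intro Bochner_Integration.integral_cong) (auto simp: indicator_def)
      finally show "(LINT s|lborel. h s) - (LINT s|lborel. indicator {..y} s *\<^sub>R h s) = G y"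
        unfolding eqG .
    qed
    finally show ?thesis by simp
  qed
  have bot: "(G \<longlongrightarrow> (LINT s|lborel. h s)) at_bot"
  proof -
    \<comment> \<open>Reflection s -> -s reduces the limit at -infinity to convergence of integrals
      over growing left half lines.\<close>
    have hi': "integrable lborel (\<lambda>s. h (- s))"
      using lborel_integrable_real_affine[OF hi, of "-1" 0] by simp
    have "((\<lambda>y. LINT s|lborel. indicator {..y} s *\<^sub>R h (- s)) \<longlongrightarrow> (LINT s|lborel. h (- s))) at_top"
      by (intro tendsto_integral_at_top hi') simp
    also have "(LINT s|lborel. h (- s)) = (LINT s|lborel. h s)"
      using lborel_integral_real_affine[of "-1" h 0] by simp
    also have "(\<lambda>y. LINT s|lborel. indicator {..y} s *\<^sub>R h (- s)) = (\<lambda>y. G (- y))"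
    proof
      fix y
      have "G (- y) = (LINT s|lborel. indicator {- y..} (- s) *\<^sub>R h (- s))"
        using lborel_integral_real_affine[of "-1" "\<lambda>s. indicator {- y..} s *\<^sub>R h s" 0]
        by (simp add: G_def set_lebesgue_integral_def)
      also have "\<dots> = (LINT s|lborel. indicator {..y} s *\<^sub>R h (- s))"
        by (intro Bochner_Integration.integral_cong) (auto simp: indicator_def)
      finally show "(LINT s|lborel. indicator {..y} s *\<^sub>R h (- s)) = G (- y)" ..
    qed
    finally show ?thesis by (subst filterlim_at_bot_mirror) (simp add: o_def)
  qed
  have "Phi M x t p = K + (LINT s|lborel. indicator {s. p < ereal s} s * h s)" for p
  proof (cases p)
    case (real r)
    then show ?thesis by (simp only: Phi_def ereal.case eqG P)
  next
    case PInf
    have "Lim at_top (Phi_real M x t) = K + 0"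
      unfolding P by (intro tendsto_Lim tendsto_intros top) simp
    then show ?thesis using PInf by (simp add: Phi_def)
  next
    case MInf
    have "Lim at_bot (Phi_real M x t) = K + (LINT s|lborel. h s)"
      unfolding P by (intro tendsto_Lim tendsto_intros bot) simp
    then show ?thesis using MInf by (simp add: Phi_def)
  qed
  then show ?thesis using that unfolding h_def by blast
qed

lemma Phi_diff_eq_integral:
  assumes t: "t > 0" and M: "M \<ge> 1" and pq: "p < q"
  shows "(LINT s|lborel. indicator {s. p < ereal s \<and> ereal s < q} s * (heat t (x - s) * eta M s)) = Phi M x t p - Phi M x t q"
proof -
  obtain K where K: "\<And>p. Phi M x t p = K + (LINT s|lborel. indicator {s. p < ereal s} s * (heat t (x - s) * eta M s))"
    using Phi_eq_tail_integral[OF t M] by blast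
  let ?h = "\<lambda>s. heat t (x - s) * eta M s"
  have hi: "integrable lborel ?h" by (rule integrable_heat_mult[OF t integrable_eta])
  have i: "integrable lborel (\<lambda>s. indicator {s. p < ereal s} s * ?h s)" for p
    using integrable_mult_indicator[OF _ hi, of "{s. p < ereal s}"] by simp
  have "Phi M x t p - Phi M x t q = (LINT s|lborel. indicator {s. p < ereal s} s * ?h s - indicator {s. q < ereal s} s * ?h s)"
    unfolding K by (subst Bochner_Integration.integral_diff[OF i i]) simp
  also have "\<dots> = (LINT s|lborel. indicator {s. p < ereal s \<and> ereal s < q} s * ?h s)"
  proof (intro integral_cong_AE)
    show "AE s in lborel. indicator {s. p < ereal s} s * ?h s - indicator {s. q < ereal s} s * ?h s
        = indicator {s. p < ereal s \<and> ereal s < q} s * ?h s"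
    \<comment> \<open>The difference of the two tails is taken over p < s \<le> q, which differs
      from the open interval in the single point q. For infinite q there is no discrepancy, and the
      default value of \<open>real_of_ereal\<close> does no harm.\<close>
    proof (rule AE_I[where N = "{real_of_ereal q}"])
      show "{s \<in> space lborel. \<not> (indicator {s. p < ereal s} s * ?h s - indicator {s. q < ereal s} s * ?h s
        = indicator {s. p < ereal s \<and> ereal s < q} s * ?h s)} \<subseteq> {real_of_ereal q}"
        using pq by (cases p; cases q) (auto simp: indicator_def split: if_splits)
    qed auto
  qed measurable
  finally show ?thesis ..
qed

text \<open>The substitution s = a y and the parabolic scaling of the heat kernel, space by a and
  time by a^2, produce the arguments a x, a^2 t, a p and a q.\<close>

lemma Phi_scaled_diff:
  assumes t: "t > 0" and M: "M \<ge> 1" and pq: "p < q" and a: "a > 0"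
  shows "(LINT y|lborel. heat t (x - y) * (indicator {s. p < ereal s \<and> ereal s < q} y * eta M (a * y)))
    = Phi M (a * x) (a\<^sup>2 * t) (ereal a * p) - Phi M (a * x) (a\<^sup>2 * t) (ereal a * q)"
proof -
  have less: "ereal a * b < ereal a * c \<longleftrightarrow> b < c" for b c
  proof
    assume l: "ereal a * b < ereal a * c"
    show "b < c"
    proof (rule ccontr)
      assume "\<not> b < c"
      then have "ereal a * c \<le> ereal a * b" using a by (intro ereal_mult_left_mono) auto
      with l show False by simp
    qed
  next
    assume "b < c"
    then show "ereal a * b < ereal a * c" using a by (intro ereal_mult_strict_left_mono) auto
  qed
  have less': "ereal a * b < ereal (a * s) \<longleftrightarrow> b < ereal s" "ereal (a * s) < ereal a * b \<longleftrightarrow> ereal s < b" for b s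
    unfolding times_ereal.simps(1)[symmetric] by (rule less)+
  have h: "a * heat (a\<^sup>2 * t) (a * x - a * y) = heat t (x - y)" for y
  proof -
    have "(a * x - a * y)\<^sup>2 / (a\<^sup>2 * t) = (x - y)\<^sup>2 / t"
      unfolding right_diff_distrib[symmetric] power_mult_distrib using a by simp
    moreover have "sqrt (pi * (a\<^sup>2 * t)) = a * sqrt (pi * t)"
      using a by (simp add: real_sqrt_mult)
    ultimately show ?thesis using a by (simp add: heat_def)
  qed
  have "Phi M (a * x) (a\<^sup>2 * t) (ereal a * p) - Phi M (a * x) (a\<^sup>2 * t) (ereal a * q) =
      (LINT s|lborel. indicator {s. ereal a * p < ereal s \<and> ereal s < ereal a * q} s * (heat (a\<^sup>2 * t) (a * x - s) * eta M s))"
    using t a M pq by (intro Phi_diff_eq_integral[symmetric]) (auto simp: less)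
  also have "\<dots> = \<bar>a\<bar> *\<^sub>R (LINT y|lborel. indicator {s. ereal a * p < ereal s \<and> ereal s < ereal a * q} (0 + a * y)
      * (heat (a\<^sup>2 * t) (a * x - (0 + a * y)) * eta M (0 + a * y)))"
    using a by (intro lborel_integral_real_affine) auto
  also have "\<dots> = (LINT y|lborel. a * (indicator {s. ereal a * p < ereal s \<and> ereal s < ereal a * q} (0 + a * y)
      * (heat (a\<^sup>2 * t) (a * x - (0 + a * y)) * eta M (0 + a * y))))"
    using a by simp
  also have "\<dots> = (LINT y|lborel. heat t (x - y) * (indicator {s. p < ereal s \<and> ereal s < q} y * eta M (a * y)))"
    unfolding h[symmetric] by (intro Bochner_Integration.integral_cong) (auto simp: indicator_def less')
  finally show ?thesis ..
qed

subsection \<open>Integrals of products over Euclidean space\<close>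

lemma borel_measurable_vec_nth [measurable]: "(\<lambda>y :: real ^ 'n. y $ j) \<in> borel_measurable borel"
  by (intro borel_measurable_continuous_onI continuous_on_component continuous_on_id)

lemma lborel_product:
  fixes f :: "'n::finite \<Rightarrow> real \<Rightarrow> real"
  assumes f: "\<And>j. integrable lborel (f j)"
  shows "integrable lborel (\<lambda>y :: real ^ 'n. \<Prod>j\<in>UNIV. f j (y $ j))"
    and "(LINT y|lborel. (\<Prod>j\<in>UNIV. f j ((y :: real ^ 'n) $ j))) = (\<Prod>j\<in>UNIV. LINT s|lborel. f j s)"
proof -
  interpret product_sigma_finite "\<lambda>_ :: real ^ 'n. lborel :: real measure"
    by (simp add: product_sigma_finite_def sigma_finite_lborel)
  let ?e = "\<lambda>i. axis i 1 :: real ^ 'n"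
  \<comment> \<open>Lebesgue measure on the vector space is the image of a product indexed by basis
    vectors; \<open>g\<close> transports the factors from coordinates to that index set.\<close>
  define g where "g b = f (inv ?e b)" for b
  have inj: "inj ?e" by (auto simp: inj_on_def axis_eq_axis)
  have g: "g (?e i) = f i" for i unfolding g_def by (rule arg_cong[OF inv_f_f[OF inj]])
  have B: "(Basis :: (real ^ 'n) set) = range ?e" by (auto simp: Basis_vec_def)
  have fm [measurable]: "f j \<in> borel_measurable borel" for j using f[of j] by auto
  have m: "(\<lambda>y :: real ^ 'n. \<Prod>j\<in>UNIV. f j (y $ j)) \<in> borel_measurable borel" by measurable
  have mp: "(\<lambda>v. \<Sum>b\<in>Basis. v b *\<^sub>R b) \<in> (\<Pi>\<^sub>M b\<in>(Basis :: (real ^ 'n) set). lborel) \<rightarrow>\<^sub>M borel"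
    by measurable
  have comp: "(\<Sum>b\<in>Basis. v b *\<^sub>R b) $ j = v (?e j)" for v :: "real ^ 'n \<Rightarrow> real" and j
  proof -
    have "(\<Sum>b\<in>Basis. v b *\<^sub>R b) $ j = (\<Sum>b\<in>Basis. v b *\<^sub>R b) \<bullet> ?e j"
      by (simp add: inner_axis)
    also have "\<dots> = v (?e j)" by (rule inner_sum_left_Basis) (simp add: B)
    finally show ?thesis .
  qed
  have pr: "(\<Prod>j\<in>UNIV. f j ((\<Sum>b\<in>Basis. v b *\<^sub>R b) $ j)) = (\<Prod>b\<in>Basis. g b (v b))" for v :: "real ^ 'n \<Rightarrow> real"
    unfolding comp unfolding B prod.reindex[OF inj] o_def g ..
  have gi: "integrable lborel (g b)" for b unfolding g_def by (rule f)
  show "integrable lborel (\<lambda>y :: real ^ 'n. \<Prod>j\<in>UNIV. f j (y $ j))"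
    unfolding lborel_eq[where 'a = "real ^ 'n"] integrable_distr_eq[OF mp m] pr
    by (intro product_integrable_prod gi) simp
  have "(LINT y|lborel. (\<Prod>j\<in>UNIV. f j ((y :: real ^ 'n) $ j))) = (\<Prod>b\<in>(Basis :: (real ^ 'n) set). LINT s|lborel. g b s)"
    unfolding lborel_eq[where 'a = "real ^ 'n"] integral_distr[OF mp m] pr
    by (intro product_integral_prod gi) simp
  also have "\<dots> = (\<Prod>j\<in>UNIV. LINT s|lborel. f j s)"
    unfolding B prod.reindex[OF inj] o_def g ..
  finally show "(LINT y|lborel. (\<Prod>j\<in>UNIV. f j ((y :: real ^ 'n) $ j))) = (\<Prod>j\<in>UNIV. LINT s|lborel. f j s)" .
qed

subsection \<open>Interchanging the integrals\<close>

text \<open>Two bounds in one: the supremum of f against total heat mass 1, and the supremum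
  t^(-1/2) of the kernel against the L1 norm of f. The first controls small t, the second large
  t.\<close>

lemma integral_heat_mult_le:
  assumes t: "t > 0" and f: "integrable lborel f" and D: "\<And>s. \<bar>f s\<bar> \<le> D" "(LINT s|lborel. \<bar>f s\<bar>) \<le> D"
  shows "(LINT s|lborel. \<bar>heat t (x - s) * f s\<bar>) \<le> D * min 1 (t powr (- 1 / 2))"
proof -
  have i: "integrable lborel (\<lambda>s. \<bar>heat t (x - s) * f s\<bar>)"
    by (intro integrable_abs integrable_heat_mult t f)
  have D0: "D \<ge> 0" using D(1)[of 0] by linarith
  have 1: "(LINT s|lborel. \<bar>heat t (x - s) * f s\<bar>) \<le> D * 1"
  proof -
    have hi: "integrable lborel (\<lambda>s. heat t (x - s))" "(LINT s|lborel. heat t (x - s)) = 1"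
      unfolding heat_eq_normal_density[OF t] using t by simp_all
    have "(LINT s|lborel. \<bar>heat t (x - s) * f s\<bar>) \<le> (LINT s|lborel. D * heat t (x - s))"
    proof (rule integral_mono[OF i])
      show "integrable lborel (\<lambda>s. D * heat t (x - s))" by (intro integrable_mult_right hi)
      show "\<bar>heat t (x - s) * f s\<bar> \<le> D * heat t (x - s)" for s
        using heat_nonneg[OF t, of "x - s"] D(1)[of s] by (simp add: abs_mult mult.commute mult_right_mono)
    qed
    then show ?thesis using hi by simp
  qed
  have 2: "(LINT s|lborel. \<bar>heat t (x - s) * f s\<bar>) \<le> D * t powr (- 1 / 2)"
  proof -
    have le: "heat t y \<le> t powr (- 1 / 2)" for y
    proof -
      have "sqrt t \<le> sqrt (pi * t)" using t pi_gt3 by simp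
      then have "1 / sqrt (pi * t) \<le> 1 / sqrt t"
        using t by (intro divide_left_mono) auto
      also have "1 / sqrt t = t powr (- 1 / 2)"
        using t by (simp add: powr_minus_divide powr_half_sqrt)
      finally show ?thesis using heat_le[OF t, of y] by linarith
    qed
    have "(LINT s|lborel. \<bar>heat t (x - s) * f s\<bar>) \<le> (LINT s|lborel. t powr (- 1 / 2) * \<bar>f s\<bar>)"
    proof (rule integral_mono[OF i])
      show "integrable lborel (\<lambda>s. t powr (- 1 / 2) * \<bar>f s\<bar>)" by (intro integrable_mult_right integrable_abs f)
      show "\<bar>heat t (x - s) * f s\<bar> \<le> t powr (- 1 / 2) * \<bar>f s\<bar>" for s
        using heat_nonneg[OF t, of "x - s"] mult_right_mono[OF le, of "\<bar>f s\<bar>" "x - s"] by (simp add: abs_mult)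
    qed
    also have "\<dots> = t powr (- 1 / 2) * (LINT s|lborel. \<bar>f s\<bar>)" by simp
    also have "\<dots> \<le> t powr (- 1 / 2) * D" by (intro mult_left_mono D) simp
    finally show ?thesis by (simp add: mult.commute)
  qed
  show ?thesis using 1 2 by (auto simp: min_def)
qed

text \<open>The alternative in the hypothesis is exactly the alternative of the theorem. Three
  factors t^(-1/2) already give the integrable exponent -3/2. For R > 0 the quadratic Taylor term of
  e^(ct), c = R/4, yields e^(-ct) \<le> 2/(ct)^2, whatever n is.\<close>

lemma decay_bound:
  fixes R :: real and n :: nat
  assumes "n \<ge> 3 \<and> R \<ge> 0 \<or> R > 0"
  shows "\<exists>E\<ge>0. \<forall>t>0. exp (- (R * t / 4)) * min 1 (t powr (- 1 / 2)) ^ n \<le> E * (if t \<le> 1 then 1 else t powr (- 3 / 2))"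
proof -
  have m: "min 1 (t powr (- 1 / 2)) ^ n \<le> 1" for t :: real
    by (intro power_le_one) auto
  have e: "exp (- (R * t / 4)) \<le> 1" if "t > 0" for t
    using assms that by auto
  show ?thesis
  proof (cases "R > 0")
    case False
    then have n: "n \<ge> 3" using assms by auto
    have "exp (- (R * t / 4)) * min 1 (t powr (- 1 / 2)) ^ n \<le> 1 * (if t \<le> 1 then 1 else t powr (- 3 / 2))" if t: "t > 0" for t
    proof -
      have "min 1 (t powr (- 1 / 2)) ^ n \<le> (if t \<le> 1 then 1 else t powr (- 3 / 2))"
      proof (cases "t \<le> 1")
        case False
        have "min 1 (t powr (- 1 / 2)) ^ n \<le> min 1 (t powr (- 1 / 2)) ^ 3"
          using n by (intro power_decreasing) auto
        also have "\<dots> \<le> (t powr (- 1 / 2)) ^ 3" by (intro power_mono) auto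
        also have "\<dots> = t powr (- 3 / 2)"
          using t by (simp add: powr_powr flip: powr_realpow)
        finally show ?thesis using False by simp
      qed (use m in auto)
      then show ?thesis using e[OF t] mult_mono[of "exp (- (R * t / 4))" 1] by fastforce
    qed
    then show ?thesis by (intro exI[of _ 1]) auto
  next
    case True
    define c where "c = R / 4"
    have c: "c > 0" using True by (simp add: c_def)
    have "exp (- (R * t / 4)) * min 1 (t powr (- 1 / 2)) ^ n \<le> (1 + 2 / c\<^sup>2) * (if t \<le> 1 then 1 else t powr (- 3 / 2))"
      if t: "t > 0" for t
    proof -
      have "exp (- (R * t / 4)) * min 1 (t powr (- 1 / 2)) ^ n \<le> exp (- (c * t))"
        using m[of t] by (simp add: c_def mult_left_le)
      also have "\<dots> \<le> (1 + 2 / c\<^sup>2) * (if t \<le> 1 then 1 else t powr (- 3 / 2))"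
      proof (cases "t \<le> 1")
        case True
        have "exp (- (c * t)) \<le> 1" using c t by simp
        also have "1 \<le> 1 + 2 / c\<^sup>2" by simp
        finally show ?thesis using True by simp
      next
        case False
        have "1 + c * t + (c * t)\<^sup>2 / 2 \<le> exp (c * t)"
          by (rule exp_lower_Taylor_quadratic) (use c t in simp)
        then have "(c * t)\<^sup>2 / 2 \<le> exp (c * t)"
          using mult_pos_pos[OF c t] by linarith
        then have "exp (- (c * t)) \<le> 2 / c\<^sup>2 * (1 / t\<^sup>2)"
          using c t by (simp add: exp_minus field_simps)
        also have "1 / t\<^sup>2 = t powr (- 2)" using t by (simp add: powr_minus_divide powr_numeral)
        also have "2 / c\<^sup>2 * t powr (- 2) \<le> 2 / c\<^sup>2 * t powr (- 3 / 2)"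
          using False by (intro mult_left_mono powr_mono) auto
        also have "\<dots> \<le> (1 + 2 / c\<^sup>2) * t powr (- 3 / 2)" by (intro mult_right_mono) auto
        finally show ?thesis using False by simp
      qed
      finally show ?thesis .
    qed
    then show ?thesis by (intro exI[of _ "1 + 2 / c\<^sup>2"]) auto
  qed
qed

lemma integrable_decay:
  "integrable lborel (\<lambda>t::real. indicator {0<..} t * (if t \<le> 1 then 1 else t powr (- 3 / 2)))"
proof -
  have "(\<lambda>t::real. t powr (- 3 / 2)) integrable_on {1..}"
    using has_integral_powr_to_inf[of "- 3 / 2" 1] by (auto simp: integrable_on_def)
  then have "(\<lambda>t::real. t powr (- 3 / 2)) absolutely_integrable_on {1..}"
    by (intro nonnegative_absolutely_integrable_1) auto
  then have 1: "integrable lborel (\<lambda>t::real. indicator {1..} t * t powr (- 3 / 2))"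
    by (subst (asm) set_integrable_def, subst (asm) integrable_completion) auto
  have 2: "integrable lborel (indicator {0<..1} :: real \<Rightarrow> real)"
    by (intro integrable_real_indicator) (auto simp: emeasure_lborel_Ioc)
  show ?thesis
    by (rule Bochner_Integration.integrable_bound[OF Bochner_Integration.integrable_add[OF 1 2]])
      (auto intro!: AE_I2 simp: indicator_def)
qed

text \<open>The modulus is integrated over y first: for fixed t it factorises into one-dimensional
  integrals, each of which obeys \<open>integral_heat_mult_le\<close>.\<close>

lemma heat_superposition_integrable:
  fixes f :: "'n::finite \<Rightarrow> real \<Rightarrow> real" and x :: "real ^ 'n"
  assumes f: "\<And>j. integrable lborel (f j)" and C: "\<And>j s. \<bar>f j s\<bar> \<le> C"
    and lam: "Re (lam\<^sup>2) \<ge> 0" "CARD('n) \<ge> 3 \<or> Re (lam\<^sup>2) > 0"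
  shows "integrable (lborel \<Otimes>\<^sub>M lborel) (\<lambda>(t, y). indicator {0<..} t *\<^sub>R
    (exp (- (lam\<^sup>2) * of_real t / 4) * of_real (\<Prod>j\<in>UNIV. heat t (x $ j - y $ j) * f j (y $ j))))"
proof -
  let ?h = "\<lambda>(t, y). indicator {0<..} t *\<^sub>R
    (exp (- (lam\<^sup>2) * of_real t / 4) * of_real (\<Prod>j\<in>UNIV. heat t (x $ j - y $ j) * f j (y $ j))) :: complex"
  have fm [measurable]: "f j \<in> borel_measurable borel" for j using f[of j] by auto
  have hm [measurable]: "?h \<in> borel_measurable (lborel \<Otimes>\<^sub>M lborel)"
    unfolding heat_def by measurable
  \<comment> \<open>A single constant that bounds all suprema and all L1 norms
    simultaneously.\<close>
  define D where "D = C + (\<Sum>j\<in>UNIV. LINT s|lborel. \<bar>f j s\<bar>)"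
  have C0: "C \<ge> 0" using C[of undefined 0] by linarith
  have int0: "(LINT s|lborel. \<bar>f j s\<bar>) \<ge> 0" for j by simp
  have D1: "\<bar>f j s\<bar> \<le> D" for j s
    using C[of j s] sum_nonneg[of UNIV "\<lambda>j. LINT s|lborel. \<bar>f j s\<bar>"] int0 by (simp add: D_def add_increasing2)
  have D2: "(LINT s|lborel. \<bar>f j s\<bar>) \<le> D" for j
    using C0 member_le_sum[of j UNIV "\<lambda>j. LINT s|lborel. \<bar>f j s\<bar>"] int0 by (simp add: D_def add_increasing)
  have D0: "D \<ge> 0" using D2[of undefined] int0[of undefined] by linarith
  have nrm: "norm (?h (t, y)) = indicator {0<..} t * exp (- (Re (lam\<^sup>2) * t / 4))
      * (\<Prod>j\<in>UNIV. \<bar>heat t (x $ j - y $ j) * f j (y $ j)\<bar>)" for t y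
    by (simp add: norm_mult abs_prod del: of_real_prod of_real_mult)
  have fi: "integrable lborel (\<lambda>s. heat t (x $ j - s) * f j s)" if "t > 0" for t j
    by (rule integrable_heat_mult[OF that f])
  have inner: "(LINT y|lborel. norm (?h (t, y))) = indicator {0<..} t * exp (- (Re (lam\<^sup>2) * t / 4))
      * (\<Prod>j\<in>UNIV. LINT s|lborel. \<bar>heat t (x $ j - s) * f j s\<bar>)" for t
  proof (cases "t > 0")
    case True
    show ?thesis unfolding nrm
      using lborel_product(2)[of "\<lambda>j s. \<bar>heat t (x $ j - s) * f j s\<bar>", OF integrable_abs[OF fi[OF True]]]
      by simp
  qed simp
  obtain E where E: "E \<ge> 0" "\<And>t. t > 0 \<Longrightarrow>
      exp (- (Re (lam\<^sup>2) * t / 4)) * min 1 (t powr (- 1 / 2)) ^ CARD('n) \<le> E * (if t \<le> 1 then 1 else t powr (- 3 / 2))"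
    using decay_bound[of "CARD('n)" "Re (lam\<^sup>2)"] lam by blast
  show ?thesis
  proof (rule lborel_pair.Fubini_integrable[OF hm])
    show "AE t in lborel. integrable lborel (\<lambda>y. ?h (t, y))"
    proof (rule AE_I2)
      fix t :: real
      show "integrable lborel (\<lambda>y. ?h (t, y))"
      proof (cases "t > 0")
        case True
        have "integrable lborel (\<lambda>y. of_real (\<Prod>j\<in>UNIV. heat t (x $ j - y $ j) * f j (y $ j)) :: complex)"
          by (intro integrable_of_real lborel_product(1)[of "\<lambda>j s. heat t (x $ j - s) * f j s"] fi True)
        then show ?thesis by simp
      qed simp
    qed
    show "integrable lborel (\<lambda>t. LINT y|lborel. norm (?h (t, y)))"
    proof (rule Bochner_Integration.integrable_bound)
      show "integrable lborel (\<lambda>t::real. D ^ CARD('n) * E * (indicator {0<..} t * (if t \<le> 1 then 1 else t powr (- 3 / 2))))"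
        by (intro integrable_mult_right integrable_decay)
      show "(\<lambda>t. LINT y|lborel. norm (?h (t, y))) \<in> borel_measurable lborel"
        by measurable
      show "AE t in lborel. norm (LINT y|lborel. norm (?h (t, y))) \<le>
          norm (D ^ CARD('n) * E * (indicator {0<..} t * (if t \<le> 1 then 1 else t powr (- 3 / 2))))"
      proof (rule AE_I2)
        fix t :: real
        have "(LINT y|lborel. norm (?h (t, y))) \<le>
            D ^ CARD('n) * E * (indicator {0<..} t * (if t \<le> 1 then 1 else t powr (- 3 / 2)))"
        proof (cases "t > 0")
          case True
          have "(\<Prod>j\<in>UNIV. LINT s|lborel. \<bar>heat t (x $ j - s) * f j s\<bar>) \<le> (\<Prod>j\<in>(UNIV :: 'n set). D * min 1 (t powr (- 1 / 2)))"
            by (intro prod_mono conjI integral_heat_mult_le[OF True f D1 D2]) simp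
          also have "\<dots> = D ^ CARD('n) * min 1 (t powr (- 1 / 2)) ^ CARD('n)"
            by (simp add: power_mult_distrib)
          finally have "exp (- (Re (lam\<^sup>2) * t / 4)) * (\<Prod>j\<in>UNIV. LINT s|lborel. \<bar>heat t (x $ j - s) * f j s\<bar>)
             \<le> exp (- (Re (lam\<^sup>2) * t / 4)) * (D ^ CARD('n) * min 1 (t powr (- 1 / 2)) ^ CARD('n))"
            by (intro mult_left_mono) auto
          also have "\<dots> = D ^ CARD('n) * (exp (- (Re (lam\<^sup>2) * t / 4)) * min 1 (t powr (- 1 / 2)) ^ CARD('n))"
            by simp
          also have "\<dots> \<le> D ^ CARD('n) * (E * (if t \<le> 1 then 1 else t powr (- 3 / 2)))"
            by (intro mult_left_mono E True) (use D0 in auto)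
          finally show ?thesis unfolding inner using True by (simp add: mult.assoc)
        qed (simp add: inner)
        moreover have "(LINT y|lborel. norm (?h (t, y))) \<ge> 0" by simp
        ultimately show "norm (LINT y|lborel. norm (?h (t, y))) \<le>
          norm (D ^ CARD('n) * E * (indicator {0<..} t * (if t \<le> 1 then 1 else t powr (- 3 / 2))))"
          by (simp only: real_norm_def abs_of_nonneg)
      qed
    qed
  qed
qed

lemma volume_potential_heat:
  fixes f :: "'n::finite \<Rightarrow> real \<Rightarrow> real" and x :: "real ^ 'n"
  assumes f: "\<And>j. integrable lborel (f j)" and C: "\<And>j s. \<bar>f j s\<bar> \<le> C"
    and lam: "Re (lam\<^sup>2) \<ge> 0" "CARD('n) \<ge> 3 \<or> Re (lam\<^sup>2) > 0"
    and g: "\<And>y. g y = (\<Prod>j\<in>UNIV. f j (y $ j))"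
  shows "integrable lborel (\<lambda>y. kappa lam (x - y) * of_real (g y))"
    and "set_integrable lborel {0<..} (\<lambda>t. exp (- (lam\<^sup>2) * of_real t / 4) *
           of_real (\<Prod>j\<in>UNIV. LINT s|lborel. heat t (x $ j - s) * f j s))" (is "set_integrable _ _ ?I")
    and "volume_potential lam g x = 1 / 4 * (LINT t:{0<..}|lborel. exp (- (lam\<^sup>2) * of_real t / 4) *
           of_real (\<Prod>j\<in>UNIV. LINT s|lborel. heat t (x $ j - s) * f j s))"
proof -
  define h where "h t y = indicator {0<..} t *\<^sub>R
    (exp (- (lam\<^sup>2) * of_real t / 4) * of_real (\<Prod>j\<in>UNIV. heat t (x $ j - y $ j) * f j (y $ j)))"
    for t :: real and y :: "real ^ 'n"
  have h: "integrable (lborel \<Otimes>\<^sub>M lborel) (case_prod h)"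
    using heat_superposition_integrable[OF f C lam, of x] unfolding h_def .
  have y_int: "(LINT y|lborel. h t y) = indicator {0<..} t *\<^sub>R ?I t" for t
  proof (cases "t > 0")
    case True
    have "(LINT y|lborel. h t y) = exp (- (lam\<^sup>2) * of_real t / 4) *
        of_real (LINT y|lborel. (\<Prod>j\<in>UNIV. heat t (x $ j - y $ j) * f j (y $ j)))"
      using True unfolding h_def by (simp del: of_real_prod of_real_mult)
    also have "(LINT y|lborel. (\<Prod>j\<in>UNIV. heat t (x $ j - y $ j) * f j (y $ j)))
        = (\<Prod>j\<in>UNIV. LINT s|lborel. heat t (x $ j - s) * f j s)"
      by (rule lborel_product(2)[of "\<lambda>j s. heat t (x $ j - s) * f j s"]) (rule integrable_heat_mult[OF True f])
    finally show ?thesis using True by simp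
  qed (simp add: h_def)
  have t_int: "(LINT t|lborel. h t y) = kappa lam (x - y) * of_real (g y) * 4" if "y \<noteq> x" for y
  proof -
    have "(LINT t|lborel. h t y) = (LINT t:{0<..}|lborel. exp (- (lam\<^sup>2) * of_real t / 4) *
        of_real (\<Prod>j\<in>UNIV. heat t ((x - y) $ j)) * of_real (g y))"
      unfolding set_lebesgue_integral_def h_def g prod.distrib
      by (intro Bochner_Integration.integral_cong refl) simp
    also have "\<dots> = (LINT t:{0<..}|lborel. exp (- (lam\<^sup>2) * of_real t / 4) *
        of_real (\<Prod>j\<in>UNIV. heat t ((x - y) $ j))) * of_real (g y)"
      by (rule set_integral_mult_left)
    finally show ?thesis
      unfolding kappa_eq_heat[OF _ lam, of "x - y", simplified right_minus_eq, OF not_sym[OF that]] by simp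
  qed
  have ti: "integrable lborel (\<lambda>y. 1 / 4 * (LINT t|lborel. h t y))"
    by (intro integrable_mult_right lborel_pair.integrable_snd h)
  show "integrable lborel (\<lambda>y. kappa lam (x - y) * of_real (g y))"
    by (rule integrable_discrete_difference[where X = "{x}", THEN iffD1, OF _ _ _ _ ti]) (auto simp: t_int)
  show "set_integrable lborel {0<..} ?I"
    using lborel_pair.integrable_fst[OF h] unfolding y_int set_integrable_def .
  have "volume_potential lam g x = (LINT y|lborel. 1 / 4 * (LINT t|lborel. h t y))"
    unfolding volume_potential_def
    by (rule integral_discrete_difference[where X = "{x}"]) (auto simp: t_int)
  also have "\<dots> = 1 / 4 * (LINT y|lborel. (LINT t|lborel. h t y))"
    by simp
  also have "(LINT y|lborel. (LINT t|lborel. h t y)) = (LINT t|lborel. (LINT y|lborel. h t y))"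
    by (rule lborel_pair.Fubini_integral[OF h])
  finally show "volume_potential lam g x = 1 / 4 * (LINT t:{0<..}|lborel. ?I t)"
    unfolding y_int set_lebesgue_integral_def .
qed

text \<open>The two integrability claims give the equation its content, since a Bochner integral
  that does not exist is 0 by convention. The degree of \<open>QM\<close> is claimed for
  \<open>M \<ge> 2\<close>, because 2M - 3 is truncated to 0 at M = 1; \<open>P \<noteq> 0\<close>
  matters there too, the zero polynomial having degree 0.\<close>

theorem theorem2p1:
  fixes M :: nat and lambda :: complex
    and a :: "'n::finite \<Rightarrow> real" and p q :: "'n \<Rightarrow> ereal"
    and g :: "real ^ 'n \<Rightarrow> real" and u :: "real ^ 'n \<Rightarrow> complex"
  assumes M: "M \<ge> 1"
    and lambda: "Re (lambda\<^sup>2) \<ge> 0"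
    and a: "\<And>j. a j > 0"
    and pq: "\<And>j. p j < q j"
    and g: "\<And>x. g x = (\<Prod>j\<in>UNIV. indicator {s. p j < ereal s \<and> ereal s < q j} (x $ j)
                                    * eta M (a j * x $ j))"
    and u: "u = volume_potential lambda g"
  shows "(\<forall>t>0. \<exists>P :: real poly. P \<noteq> 0 \<and> degree P = 2 * M - 2 \<and> (\<forall>x. PM M t x = poly P x)) \<and>
    (M = 1 \<longrightarrow> (\<forall>t>0. \<forall>x y. QM M t x y = 0)) \<and>
    (M \<ge> 2 \<longrightarrow> (\<forall>t>0. \<forall>y. \<exists>Q :: real poly. degree Q = 2 * M - 3 \<and> (\<forall>x. QM M t x y = poly Q x))) \<and>
    (CARD('n) \<ge> 3 \<or> Re (lambda\<^sup>2) > 0 \<longrightarrow>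
      (\<forall>x. let
          integrand = (\<lambda>t. exp (- (lambda\<^sup>2) * of_real t / 4) *
            of_real (\<Prod>j\<in>UNIV. Phi M (a j * x $ j) ((a j)\<^sup>2 * t) (ereal (a j) * p j)
                               - Phi M (a j * x $ j) ((a j)\<^sup>2 * t) (ereal (a j) * q j)))
        in
          integrable lborel (\<lambda>y. kappa lambda (x - y) * of_real (g y)) \<and>
          set_integrable lborel {0<..} integrand \<and>
          u x = 1 / 4 * (LINT t:{0<..}|lborel. integrand t)))"
proof (intro conjI impI)
  show "\<forall>t>0. \<exists>P :: real poly. P \<noteq> 0 \<and> degree P = 2 * M - 2 \<and> (\<forall>x. PM M t x = poly P x)"
    using PM_poly[OF _ M] by blast
  show "\<forall>t>0. \<forall>x y. QM M t x y = 0" if "M = 1"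
    using that by (simp add: QM_def)
  show "\<forall>t>0. \<forall>y. \<exists>Q :: real poly. degree Q = 2 * M - 3 \<and> (\<forall>x. QM M t x y = poly Q x)" if "M \<ge> 2"
    using QM_poly[OF _ that] by blast
  assume lam: "CARD('n) \<ge> 3 \<or> Re (lambda\<^sup>2) > 0"
  define f where "f j s = indicator {s. p j < ereal s \<and> ereal s < q j} s * eta M (a j * s)" for j s
  obtain C where C: "C \<ge> 0" "\<And>y. \<bar>eta M y\<bar> \<le> C" using eta_bounded by blast
  have fC: "\<bar>f j s\<bar> \<le> C" for j s using C by (auto simp: f_def indicator_def)
  have fi: "integrable lborel (f j)" for j
  proof -
    have "integrable lborel (\<lambda>s. eta M (a j * s))"
      using lborel_integrable_real_affine[OF integrable_eta, of "a j" M 0] a[of j] by simp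
    from integrable_mult_indicator[OF _ this, of "{s. p j < ereal s \<and> ereal s < q j}"]
    show ?thesis by (simp add: f_def[abs_def])
  qed
  have gf: "g y = (\<Prod>j\<in>UNIV. f j (y $ j))" for y unfolding g f_def ..
  show "\<forall>x. let
          integrand = (\<lambda>t. exp (- (lambda\<^sup>2) * of_real t / 4) *
            of_real (\<Prod>j\<in>UNIV. Phi M (a j * x $ j) ((a j)\<^sup>2 * t) (ereal (a j) * p j)
                               - Phi M (a j * x $ j) ((a j)\<^sup>2 * t) (ereal (a j) * q j)))
        in
          integrable lborel (\<lambda>y. kappa lambda (x - y) * of_real (g y)) \<and>
          set_integrable lborel {0<..} integrand \<and>
          u x = 1 / 4 * (LINT t:{0<..}|lborel. integrand t)"
    unfolding Let_def
  proof
    fix x :: "real ^ 'n"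
    let ?I = "\<lambda>t. exp (- (lambda\<^sup>2) * of_real t / 4) *
            of_real (\<Prod>j\<in>UNIV. Phi M (a j * x $ j) ((a j)\<^sup>2 * t) (ereal (a j) * p j)
                               - Phi M (a j * x $ j) ((a j)\<^sup>2 * t) (ereal (a j) * q j))"
    let ?J = "\<lambda>t. exp (- (lambda\<^sup>2) * of_real t / 4) * of_real (\<Prod>j\<in>UNIV. LINT s|lborel. heat t (x $ j - s) * f j s)"
    have IJ: "?J t = ?I t" if "t \<in> {0<..}" for t
      unfolding f_def using that by (subst Phi_scaled_diff[OF _ M pq a]) auto
    note V = volume_potential_heat[OF fi fC lambda lam gf, of x]
    have "set_integrable lborel {0<..} ?I"
      using V(2) by (rule set_integrable_cong[THEN iffD1, rotated 3]) (use IJ in auto)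
    moreover have "(LINT t:{0<..}|lborel. ?J t) = (LINT t:{0<..}|lborel. ?I t)"
      by (rule set_lebesgue_integral_cong) (use IJ in auto)
    ultimately show "integrable lborel (\<lambda>y. kappa lambda (x - y) * of_real (g y)) \<and>
          set_integrable lborel {0<..} ?I \<and> u x = 1 / 4 * (LINT t:{0<..}|lborel. ?I t)"
      using V(1,3) unfolding u by simp
  qed
qed

end
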